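(* There exists a universal constant $C>0$ such that the following holds. Let $d=2$ or $3$ and let $\Omega=\{(x',x_d):0\le x_d\le H,\ x'\in[0,W]_{\mathrm{per}}^{d-1}\}$ be a bounded periodic channel with period $W$ and height $H$ in $\mathbb R^d$. Let $\bar u$ be a static shear flow in $\Omega$ with bounded vorticity, and let $u^\nu$ be a Leray–Hopf solution to the Navier–Stokes equation $(\mathrm{NSE}_\nu)$ in $\Omega$ with viscosity $\nu>0$. Denote the maximum shear, boundary velocity, and kinetic energy of $\bar u$ by $$G:=\|\nabla\bar u\|_{L^\infty(\Omega)},\qquad A:=\|\bar u\|_{L^\infty(\partial\Omega)},\qquad E:=\|\bar u\|_{L^2(\Omega)}^2,$$ and let $\mathsf{Re}=AH/\nu$. For any $T>0$, $$\sup_{0\le t\le T}\Big\{\|u^\nu-\bar u\|_{L^2(\Omega)}^2(t)+\frac{\nu}{2}\|\nabla u^\nu\|_{L^2((0,t)\times\Omega)}^2\Big\}\le\exp(2GT)\Big\{4\|u^\nu(0)-\bar u\|_{L^2(\Omega)}^2+2\nu G^2T|\Omega|+CA^2|\Omega|\,\mathsf{Re}^{-1}\log(2+\mathsf{Re})+2\,\mathsf{Re}^{-1}E+CA^3T|\partial\Omega|\max\{H/W,1\}^2\Big\}.$$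
   Context: Static shear flow means $\bar u(x)=\bar U(x_2)e_1$ if $d=2$, and $\bar u(x)=\bar U_1(x_3)e_1+\bar U_2(x_3)e_2$ if $d=3$. The physical boundary $\partial\Omega$ consists of $\{x_d=0\}$ and $\{x_d=H\}$; $|\Omega|$ and $|\partial\Omega|$ denote respectively $d$- and $(d-1)$-dimensional measure. The equation $(\mathrm{NSE}_\nu)$ in $\Omega$ is $$\partial_t u^\nu+u^\nu\cdot\nabla u^\nu+\nabla P^\nu=\nu\Delta u^\nu,\qquad\operatorname{div}u^\nu=0\quad\text{in }(0,T)\times\Omega,\qquad u^\nu=0\ \text{for }x_d=0\text{ and }x_d=H,$$ with all functions periodic of period $W$ in each component of $x'$. A Leray–Hopf solution is a weak solution to $(\mathrm{NSE}_\nu)$ (with initial value $u^\nu(0)\in L^2(\Omega)$) which in addition verifies the energy inequality $\frac12\frac{d}{dt}\|u^\nu\|_{L^2(\Omega)}^2\le-\nu\|\nabla u^\nu\|_{L^2(\Omega)}^2$; integrated from time $0$, this gives $\frac12\|u^\nu(T)\|_{L^2(\Omega)}^2+\nu\|\nabla u^\nu\|_{L^2((0,T)\times\Omega)}^2\le\frac12\|u^\nu(0)\|_{L^2(\Omega)}^2$. *)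

theory Defs
  imports "HOL-Analysis.Analysis"
begin

text \<open>
  Throughout, \<open>v\<close> is the wall-normal coordinate (\<open>x\<^sub>d\<close>), so that one set of definitions
  serves both \<open>\<real>\<^sup>2\<close> (with \<open>v = 2\<close>) and \<open>\<real>\<^sup>3\<close> (with \<open>v = 3\<close>).
  The periodic channel is represented by one closed period cell. The other cells enter only
  through the test functions, which are periodic on the whole strip and need not vanish on the
  lateral faces of the cell: integrating against them over one cell is integration over the
  quotient, so every weak notion below is the one on the periodic channel.
\<close>

definition channel :: "'n::finite \<Rightarrow> real \<Rightarrow> real \<Rightarrow> (real^'n) set" where
  "channel v W H = {x. 0 \<le> x $ v \<and> x $ v \<le> H \<and> (\<forall>i. i \<noteq> v \<longrightarrow> 0 \<le> x $ i \<and> x $ i \<le> W)}"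

definition periodic :: "'n::finite \<Rightarrow> real \<Rightarrow> real \<Rightarrow> (real^'n \<Rightarrow> 'b) \<Rightarrow> bool" where
  "periodic v W H f \<longleftrightarrow>
     (\<forall>x i. 0 \<le> x $ v \<and> x $ v \<le> H \<and> i \<noteq> v \<longrightarrow> f (x + W *\<^sub>R axis i 1) = f x)"

text \<open>
  The \<open>(d-1)\<close>-dimensional measure on the two walls \<open>x\<^sub>d = 0\<close> and \<open>x\<^sub>d = H\<close> of one period cell.
\<close>

definition wall_measure :: "'n::finite \<Rightarrow> real \<Rightarrow> real \<Rightarrow> (real^'n) measure" where
  "wall_measure v W H =
     distr (count_space {0, H} \<Otimes>\<^sub>M (\<Pi>\<^sub>M i\<in>UNIV - {v}. restrict_space lborel {0..W})) borel
       (\<lambda>(a, y). \<chi> i. if i = v then a else y i)"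

definition L2sq :: "'a::euclidean_space set \<Rightarrow> ('a \<Rightarrow> 'b::real_normed_vector) \<Rightarrow> real" where
  "L2sq S f = (\<integral>x. (norm (f x))\<^sup>2 \<partial>lebesgue_on S)"

definition in_L2 :: "'a::euclidean_space set \<Rightarrow> ('a \<Rightarrow> 'b::euclidean_space) \<Rightarrow> bool" where
  "in_L2 S f \<longleftrightarrow> f \<in> borel_measurable (lebesgue_on S) \<and> integrable (lebesgue_on S) (\<lambda>x. (norm (f x))\<^sup>2)"

definition ess_bounded :: "'a measure \<Rightarrow> ('a \<Rightarrow> 'b::real_normed_vector) \<Rightarrow> bool" where
  "ess_bounded M f \<longleftrightarrow> (\<exists>c. AE x in M. norm (f x) \<le> c)"

text \<open>
  Unlike the library's \<open>esssup\<close>, which is infinite for functions that are not measurable on the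
  whole space of \<open>M\<close>, this does not look at the values of \<open>f\<close> off a set of full measure.
\<close>

definition Linf_norm :: "'a measure \<Rightarrow> ('a \<Rightarrow> 'b::real_normed_vector) \<Rightarrow> real" where
  "Linf_norm M f = Inf {c. 0 \<le> c \<and> (AE x in M. norm (f x) \<le> c)}"

primrec C_k :: "nat \<Rightarrow> ('a::euclidean_space \<Rightarrow> 'b::real_normed_vector) \<Rightarrow> bool" where
  "C_k 0 f \<longleftrightarrow> continuous_on UNIV f"
| "C_k (Suc k) f \<longleftrightarrow> (\<forall>x. f differentiable at x) \<and>
     (\<forall>b\<in>Basis. C_k k (\<lambda>x. frechet_derivative f (at x) b))"

definition smooth :: "('a::euclidean_space \<Rightarrow> 'b::real_normed_vector) \<Rightarrow> bool" where
  "smooth f \<longleftrightarrow> (\<forall>k. C_k k f)"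

text \<open>The gradient of a vector field has entry \<open>\<partial>\<^sub>j f\<^sub>i\<close> in row \<open>i\<close> and column \<open>j\<close>.\<close>

definition grad :: "(real^'n::finite \<Rightarrow> real^'n) \<Rightarrow> real^'n \<Rightarrow> real^'n^'n" where
  "grad f x = jacobian f (at x)"

definition divergence_free :: "(real^'n::finite \<Rightarrow> real^'n) \<Rightarrow> bool" where
  "divergence_free f \<longleftrightarrow> (\<forall>x. trace (grad f x) = 0)"

text \<open>Smooth functions on the periodic channel with compact support in \<open>0 < x\<^sub>d < H\<close>.\<close>

definition test_function ::
  "'n::finite \<Rightarrow> real \<Rightarrow> real \<Rightarrow> (real^'n \<Rightarrow> 'b::real_normed_vector) \<Rightarrow> bool" where
  "test_function v W H \<phi> \<longleftrightarrow> smooth \<phi> \<and> periodic v W H \<phi> \<and>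
     (\<exists>\<delta>>0. \<forall>x. x $ v \<le> \<delta> \<or> H - \<delta> \<le> x $ v \<longrightarrow> \<phi> x = 0)"

definition weak_gradient ::
  "'n::finite \<Rightarrow> real \<Rightarrow> real \<Rightarrow> (real^'n \<Rightarrow> real^'n) \<Rightarrow> (real^'n \<Rightarrow> real^'n^'n) \<Rightarrow> bool" where
  "weak_gradient v W H f g \<longleftrightarrow>
     integrable (lebesgue_on (channel v W H)) f \<and>
     integrable (lebesgue_on (channel v W H)) g \<and>
     (\<forall>(\<phi> :: real^'n \<Rightarrow> real) i j. test_function v W H \<phi> \<longrightarrow>
        (\<integral>x. f x $ i * frechet_derivative \<phi> (at x) (axis j 1) \<partial>lebesgue_on (channel v W H)) =
        - (\<integral>x. g x $ i $ j * \<phi> x \<partial>lebesgue_on (channel v W H)))"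

text \<open>
  \<open>f \<in> H\<^sup>1\<^sub>0\<close> with weak gradient \<open>g\<close>, where \<open>H\<^sup>1\<^sub>0\<close> is the closure in \<open>H\<^sup>1\<close> of the test functions.
  This is how the no-slip condition \<open>f = 0\<close> on the walls is imposed.
\<close>

definition H10_gradient ::
  "'n::finite \<Rightarrow> real \<Rightarrow> real \<Rightarrow> (real^'n \<Rightarrow> real^'n) \<Rightarrow> (real^'n \<Rightarrow> real^'n^'n) \<Rightarrow> bool" where
  "H10_gradient v W H f g \<longleftrightarrow>
     in_L2 (channel v W H) f \<and> in_L2 (channel v W H) g \<and> weak_gradient v W H f g \<and>
     (\<exists>\<phi>. (\<forall>k::nat. test_function v W H (\<phi> k)) \<and>
        (\<lambda>k. L2sq (channel v W H) (\<lambda>x. \<phi> k x - f x)) \<longlonglongrightarrow> 0 \<and>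
        (\<lambda>k. L2sq (channel v W H) (\<lambda>x. grad (\<phi> k) x - g x)) \<longlonglongrightarrow> 0)"

text \<open>
  For a shear flow \<open>\<Sum>i\<noteq>d. U\<^sub>i(x\<^sub>d) e\<^sub>i\<close> bounded vorticity makes the \<open>U\<^sub>i\<close> Lipschitz (after a change
  on a null set). Taking the \<open>U\<^sub>i\<close> continuous selects that representative, whose pointwise values
  on the walls are the boundary trace.
\<close>

definition shear_flow :: "'n::finite \<Rightarrow> real \<Rightarrow> (real^'n \<Rightarrow> real^'n) \<Rightarrow> bool" where
  "shear_flow v H f \<longleftrightarrow> (\<exists>U :: 'n \<Rightarrow> real \<Rightarrow> real.
     (\<forall>i. continuous_on {0..H} (U i)) \<and>
     (\<forall>x. 0 \<le> x $ v \<and> x $ v \<le> H \<longrightarrow> f x = (\<Sum>i\<in>UNIV - {v}. U i (x $ v) *\<^sub>R axis i 1)))"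

text \<open>
  The vorticity as an antisymmetric matrix; its entries are, up to sign, \<open>\<partial>\<^sub>1u\<^sub>2 - \<partial>\<^sub>2u\<^sub>1\<close> in the
  plane and the components of the curl in space.
\<close>

definition vorticity :: "(real^'n::finite \<Rightarrow> real^'n^'n) \<Rightarrow> real^'n \<Rightarrow> real^'n^'n" where
  "vorticity g x = g x - transpose (g x)"

definition shear_flow_bounded_vorticity ::
  "'n::finite \<Rightarrow> real \<Rightarrow> real \<Rightarrow> (real^'n \<Rightarrow> real^'n) \<Rightarrow> (real^'n \<Rightarrow> real^'n^'n) \<Rightarrow> bool" where
  "shear_flow_bounded_vorticity v W H f g \<longleftrightarrow>
     shear_flow v H f \<and> weak_gradient v W H f g \<and>
     ess_bounded (lebesgue_on (channel v W H)) (vorticity g)"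

text \<open>
  Divergence-free test fields with compact support in \<open>[0,T)\<close> in time and in \<open>0 < x\<^sub>d < H\<close> in space.
  They may carry a nonzero mean flux along the channel, so the pressure that they eliminate is
  periodic.
\<close>

definition solenoidal_test_field ::
  "'n::finite \<Rightarrow> real \<Rightarrow> real \<Rightarrow> real \<Rightarrow> (real \<Rightarrow> real^'n \<Rightarrow> real^'n) \<Rightarrow> bool" where
  "solenoidal_test_field v W H T \<Phi> \<longleftrightarrow>
     smooth (\<lambda>(t, x). \<Phi> t x) \<and>
     (\<forall>t. periodic v W H (\<Phi> t) \<and> divergence_free (\<Phi> t)) \<and>
     (\<exists>\<delta>>0. \<forall>t x. T - \<delta> \<le> t \<or> x $ v \<le> \<delta> \<or> H - \<delta> \<le> x $ v \<longrightarrow> \<Phi> t x = 0)"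

text \<open>
  Weak solutions of the Navier--Stokes equations on \<open>(0,T)\<close> with initial value \<open>u 0\<close>; \<open>g\<close> is the
  spatial gradient of \<open>u\<close>. The representative of \<open>u\<close> in time is the weakly continuous one, so that
  \<open>u t\<close> is meaningful for every \<open>t \<in> [0,T]\<close>. In the momentum equation
  \<open>u \<bullet> (grad \<Phi> *v u)\<close> is \<open>(u \<otimes> u) : \<nabla>\<Phi>\<close>.
\<close>

definition weak_solution ::
  "'n::finite \<Rightarrow> real \<Rightarrow> real \<Rightarrow> real \<Rightarrow> real \<Rightarrow>
   (real \<Rightarrow> real^'n \<Rightarrow> real^'n) \<Rightarrow> (real \<Rightarrow> real^'n \<Rightarrow> real^'n^'n) \<Rightarrow> bool" where
  "weak_solution v W H \<nu> T u g \<longleftrightarrow>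
     (\<forall>t\<in>{0..T}. periodic v W H (u t) \<and> in_L2 (channel v W H) (u t)) \<and>
     (\<exists>M. \<forall>t\<in>{0..T}. L2sq (channel v W H) (u t) \<le> M) \<and>
     (\<forall>\<psi> :: real^'n \<Rightarrow> real^'n. in_L2 (channel v W H) \<psi> \<longrightarrow>
        continuous_on {0..T} (\<lambda>t. \<integral>x. u t x \<bullet> \<psi> x \<partial>lebesgue_on (channel v W H))) \<and>
     in_L2 ({0..T} \<times> channel v W H) (\<lambda>(t, x). u t x) \<and>
     in_L2 ({0..T} \<times> channel v W H) (\<lambda>(t, x). g t x) \<and>
     (AE t in lebesgue_on {0..T}. H10_gradient v W H (u t) (g t) \<and>
        (AE x in lebesgue_on (channel v W H). trace (g t x) = 0)) \<and>
     (\<forall>\<Phi>. solenoidal_test_field v W H T \<Phi> \<longrightarrow>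
        (\<integral>(t, x). u t x \<bullet> vector_derivative (\<lambda>s. \<Phi> s x) (at t)
              + u t x \<bullet> (grad (\<Phi> t) x *v u t x)
              - \<nu> * (g t x \<bullet> grad (\<Phi> t) x) \<partial>lebesgue_on ({0..T} \<times> channel v W H))
        + (\<integral>x. u 0 x \<bullet> \<Phi> 0 x \<partial>lebesgue_on (channel v W H)) = 0)"

text \<open>
  The inequality \<open>1/2 d/dt \<parallel>u\<parallel>\<^sup>2 \<le> - \<nu> \<parallel>\<nabla>u\<parallel>\<^sup>2\<close> in the sense of distributions on \<open>[0,T)\<close>. Allowing
  \<open>\<theta> 0 \<noteq> 0\<close> is what permits integrating it from time \<open>0\<close>.
\<close>

definition energy_inequality ::
  "'n::finite \<Rightarrow> real \<Rightarrow> real \<Rightarrow> real \<Rightarrow> real \<Rightarrow>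
   (real \<Rightarrow> real^'n \<Rightarrow> real^'n) \<Rightarrow> (real \<Rightarrow> real^'n \<Rightarrow> real^'n^'n) \<Rightarrow> bool" where
  "energy_inequality v W H \<nu> T u g \<longleftrightarrow>
     (\<forall>\<theta> :: real \<Rightarrow> real. smooth \<theta> \<and> (\<forall>t. 0 \<le> \<theta> t) \<and> (\<exists>\<delta>>0. \<forall>t\<ge>T - \<delta>. \<theta> t = 0) \<longrightarrow>
        - (1/2) * (\<integral>t. deriv \<theta> t * L2sq (channel v W H) (u t) \<partial>lebesgue_on {0..T})
        - (1/2) * \<theta> 0 * L2sq (channel v W H) (u 0)
        \<le> - \<nu> * (\<integral>t. \<theta> t * L2sq (channel v W H) (g t) \<partial>lebesgue_on {0..T}))"

definition leray_hopf ::
  "'n::finite \<Rightarrow> real \<Rightarrow> real \<Rightarrow> real \<Rightarrow> real \<Rightarrow>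
   (real \<Rightarrow> real^'n \<Rightarrow> real^'n) \<Rightarrow> (real \<Rightarrow> real^'n \<Rightarrow> real^'n^'n) \<Rightarrow> bool" where
  "leray_hopf v W H \<nu> T u g \<longleftrightarrow>
     weak_solution v W H \<nu> T u g \<and> energy_inequality v W H \<nu> T u g"

end

theory Submission
  imports Defs
begin

text \<open>
  A shear flow is constant on each wall. Following Hopf, subtract from it a tangential boundary layer
  of width \<open>\<delta> ~ \<nu> / A\<close>, which gives a steady profile \<open>\<phi>\<close> that vanishes at the walls.
  Testing the weak formulation with \<open>\<phi>\<close> and adding the energy inequality yields a differential
  inequality for \<open>w = u - \<phi>\<close> whose only convective term is the integral of
  \<open>w\<^sub>d w \<bullet> \<phi>'\<close>, since \<open>w\<^sub>d \<phi> \<bullet> \<phi>'\<close> integrates to zero: a solenoidal field has no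
  flux across the sections \<open>{x\<^sub>d = y}\<close>. Away from the layers it is at most \<open>G |w|\<^sup>2\<close>; inside a layer
  \<open>|\<phi>'| ~ A / \<delta>\<close> on a set of width \<open>\<delta>\<close>, where \<open>w\<close> vanishes at the wall, so by
  Hardy's inequality the term is absorbed by the viscosity. The layer itself dissipates
  \<open>\<nu> A\<^sup>2 / \<delta> ~ A\<^sup>3\<close> per unit time and area of the wall, and Gronwall's inequality
  concludes. For small \<open>Re\<close> the layers do not fit into the channel, but for
  \<open>Re \<le> 1/3\<close> the energy inequality alone is enough. The weak formulation, which a priori admits smooth compactly supported
  profiles, extends to Lipschitz profiles vanishing at the walls by the lemma of du Bois-Reymond.
\<close>

section \<open>Smooth functions\<close>

text \<open>The momentum equation is only ever tested with fields \<theta>(t) \<psi>(x_v) e_i, i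
  different from v. They are solenoidal and periodic by shape, and integrating out the other
  variables leaves an identity between functions of x_v; hence the marginals and the one-variable
  lemmas. The obstacle is the low regularity of u, which is not an admissible test field itself. So
  |u - \<phi>|^2 is expanded: the square obeys the energy inequality, the cross term the weak
  formulation, with the same \<theta> in both. Weak continuity in time then gives the bound at every
  t, by lower semicontinuity of the norm. The slope of \<phi> is split: that of the shear acts on u
  - \<phi> and gives Gronwall the rate G, that of the layer acts on u, to which Hardy's inequality
  extends by density. The width \<nu> / (48 A) makes the Hardy bound of the layer term equal to
  \<nu> / 12 of the dissipation. Passing between \<phi> and the shear flow costs a factor 2 at each
  end, hence the 4 before the initial distance. The layer yields Re^(-1) and A^3 T directly; the
  logarithm and the aspect ratio are inserted by ln (2 + Re) >= 1/2 and max (H/W) 1 >= 1.\<close>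

lemma C_k_iff_derivative:
  assumes "\<And>x. (f has_derivative f' x) (at x)"
  shows "C_k (Suc k) f \<longleftrightarrow> (\<forall>b\<in>Basis. C_k k (\<lambda>x. f' x b))"
proof -
  have "frechet_derivative f (at x) = f' x" for x
    using frechet_derivative_at[OF assms[of x]] by simp
  moreover have "f differentiable at x" for x
    using assms[of x] by (auto simp: differentiable_def)
  ultimately show ?thesis by simp
qed

lemma C_k_Suc_has_derivative:
  assumes "C_k (Suc k) f"
  shows "(f has_derivative frechet_derivative f (at x)) (at x)"
  using assms by (simp add: frechet_derivative_works)

lemma C_k_SucD:
  assumes "C_k (Suc k) f"
  shows "C_k k f"
  using assms
proof (induction k arbitrary: f)
  case 0
  then show ?case
    by (auto intro!: differentiable_imp_continuous_on simp: differentiable_on_def)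
next
  case (Suc k)
  show ?case
    unfolding C_k.simps(2)[of k]
    using Suc.prems Suc.IH unfolding C_k.simps(2)[of "Suc k"] by blast
qed

lemma C_k_const: "C_k k (\<lambda>x. c)"
proof (induction k arbitrary: c)
  case (Suc k)
  then show ?case
    by (subst C_k_iff_derivative[where f' = "\<lambda>_ _. 0"]) auto
qed simp

lemma C_k_bounded_linear:
  assumes "bounded_linear f"
  shows "C_k k f"
proof (cases k)
  case 0
  then show ?thesis using assms by (simp add: linear_continuous_on)
next
  case (Suc j)
  have "C_k (Suc j) f"
    by (subst C_k_iff_derivative[where f' = "\<lambda>_. f"])
       (auto simp: C_k_const bounded_linear_imp_has_derivative assms)
  then show ?thesis using Suc by simp
qed

lemma C_k_add:
  assumes "C_k k f" "C_k k g"
  shows "C_k k (\<lambda>x. f x + g x)"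
  using assms
proof (induction k arbitrary: f g)
  case (Suc k)
  show ?case
    by (subst C_k_iff_derivative[OF has_derivative_add
          [OF C_k_Suc_has_derivative[OF Suc.prems(1)] C_k_Suc_has_derivative[OF Suc.prems(2)]]])
       (use Suc in auto)
qed (auto intro: continuous_on_add)

lemma C_k_scaleR:
  fixes f :: "'a::euclidean_space \<Rightarrow> real" and g :: "'a \<Rightarrow> 'b::real_normed_vector"
  assumes "C_k k f" "C_k k g"
  shows "C_k k (\<lambda>x. f x *\<^sub>R g x)"
  using assms
proof (induction k arbitrary: f g)
  case (Suc k)
  note IH = Suc.IH and f = Suc.prems(1) and g = Suc.prems(2)
  show ?case
  proof (subst C_k_iff_derivative[OF has_derivative_scaleR
        [OF C_k_Suc_has_derivative[OF f] C_k_Suc_has_derivative[OF g]]], intro ballI)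
    fix b :: 'a assume "b \<in> Basis"
    then show "C_k k (\<lambda>x. f x *\<^sub>R frechet_derivative g (at x) b + frechet_derivative f (at x) b *\<^sub>R g x)"
      using f g by (intro C_k_add IH C_k_SucD[OF f] C_k_SucD[OF g]) auto
  qed
qed (auto intro: continuous_on_scaleR)

lemma C_k_mult:
  fixes f g :: "'a::euclidean_space \<Rightarrow> real"
  assumes "C_k k f" "C_k k g"
  shows "C_k k (\<lambda>x. f x * g x)"
  using C_k_scaleR[OF assms] by simp

lemma C_k_prod:
  fixes f :: "'i \<Rightarrow> 'a::euclidean_space \<Rightarrow> real"
  assumes "\<And>i. i \<in> I \<Longrightarrow> C_k k (f i)"
  shows "C_k k (\<lambda>x. \<Prod>i\<in>I. f i x)"
  using assms by (induction I rule: infinite_finite_induct) (auto simp: C_k_const C_k_mult)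

lemma C_k_Suc_real:
  fixes f :: "real \<Rightarrow> real"
  assumes "\<And>x. (f has_real_derivative f' x) (at x)" "C_k k f'"
  shows "C_k (Suc k) f"
  by (subst C_k_iff_derivative[where f' = "\<lambda>x h. f' x * h"])
     (use assms in \<open>auto simp: has_field_derivative_def\<close>)

lemma C_k_compose:
  fixes h :: "real \<Rightarrow> real" and f :: "'a::euclidean_space \<Rightarrow> real"
  assumes "C_k k h" "C_k k f"
  shows "C_k k (\<lambda>x. h (f x))"
  using assms
proof (induction k arbitrary: h f)
  case 0
  then show ?case
    by (auto intro: continuous_on_compose2)
next
  case (Suc k)
  note h = Suc.prems(1) and f = Suc.prems(2)
  let ?h' = "\<lambda>y. frechet_derivative h (at y)" and ?f' = "\<lambda>x. frechet_derivative f (at x)"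
  \<comment> \<open>A linear map on the reals is multiplication by its value at 1. This turns the
    chain rule into a product of real functions, to which the induction hypothesis applies.\<close>
  have lin: "?h' y t = t * ?h' y 1" for y t
    using linear_scale[OF has_derivative_linear[OF C_k_Suc_has_derivative[OF h, of y]], of t 1]
    by simp
  show ?case
  proof (subst C_k_iff_derivative[OF has_derivative_compose
        [OF C_k_Suc_has_derivative[OF f] C_k_Suc_has_derivative[OF h]]], intro ballI)
    fix b :: 'a assume b: "b \<in> Basis"
    have "C_k k (\<lambda>x. ?f' x b * ?h' (f x) 1)"
      using b h f by (intro C_k_mult Suc.IH[of "\<lambda>y. ?h' y 1"] C_k_SucD[OF f]) auto
    then show "C_k k (\<lambda>x. ?h' (f x) (?f' x b))"
      by (subst lin)
  qed
qed

lemma smooth_const: "smooth (\<lambda>x. c)"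
  by (simp add: smooth_def C_k_const)

lemma smooth_bounded_linear: "bounded_linear f \<Longrightarrow> smooth f"
  by (simp add: smooth_def C_k_bounded_linear)

lemma smooth_add: "smooth f \<Longrightarrow> smooth g \<Longrightarrow> smooth (\<lambda>x. f x + g x)"
  by (simp add: smooth_def C_k_add)

lemma smooth_scaleR: "smooth f \<Longrightarrow> smooth g \<Longrightarrow> smooth (\<lambda>x. f x *\<^sub>R g x)"
  by (simp add: smooth_def C_k_scaleR)

lemma smooth_mult:
  fixes f g :: "'a::euclidean_space \<Rightarrow> real"
  shows "smooth f \<Longrightarrow> smooth g \<Longrightarrow> smooth (\<lambda>x. f x * g x)"
  by (simp add: smooth_def C_k_mult)

lemma smooth_diff:
  fixes f g :: "'a::euclidean_space \<Rightarrow> real"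
  assumes "smooth f" "smooth g"
  shows "smooth (\<lambda>x. f x - g x)"
  using smooth_add[OF assms(1) smooth_mult[OF smooth_const[of "-1"] assms(2)]] by simp

lemma smooth_prod:
  fixes f :: "'i \<Rightarrow> 'a::euclidean_space \<Rightarrow> real"
  shows "(\<And>i. i \<in> I \<Longrightarrow> smooth (f i)) \<Longrightarrow> smooth (\<lambda>x. \<Prod>i\<in>I. f i x)"
  by (simp add: smooth_def C_k_prod)

lemma smooth_compose:
  fixes h :: "real \<Rightarrow> real" and f :: "'a::euclidean_space \<Rightarrow> real"
  shows "smooth h \<Longrightarrow> smooth f \<Longrightarrow> smooth (\<lambda>x. h (f x))"
  by (simp add: smooth_def C_k_compose)

lemma smooth_has_derivative:
  assumes "smooth f"
  shows "(f has_derivative frechet_derivative f (at x)) (at x)"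
  using assms C_k_Suc_has_derivative[of 0 f] by (simp add: smooth_def del: C_k.simps)

lemma smooth_continuous: "smooth f \<Longrightarrow> continuous_on S f"
  by (meson smooth_has_derivative has_derivative_at_withinI has_derivative_continuous_on)

lemma smooth_continuous_derivative:
  assumes "smooth f" "b \<in> Basis"
  shows "continuous_on S (\<lambda>x. frechet_derivative f (at x) b)"
proof -
  have "C_k (Suc 0) f" using assms(1) unfolding smooth_def by blast
  then show ?thesis using assms(2) by (auto intro: continuous_on_subset)
qed

lemma smooth_has_real_derivative:
  fixes f :: "real \<Rightarrow> real"
  assumes "smooth f"
  shows "(f has_real_derivative deriv f x) (at x)"
  using smooth_has_derivative[OF assms] field_differentiable_derivI
  by (metis differentiable_def field_differentiable_def real_differentiable_def DERIV_deriv_iff_real_differentiable)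

lemma smooth_continuous_deriv:
  fixes f :: "real \<Rightarrow> real"
  assumes "smooth f"
  shows "continuous_on S (deriv f)"
proof -
  have "deriv f x = frechet_derivative f (at x) 1" for x
    using has_derivative_unique[OF smooth_has_derivative[OF assms]
        smooth_has_real_derivative[OF assms, unfolded has_field_derivative_def], of x] by simp
  then show ?thesis
    using smooth_continuous_derivative[OF assms, of 1 S] by simp
qed

lemma bounded_on_Icc:
  fixes f :: "real \<Rightarrow> real"
  assumes "continuous_on {a..b} f"
  shows "\<exists>K. \<forall>y\<in>{a..b}. \<bar>f y\<bar> \<le> K"
  using compact_imp_bounded[OF compact_continuous_image[OF assms]] by (auto simp: bounded_iff)

lemma smooth_borel_measurable: "smooth f \<Longrightarrow> f \<in> borel_measurable borel" for f :: "real \<Rightarrow> real"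
  by (intro borel_measurable_continuous_onI smooth_continuous)

text \<open>Order k of the derivative gives order k + 1 of the antiderivative, and
  \<open>C_k_SucD\<close> discards the surplus. It makes primitives of bumps admissible in the lemma
  of du Bois-Reymond.\<close>

lemma smooth_antiderivative:
  fixes f F :: "real \<Rightarrow> real"
  assumes "\<And>x. (F has_real_derivative f x) (at x)" "smooth f"
  shows "smooth F"
  unfolding smooth_def
proof
  fix k show "C_k k F"
    using C_k_SucD[OF C_k_Suc_real[OF assms(1)]] assms(2) by (simp add: smooth_def)
qed

text \<open>\<open>cos\<close> and \<open>sin\<close> go through the induction together, each being
  the derivative of the other up to sign.\<close>

lemma smooth_cos: "smooth (cos :: real \<Rightarrow> real)"
proof -
  have "C_k k (cos :: real \<Rightarrow> real) \<and> C_k k (sin :: real \<Rightarrow> real)" for k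
  proof (induction k)
    case (Suc k)
    have "C_k k (\<lambda>x::real. - sin x)"
      using C_k_mult[OF C_k_const[of k "-1"] conjunct2[OF Suc]] by simp
    then show ?case
      using Suc by (auto intro!: C_k_Suc_real[of cos "\<lambda>x. - sin x"] C_k_Suc_real[of sin cos]
          derivative_eq_intros simp del: C_k.simps)
  qed (auto intro!: continuous_intros)
  then show ?thesis by (simp add: smooth_def)
qed

section \<open>Smooth ramps built from exp(-1/s)\<close>

text \<open>The functions s^(-k) exp(-1/s), extended by 0. A whole family is taken so that
  smoothness follows by induction: the derivative of a member is a combination of the next two, and
  no formula for higher derivatives is required.\<close>

definition flat_exp :: "nat \<Rightarrow> real \<Rightarrow> real" where
  "flat_exp k s = (if 0 < s then (1 / s) ^ k * exp (- (1 / s)) else 0)"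

text \<open>In the variable 1/s this is the decay of a power against the exponential at
  infinity.\<close>

lemma flat_exp_tendsto_0: "(flat_exp k \<longlongrightarrow> 0) (at 0)"
proof -
  have "((\<lambda>s::real. inverse s ^ k / exp (inverse s)) \<longlongrightarrow> 0) (at_right 0)"
    by (rule filterlim_compose[OF tendsto_power_div_exp_0 filterlim_inverse_at_top_right])
  then have "(flat_exp k \<longlongrightarrow> 0) (at_right 0)"
    by (rule Lim_transform_eventually)
       (auto simp: eventually_at_filter flat_exp_def exp_minus field_simps)
  moreover have "(flat_exp k \<longlongrightarrow> 0) (at_left 0)"
    by (rule tendsto_eventually) (auto simp: eventually_at_filter flat_exp_def)
  ultimately show ?thesis by (simp add: filterlim_at_split)
qed

lemma flat_exp_has_derivative:
  "(flat_exp k has_real_derivative flat_exp (k + 2) s - k * flat_exp (k + 1) s) (at s)"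
proof (cases "s = 0")
  case True
  \<comment> \<open>At 0 the difference quotient of \<open>flat_exp k\<close> is
    \<open>flat_exp (Suc k)\<close>, which tends to 0.\<close>
  have "(flat_exp k has_real_derivative 0) (at 0)"
    unfolding has_field_derivative_iff
    by (rule Lim_transform_eventually[OF flat_exp_tendsto_0[of "Suc k"]])
       (auto simp: eventually_at_filter flat_exp_def)
  then show ?thesis using True by (simp add: flat_exp_def)
next
  case False
  show ?thesis
  proof (cases "0 < s")
    case True
    have "((\<lambda>s. (1 / s) ^ k * exp (- (1 / s))) has_real_derivative
        flat_exp (k + 2) s - k * flat_exp (k + 1) s) (at s)"
    proof -
      have inv: "((\<lambda>s. 1 / s) has_real_derivative - ((1 / s) ^ 2)) (at s)"
        using True by (auto intro!: derivative_eq_intros simp: power2_eq_square)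
      have "((\<lambda>s. (1 / s) ^ k) has_real_derivative - real k * (1 / s) ^ (k + 1)) (at s)"
        by (rule DERIV_cong[OF DERIV_power[OF inv]]) (cases k, auto simp: power2_eq_square divide_simps)
      moreover have "((\<lambda>s. exp (- (1 / s))) has_real_derivative (1 / s) ^ 2 * exp (- (1 / s))) (at s)"
        by (rule derivative_eq_intros inv refl)+ simp
      ultimately have "((\<lambda>s. (1 / s) ^ k * exp (- (1 / s))) has_real_derivative
          - real k * (1 / s) ^ (k + 1) * exp (- (1 / s)) + (1 / s) ^ 2 * exp (- (1 / s)) * (1 / s) ^ k) (at s)"
        by (rule DERIV_mult)
      then show ?thesis
        by (rule DERIV_cong) (use True in \<open>simp add: flat_exp_def power_add power2_eq_square mult_ac\<close>)
    qed
    then show ?thesis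
      by (rule has_field_derivative_transform_within_open[of _ _ _ "{0<..}"])
        (use True in \<open>auto simp: flat_exp_def\<close>)
  next
    case neg: False
    have "((\<lambda>s. 0) has_real_derivative flat_exp (k + 2) s - k * flat_exp (k + 1) s) (at s)"
      using neg by (simp add: flat_exp_def)
    then show ?thesis
      by (rule has_field_derivative_transform_within_open[of _ _ _ "{..<0}"])
        (use neg False in \<open>auto simp: flat_exp_def\<close>)
  qed
qed

lemma smooth_flat_exp: "smooth (flat_exp k)"
proof -
  have "C_k n (flat_exp k)" for n k
  proof (induction n arbitrary: k)
    case 0
    show ?case
      using DERIV_isCont[OF flat_exp_has_derivative[of k]] by (simp add: continuous_at_imp_continuous_on)
  next
    case (Suc n)
    have "C_k n (\<lambda>s. flat_exp (k + 2) s + (- real k) * flat_exp (k + 1) s)"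
      by (intro C_k_add C_k_mult C_k_const Suc)
    then show ?case
      by (intro C_k_Suc_real[OF flat_exp_has_derivative]) simp
  qed
  then show ?thesis by (simp add: smooth_def)
qed

text \<open>This ramp has no plateau: it approaches 1 only at infinity. Indicators are therefore
  approximated by stretching its argument, not by cutting off.\<close>

abbreviation ramp :: "real \<Rightarrow> real" where
  "ramp \<equiv> flat_exp 0"

lemma ramp_bounds: "0 \<le> ramp s" "ramp s \<le> 1" "s \<le> 0 \<Longrightarrow> ramp s = 0"
  by (auto simp: flat_exp_def)

lemma ramp_mono: "s \<le> t \<Longrightarrow> ramp s \<le> ramp t"
  by (auto simp: flat_exp_def frac_le)

text \<open>Stretching by n turns the ramp into a Heaviside function. A shift c > 0 leaves the limit
  unchanged but makes the n-th approximant vanish for s up to c / n, which provides supports at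
  positive distance from the boundary.\<close>

lemma ramp_scaled_tendsto:
  assumes "0 \<le> c"
  shows "(\<lambda>n. ramp (real n * s - c)) \<longlonglongrightarrow> (if 0 < s then 1 else 0)"
proof (cases "0 < s")
  case True
  have lim: "filterlim (\<lambda>n. real n * s - c) at_top sequentially"
  proof -
    have "filterlim (\<lambda>n. - c + real n * s) at_top sequentially"
      by (intro filterlim_tendsto_add_at_top[OF tendsto_const]
          filterlim_at_top_mult_tendsto_pos[OF tendsto_const True] filterlim_real_sequentially)
    then show ?thesis by (simp add: add.commute)
  qed
  have "(\<lambda>n. exp (- inverse (real n * s - c))) \<longlonglongrightarrow> exp (- 0)"
    by (intro tendsto_intros tendsto_inverse_0_at_top lim)
  moreover have "\<forall>\<^sub>F n in sequentially. exp (- inverse (real n * s - c)) = ramp (real n * s - c)"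
    using eventually_compose_filterlim[OF eventually_gt_at_top[of 0] lim]
    by eventually_elim (simp add: flat_exp_def divide_inverse)
  ultimately show ?thesis using True by (simp add: Lim_transform_eventually)
next
  case False
  have "ramp (real n * s - c) = 0" for n
    using False assms mult_nonneg_nonpos[of "real n" s] by (intro ramp_bounds(3)) auto
  then show ?thesis using False by simp
qed

section \<open>Lebesgue measure along coordinate lines\<close>

text \<open>Open boxes are stable under intersection and generate the Borel sets, so a Dynkin
  argument extends the vanishing of the integrals from boxes to all Borel sets. A function whose
  integrals over all these sets vanish is null.\<close>

lemma AE_eq_0_if_box_integrals_0:
  fixes f :: "'a::euclidean_space \<Rightarrow> real"
  assumes f: "integrable lborel f" and box: "\<And>c d. (\<integral>x. indicator (box c d) x * f x \<partial>lborel) = 0"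
  shows "AE x in lborel. f x = 0"
proof (rule sigma_finite_measure.density_zero[OF lborel.sigma_finite_measure_axioms f])
  have int: "set_integrable lborel A f" if "A \<in> sets borel" for A
    using integrable_mult_indicator[OF _ f, of A] that by (simp add: set_integrable_def)
  \<comment> \<open>The whole space is not a box, yet the step to complements needs its integral. It
    is exhausted by growing boxes.\<close>
  have total: "(\<integral>x. f x \<partial>lborel) = 0"
  proof -
    have "(\<lambda>n. \<integral>x. indicator (box (- real n *\<^sub>R One) (real n *\<^sub>R One)) x * f x \<partial>lborel) \<longlonglongrightarrow> (\<integral>x. f x \<partial>lborel)"
    proof (rule integral_dominated_convergence[where w = "\<lambda>x. norm (f x)"])
      show "AE x in lborel. (\<lambda>n. indicator (box (- real n *\<^sub>R One) (real n *\<^sub>R One)) x * f x) \<longlonglongrightarrow> f x"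
      proof
        fix x :: 'a
        obtain n0 where n0: "norm x < real n0" using reals_Archimedean2 by blast
        have "x \<in> box (- real n *\<^sub>R One) (real n *\<^sub>R One)" if "n \<ge> n0" for n
        proof -
          have "- real n < x \<bullet> i \<and> x \<bullet> i < real n" if "i \<in> Basis" for i
            using Basis_le_norm[OF that, of x] n0 \<open>n \<ge> n0\<close> by linarith
          then show ?thesis by (auto simp: mem_box)
        qed
        then have "\<forall>\<^sub>F n in sequentially. indicator (box (- real n *\<^sub>R One) (real n *\<^sub>R One)) x * f x = f x"
          by (auto simp: eventually_sequentially intro!: exI[of _ n0])
        then show "(\<lambda>n. indicator (box (- real n *\<^sub>R One) (real n *\<^sub>R One)) x * f x) \<longlonglongrightarrow> f x"
          by (rule tendsto_eventually)
      qed
    qed (use f in \<open>auto simp: indicator_def\<close>)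
    then have "(\<lambda>n::nat. 0 :: real) \<longlonglongrightarrow> (\<integral>x. f x \<partial>lborel)"
      unfolding box .
    then show ?thesis by (simp add: LIMSEQ_const_iff)
  qed
  have borel: "sets (borel :: 'a measure) = sigma_sets UNIV (range (\<lambda>(a, b). box a b))"
    by (subst borel_eq_box) (simp add: sets_measure_of)
  fix A :: "'a set" assume "A \<in> sets lborel"
  then have A: "A \<in> sigma_sets UNIV (range (\<lambda>(a, b). box a b))"
    by (simp add: borel)
  have sets: "B \<in> sets borel" if "B \<in> sigma_sets UNIV (range (\<lambda>(a, b). box a b))" for B :: "'a set"
    using that by (simp add: borel)
  have "Int_stable (range (\<lambda>(a, b). box a b) :: 'a set set)"
  proof (rule Int_stableI_image)
    fix i j :: "'a \<times> 'a"
    obtain p q where "box (fst i) (snd i) \<inter> box (fst j) (snd j) = box p q"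
      using box_Int_box[of "fst i" "snd i" "fst j" "snd j"] by blast
    then show "\<exists>k\<in>UNIV. (case i of (a, b) \<Rightarrow> box a b) \<inter> (case j of (a, b) \<Rightarrow> box a b) = (case k of (a, b) \<Rightarrow> box a b)"
      unfolding case_prod_beta' by (intro bexI[of _ "(p, q)"]) simp_all
  qed
  then show "set_lebesgue_integral lborel A f = 0"
  proof (rule sigma_sets_induct_disjoint[OF _ _ A])
    fix B assume "B \<in> (range (\<lambda>(a, b). box a b) :: 'a set set)"
    then show "set_lebesgue_integral lborel B f = 0"
      using box by (auto simp: set_lebesgue_integral_def)
  next
    fix B assume B: "B \<in> sigma_sets UNIV (range (\<lambda>(a, b). box a b) :: 'a set set)" "set_lebesgue_integral lborel B f = 0"
    have "set_lebesgue_integral lborel (B \<union> (UNIV - B)) f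
        = set_lebesgue_integral lborel B f + set_lebesgue_integral lborel (UNIV - B) f"
      using sets[OF B(1)] by (intro set_integral_Un int) auto
    then show "set_lebesgue_integral lborel (UNIV - B) f = 0"
      using total B(2) by (simp add: set_lebesgue_integral_def)
  next
    fix B :: "nat \<Rightarrow> 'a set"
    assume B: "disjoint_family B" "range B \<subseteq> sigma_sets UNIV (range (\<lambda>(a, b). box a b))"
      "\<And>i. set_lebesgue_integral lborel (B i) f = 0"
    have "set_lebesgue_integral lborel (\<Union>i. B i) f = (\<Sum>i. set_lebesgue_integral lborel (B i) f)"
    proof (rule lebesgue_integral_countable_add)
      have Bi: "B i \<in> sets borel" for i
        using B(2) by (intro sets) blast
      then show "\<And>i. B i \<in> sets lborel" by simp
      show "set_integrable lborel (\<Union>i. B i) f"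
        by (intro int sets.countable_UN) (use Bi in blast)
      show "\<And>i j. i \<noteq> j \<Longrightarrow> B i \<inter> B j = {}"
        using B(1) by (auto simp: disjoint_family_on_def)
    qed
    then show "set_lebesgue_integral lborel (\<Union>i. B i) f = 0"
      using B(3) by simp
  qed (auto simp: set_lebesgue_integral_def)
qed

section \<open>Fubini in one coordinate direction\<close>

abbreviation hyperplane_measure :: "'a::euclidean_space \<Rightarrow> ('a \<Rightarrow> real) measure" where
  "hyperplane_measure b \<equiv> (\<Pi>\<^sub>M c\<in>Basis - {b}. lborel)"

definition on_line :: "'a::euclidean_space \<Rightarrow> ('a \<Rightarrow> real) \<Rightarrow> real \<Rightarrow> 'a" where
  "on_line b z s = (\<Sum>c\<in>Basis - {b}. z c *\<^sub>R c) + s *\<^sub>R b"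

lemma on_line_measurable [measurable]:
  "(\<lambda>(z, s). on_line b z s) \<in> hyperplane_measure b \<Otimes>\<^sub>M lborel \<rightarrow>\<^sub>M borel"
  unfolding on_line_def case_prod_beta' by measurable

lemma on_line_inner:
  assumes "b \<in> Basis"
  shows "on_line b z s \<bullet> b = s"
    and "c \<in> Basis \<Longrightarrow> c \<noteq> b \<Longrightarrow> on_line b z s \<bullet> c = z c"
  using assms
  by (auto simp: on_line_def inner_add_left inner_sum_left inner_Basis sum.delta if_distrib[of "\<lambda>x. _ * x"] cong: if_cong)

lemma on_line_shift: "on_line b z (s + t) = on_line b z s + t *\<^sub>R b"
  by (simp add: on_line_def scaleR_add_left)

lemma sigma_finite_hyperplane: "sigma_finite_measure (hyperplane_measure b)"
proof -
  interpret product_sigma_finite "\<lambda>_. lborel :: real measure"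
    by standard
  show ?thesis by (rule sigma_finite) simp
qed

lemma pair_sigma_finite_hyperplane: "pair_sigma_finite (hyperplane_measure b) (lborel :: real measure)"
  unfolding pair_sigma_finite_def
  using sigma_finite_hyperplane by (auto intro: lborel.sigma_finite_measure_axioms)

text \<open>By construction \<open>lborel\<close> is the image of a product of one-dimensional
  measures over \<open>Basis\<close>; the factor belonging to b is split off. Integration along
  coordinate lines and over hyperplanes both rest on this.\<close>

lemma lborel_eq_distr_on_line:
  fixes b :: "'a::euclidean_space"
  assumes b: "b \<in> Basis"
  shows "lborel = distr (hyperplane_measure b \<Otimes>\<^sub>M lborel) borel (\<lambda>(z, s). on_line b z s)" (is "_ = ?D")
proof (rule measure_eqI)
  interpret product_sigma_finite "\<lambda>_. lborel :: real measure"
    by standard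
  interpret P: pair_sigma_finite "hyperplane_measure b" "lborel :: real measure"
    by (rule pair_sigma_finite_hyperplane)
  fix A :: "'a set" assume "A \<in> sets lborel"
  then have A [measurable]: "A \<in> sets borel" by simp
  have Basis: "Basis = insert b (Basis - {b})" using b by auto
  have "emeasure lborel A = (\<integral>\<^sup>+x. indicator A x \<partial>lborel)" by simp
  also have "\<dots> = (\<integral>\<^sup>+f. indicator A (\<Sum>c\<in>Basis. f c *\<^sub>R c) \<partial>(\<Pi>\<^sub>M b\<in>Basis. lborel))"
    unfolding lborel_eq[where 'a='a] by (subst nn_integral_distr) auto
  also have "\<dots> = (\<integral>\<^sup>+f. indicator A (\<Sum>c\<in>Basis. f c *\<^sub>R c) \<partial>(\<Pi>\<^sub>M b\<in>insert b (Basis - {b}). lborel))"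
    using Basis by simp
  also have "\<dots> = (\<integral>\<^sup>+z. \<integral>\<^sup>+s. indicator A (\<Sum>c\<in>Basis. (z(b := s)) c *\<^sub>R c) \<partial>lborel \<partial>hyperplane_measure b)"
    using b by (intro product_nn_integral_insert) (auto simp: insert_absorb)
  also have "\<dots> = (\<integral>\<^sup>+z. \<integral>\<^sup>+s. indicator A (on_line b z s) \<partial>lborel \<partial>hyperplane_measure b)"
  proof -
    have "(\<Sum>c\<in>Basis. (z(b := s)) c *\<^sub>R c) = on_line b z s" for z s
      using b unfolding on_line_def by (subst sum.remove[OF _ b]) (auto simp: add.commute intro!: sum.cong)
    then show ?thesis by simp
  qed
  also have "\<dots> = (\<integral>\<^sup>+p. indicator A (case p of (z, s) \<Rightarrow> on_line b z s) \<partial>(hyperplane_measure b \<Otimes>\<^sub>M lborel))"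
    using lborel.nn_integral_fst[of "\<lambda>p. indicator A (case p of (z, s) \<Rightarrow> on_line b z s)" "hyperplane_measure b"]
    by simp
  also have "\<dots> = (\<integral>\<^sup>+x. indicator A x \<partial>?D)"
    by (subst nn_integral_distr) auto
  finally show "emeasure lborel A = emeasure ?D A" by simp
qed simp

lemma integrable_on_line:
  fixes b :: "'a::euclidean_space" and f :: "'a \<Rightarrow> real"
  assumes b: "b \<in> Basis" and f: "integrable lborel f"
  shows "integrable (hyperplane_measure b \<Otimes>\<^sub>M lborel) (\<lambda>(z, s). f (on_line b z s))"
proof -
  have [measurable]: "f \<in> borel_measurable borel" using f by auto
  show ?thesis
    using f unfolding lborel_eq_distr_on_line[OF b]
    by (subst (asm) integrable_distr_eq) (auto simp: case_prod_beta')
qed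

lemma integral_on_line:
  fixes b :: "'a::euclidean_space" and f :: "'a \<Rightarrow> real"
  assumes b: "b \<in> Basis" and f: "integrable lborel f"
  shows "(\<integral>x. f x \<partial>lborel) = (\<integral>z. \<integral>s. f (on_line b z s) \<partial>lborel \<partial>hyperplane_measure b)"
proof -
  interpret P: pair_sigma_finite "hyperplane_measure b" "lborel :: real measure"
    by (rule pair_sigma_finite_hyperplane)
  have [measurable]: "f \<in> borel_measurable borel" using f by auto
  have "(\<integral>x. f x \<partial>lborel) = (\<integral>p. f (case p of (z, s) \<Rightarrow> on_line b z s) \<partial>(hyperplane_measure b \<Otimes>\<^sub>M lborel))"
    by (subst lborel_eq_distr_on_line[OF b], subst integral_distr) auto
  also have "\<dots> = (\<integral>z. \<integral>s. f (on_line b z s) \<partial>lborel \<partial>hyperplane_measure b)"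
    using P.integral_fst'[OF integrable_on_line[OF b f, unfolded case_prod_beta']] by (simp add: case_prod_beta')
  finally show ?thesis .
qed

text \<open>The density on the real line of the image of f dx under the map taking x to its
  coordinate x \<bullet> b. For integrable f, the default value 0 of a divergent integral concerns
  only a null set of y.\<close>

definition marginal :: "'a::euclidean_space \<Rightarrow> ('a \<Rightarrow> real) \<Rightarrow> real \<Rightarrow> real" where
  "marginal b f y = (\<integral>z. f (on_line b z y) \<partial>hyperplane_measure b)"

lemma integrable_marginal:
  assumes "b \<in> Basis" "integrable lborel f"
  shows "integrable lborel (marginal b f)"
proof -
  interpret P: pair_sigma_finite "hyperplane_measure b" "lborel :: real measure"
    by (rule pair_sigma_finite_hyperplane)
  show ?thesis
    using P.integrable_snd[of "\<lambda>z s. f (on_line b z s)"] integrable_on_line[OF assms]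
    by (simp add: marginal_def[abs_def])
qed

lemma marginal_eq_0:
  assumes "b \<in> Basis" "\<And>x. x \<bullet> b = y \<Longrightarrow> f x = 0"
  shows "marginal b f y = 0"
  using assms(2) by (simp add: marginal_def on_line_inner[OF assms(1)])

text \<open>Fubini, as q is constant on the hyperplanes orthogonal to b. It turns every pairing with
  a function of the wall-normal coordinate into an integral in one variable.\<close>

lemma integral_marginal:
  fixes b :: "'a::euclidean_space" and f :: "'a \<Rightarrow> real" and q :: "real \<Rightarrow> real"
  assumes b: "b \<in> Basis" and f: "integrable lborel f"
    and [measurable]: "q \<in> borel_measurable borel" and q: "\<And>y. \<bar>q y\<bar> \<le> c"
  shows "(\<integral>x. f x * q (x \<bullet> b) \<partial>lborel) = (\<integral>y. marginal b f y * q y \<partial>lborel)"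
proof -
  interpret P: pair_sigma_finite "hyperplane_measure b" "lborel :: real measure"
    by (rule pair_sigma_finite_hyperplane)
  have [measurable]: "f \<in> borel_measurable borel" using f by auto
  have int: "integrable lborel (\<lambda>x. f x * q (x \<bullet> b))"
  proof (rule Bochner_Integration.integrable_bound[of _ "\<lambda>x. c * norm (f x)"])
    show "AE x in lborel. norm (f x * q (x \<bullet> b)) \<le> norm (c * norm (f x))"
      using mult_right_mono[OF q abs_ge_zero] order.trans[OF abs_ge_zero q]
      by (auto simp: abs_mult mult.commute[of "\<bar>f _\<bar>"])
  qed (use f in auto)
  have "(\<integral>x. f x * q (x \<bullet> b) \<partial>lborel) = (\<integral>p. f (case p of (z, s) \<Rightarrow> on_line b z s) * q (snd p) \<partial>(hyperplane_measure b \<Otimes>\<^sub>M lborel))"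
    by (subst lborel_eq_distr_on_line[OF b], subst integral_distr)
       (auto simp: case_prod_beta' on_line_inner[OF b])
  also have "\<dots> = (\<integral>s. \<integral>z. f (on_line b z s) * q s \<partial>hyperplane_measure b \<partial>lborel)"
    using P.integral_snd[of "\<lambda>z s. f (on_line b z s) * q s"] integrable_on_line[OF b int]
    by (simp add: case_prod_beta' on_line_inner[OF b])
  finally show ?thesis
    by (simp add: marginal_def)
qed

section \<open>Borel representatives of Lebesgue measurable functions\<close>

text \<open>The weak notions are stated with \<open>lebesgue_on\<close>, whereas Fubini is available
  for Borel functions on products of \<open>lborel\<close>. Representatives are chosen for each
  component and assembled; the extension by 0 moves integrals over S to the whole space.\<close>

lemma lebesgue_on_borel_representative:
  fixes f :: "'a::euclidean_space \<Rightarrow> 'b::euclidean_space"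
  assumes S: "S \<in> sets borel" and f: "f \<in> borel_measurable (lebesgue_on S)"
  obtains f' where "f' \<in> borel_measurable borel" "AE x in lborel. x \<in> S \<longrightarrow> f' x = f x" "\<And>x. x \<notin> S \<Longrightarrow> f' x = 0"
proof -
  have S': "S \<in> sets lebesgue" using S by simp
  have "(\<lambda>x. if x \<in> S then f x else 0) \<in> borel_measurable lebesgue"
    using f S' by (simp add: borel_measurable_if)
  then have "\<exists>g'\<in>borel_measurable lborel. AE x in lborel. (if x \<in> S then f x else 0) \<bullet> i = g' x" for i
    by (intro completion_ex_borel_measurable_real) auto
  then have "\<forall>i. \<exists>g'. g' \<in> borel_measurable borel \<and> (AE x in lborel. (if x \<in> S then f x else 0) \<bullet> i = g' x)"
    by (auto simp: Bex_def)
  from choice[OF this] obtain g where g: "\<And>i. g i \<in> borel_measurable borel"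
    "\<And>i. AE x in lborel. (if x \<in> S then f x else 0) \<bullet> i = g i x"
    by blast
  define f' where "f' x = indicator S x *\<^sub>R (\<Sum>i\<in>Basis. g i x *\<^sub>R i)" for x
  show thesis
  proof
    show "f' \<in> borel_measurable borel"
      unfolding f'_def using g S by measurable
    have "AE x in lborel. \<forall>i\<in>Basis. (if x \<in> S then f x else 0) \<bullet> i = g i x"
      using g(2) by (intro AE_finite_allI) auto
    then show "AE x in lborel. x \<in> S \<longrightarrow> f' x = f x"
    proof eventually_elim
      case (elim x)
      then show ?case
        unfolding f'_def by (subst euclidean_representation[of "f x", symmetric]) auto
    qed
  qed (simp add: f'_def)
qed

lemma lebesgue_on_eq_lborel:
  fixes f :: "'a::euclidean_space \<Rightarrow> real"
  assumes S: "S \<in> sets borel" and f': "f' \<in> borel_measurable borel" "\<And>x. x \<notin> S \<Longrightarrow> f' x = 0"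
    and ae: "AE x in lborel. x \<in> S \<longrightarrow> f' x = f x"
  shows "integrable (lebesgue_on S) f \<longleftrightarrow> integrable lborel f'"
    and "(\<integral>x. f x \<partial>lebesgue_on S) = (\<integral>x. f' x \<partial>lborel)"
proof -
  have AE: "AE x in lebesgue. f' x = indicator S x *\<^sub>R f x"
    using AE_completion[OF ae] by eventually_elim (use f'(2) in \<open>auto simp: indicator_def\<close>)
  have f'_leb: "f' \<in> borel_measurable lebesgue"
    using f'(1) by (simp add: measurable_completion)
  have if_leb: "(\<lambda>x. indicator S x *\<^sub>R f x) \<in> borel_measurable lebesgue"
    by (rule borel_measurable_AE[OF f'_leb AE])
  have "integrable (lebesgue_on S) f \<longleftrightarrow> integrable lebesgue (\<lambda>x. indicator S x *\<^sub>R f x)"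
    using S by (intro integrable_restrict_space) simp
  also have "\<dots> \<longleftrightarrow> integrable lebesgue f'"
    by (rule integrable_cong_AE[OF if_leb f'_leb]) (use AE in \<open>auto elim: AE_mp\<close>)
  also have "\<dots> \<longleftrightarrow> integrable lborel f'"
    using f' by (intro integrable_completion) auto
  finally show "integrable (lebesgue_on S) f \<longleftrightarrow> integrable lborel f'" .
  have "(\<integral>x. f x \<partial>lebesgue_on S) = (\<integral>x. indicator S x *\<^sub>R f x \<partial>lebesgue)"
    using S by (intro integral_restrict_space) simp
  also have "\<dots> = (\<integral>x. f' x \<partial>lebesgue)"
    by (rule integral_cong_AE[OF if_leb f'_leb]) (use AE in \<open>auto elim: AE_mp\<close>)
  also have "\<dots> = (\<integral>x. f' x \<partial>lborel)"
    using f' by (intro integral_completion) auto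
  finally show "(\<integral>x. f x \<partial>lebesgue_on S) = (\<integral>x. f' x \<partial>lborel)" .
qed

lemma AE_lebesgue_on_iff:
  assumes "S \<in> sets borel"
  shows "(AE x in lebesgue_on S. P x) \<longleftrightarrow> (AE x in lborel. x \<in> S \<longrightarrow> P x)"
  using assms by (subst AE_restrict_space_iff) (auto simp: AE_completion_iff)

section \<open>The lemma of du Bois-Reymond\<close>

text \<open>The profiles \<psi> for which \<psi>(x_v) is a test function on the channel, whatever
  the dimension.\<close>

definition bump :: "real \<Rightarrow> (real \<Rightarrow> real) \<Rightarrow> bool" where
  "bump H \<psi> \<longleftrightarrow> smooth \<psi> \<and> (\<exists>\<delta>>0. \<forall>y. y \<le> \<delta> \<or> H - \<delta> \<le> y \<longrightarrow> \<psi> y = 0)"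

text \<open>For c \<le> d the product (y - c) (d - y) is positive exactly on the open interval, so
  its stretched ramps approximate the indicator. The shift by 1 keeps the support away from c and
  d.\<close>

definition box_ramp :: "real \<Rightarrow> real \<Rightarrow> nat \<Rightarrow> real \<Rightarrow> real" where
  "box_ramp c d n y = ramp (real n * ((y - c) * (d - y)) - 1)"

lemma smooth_box_ramp: "smooth (box_ramp c d n)"
  unfolding box_ramp_def
  by (intro smooth_compose[OF smooth_flat_exp] smooth_diff smooth_mult smooth_const
      smooth_bounded_linear bounded_linear_ident)

lemma box_ramp_bounds: "0 \<le> box_ramp c d n y" "box_ramp c d n y \<le> 1"
  by (auto simp: box_ramp_def ramp_bounds)

lemma box_ramp_tendsto: "c \<le> d \<Longrightarrow> (\<lambda>n. box_ramp c d n y) \<longlonglongrightarrow> indicator {c<..<d} y"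
  using ramp_scaled_tendsto[of 1 "(y - c) * (d - y)"]
  by (auto simp: box_ramp_def zero_less_mult_iff indicator_def split: if_splits)

lemma bump_box_ramp:
  assumes "0 \<le> c" "c \<le> d" "d \<le> H" "0 < H"
  shows "bump H (box_ramp c d n)"
  unfolding bump_def
proof (intro conjI smooth_box_ramp exI[of _ "1 / ((n + 1) * H)"] allI impI)
  \<comment> \<open>Within this distance of a wall, and between c and d, one factor of (y - c) (d -
    y) is at most \<delta> and the other at most H, so n times the product is at most n / (n + 1).
    Taking n + 1 also covers n = 0.\<close>
  let ?\<delta> = "1 / (real (n + 1) * H)"
  show pos: "0 < ?\<delta>" using assms by simp
  have "?\<delta> * H = 1 / (real n + 1)"
    using assms by (simp add: field_simps) (smt (verit) mult_nonneg_nonneg of_nat_0_le_iff)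
  then have \<delta>: "real n * (?\<delta> * H) \<le> 1" by simp
  fix y assume y: "y \<le> ?\<delta> \<or> H - ?\<delta> \<le> y"
  have "real n * ((y - c) * (d - y)) \<le> 1"
  proof (cases "c < y \<and> y < d")
    case True
    have "(y - c) * (d - y) \<le> ?\<delta> * H"
    proof (cases "y \<le> ?\<delta>")
      case False
      then have "(y - c) * (d - y) \<le> H * ?\<delta>"
        using y True assms by (intro mult_mono) linarith+
      then show ?thesis by (simp only: mult.commute)
    next
      case True
      then show ?thesis
        using \<open>c < y \<and> y < d\<close> assms pos by (intro mult_mono) linarith+
    qed
    then show ?thesis using \<delta> by (meson mult_left_mono of_nat_0_le_iff order.trans)
  next
    case False
    then have "(y - c) * (d - y) \<le> 0"
      using assms by (auto simp: mult_le_0_iff)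
    then show ?thesis using mult_nonneg_nonpos[of "real n"] by (smt (verit) of_nat_0_le_iff)
  qed
  then show "box_ramp c d n y = 0"
    unfolding box_ramp_def by (intro ramp_bounds(3)) simp
qed

lemma bump_bounded:
  assumes "bump H \<psi>"
  obtains K where "\<And>y. \<bar>\<psi> y\<bar> \<le> K" "0 \<le> K"
proof -
  obtain \<delta> where \<delta>: "\<delta> > 0" "\<And>y. y \<le> \<delta> \<or> H - \<delta> \<le> y \<Longrightarrow> \<psi> y = 0"
    using assms by (auto simp: bump_def)
  obtain K where K: "\<And>y. y \<in> {0..H} \<Longrightarrow> \<bar>\<psi> y\<bar> \<le> K"
    using assms bounded_on_Icc[OF smooth_continuous] unfolding bump_def by blast
  have "\<bar>\<psi> y\<bar> \<le> max K 0" for y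
    using K[of y] \<delta>(2)[of y] \<delta>(1) by (cases "y \<in> {0..H}") auto
  then show thesis by (rule that) simp
qed

text \<open>The indicator of an open interval inside [0, H] is a bounded limit of bumps, so
  dominated convergence gives the integrals over boxes.\<close>

lemma AE_eq_0_if_bump_integrals_0:
  fixes h :: "real \<Rightarrow> real"
  assumes h: "integrable lborel h" and H: "0 < H" and supp: "\<And>y. y \<notin> {0..H} \<Longrightarrow> h y = 0"
    and bump: "\<And>\<psi>. bump H \<psi> \<Longrightarrow> (\<integral>y. h y * \<psi> y \<partial>lborel) = 0"
  shows "AE y in lborel. h y = 0"
proof (rule AE_eq_0_if_box_integrals_0[OF h])
  fix c d :: real
  have AE0: "AE y in lborel. y \<noteq> 0 \<and> y \<noteq> H"
    using AE_lborel_singleton[of 0] AE_lborel_singleton[of H] by eventually_elim auto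
  \<comment> \<open>Bumps live inside [0, H], so the interval is cut to that range. Since h vanishes
    outside, this affects the integrand at most at the two end points.\<close>
  define c' d' where "c' = max c 0" and "d' = min d H"
  show "(\<integral>y. indicator (box c d) y * h y \<partial>lborel) = 0"
  proof (cases "c' \<le> d'")
    case True
    have [measurable]: "h \<in> borel_measurable borel" using h by auto
    have [measurable]: "box_ramp c' d' n \<in> borel_measurable borel" for n
      by (intro smooth_borel_measurable smooth_box_ramp)
    have "(\<lambda>n. \<integral>y. h y * box_ramp c' d' n y \<partial>lborel) \<longlonglongrightarrow> (\<integral>y. indicator (box c d) y * h y \<partial>lborel)"
    proof (rule integral_dominated_convergence[where w = "\<lambda>y. norm (h y)"])
      show "AE y in lborel. (\<lambda>n. h y * box_ramp c' d' n y) \<longlonglongrightarrow> indicator (box c d) y * h y"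
        using AE0
      proof eventually_elim
        case (elim y)
        have "indicator (box c d) y * h y = h y * indicator {c'<..<d'} y"
          using elim supp[of y] by (auto simp: indicator_def c'_def d'_def)
        then show ?case using tendsto_mult_left[OF box_ramp_tendsto[OF True, of y], of "h y"] by (simp only:)
      qed
      show "AE y in lborel. norm (h y * box_ramp c' d' n y) \<le> norm (h y)" for n
        using box_ramp_bounds[of c' d' n] by (auto simp: abs_mult intro!: mult_left_le)
    qed (use h in auto)
    moreover have "bump H (box_ramp c' d' n)" for n
      using True H by (intro bump_box_ramp) (auto simp: c'_def d'_def)
    ultimately have "(\<lambda>n::nat. 0 :: real) \<longlonglongrightarrow> (\<integral>y. indicator (box c d) y * h y \<partial>lborel)"
      using bump by simp
    then show ?thesis by (simp add: LIMSEQ_const_iff)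
  next
    case False
    then have "(\<lambda>y. indicator (box c d) y * h y) = (\<lambda>y. 0)"
      using supp by (auto simp: indicator_def c'_def d'_def fun_eq_iff)
    then show ?thesis by (simp only: integral_zero)
  qed
qed

lemma integrable_Icc: "integrable lborel (indicator {a..b} :: real \<Rightarrow> real)"
  by (rule integrable_real_indicator) (auto simp: emeasure_lborel_Icc_eq)

text \<open>Integration by parts for a primitive, in the form of Fubini on the triangle where y lies
  between 0 and s and s is at most H. It asks no continuity of q or F.\<close>

lemma integral_tail_swap:
  fixes F q :: "real \<Rightarrow> real"
  assumes F: "integrable lborel F" and supp: "\<And>y. y \<notin> {0..H} \<Longrightarrow> F y = 0"
    and q[measurable]: "q \<in> borel_measurable borel" and qb: "\<And>y. \<bar>q y\<bar> \<le> K"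
  shows "(\<integral>s. F s * (\<integral>y. q y * indicator {0..s} y \<partial>lborel) \<partial>lborel)
       = (\<integral>y. q y * indicator {0..H} y * (\<integral>s. F s * indicator {y..} s \<partial>lborel) \<partial>lborel)"
proof -
  have [measurable]: "F \<in> borel_measurable borel" using F by auto
  let ?g = "\<lambda>s y. F s * q y * indicator {0..H} y * indicator {y..} s"
  have [measurable]: "(\<lambda>(s, y :: real). indicator {y..} s :: real) \<in> borel_measurable (lborel \<Otimes>\<^sub>M lborel)"
  proof -
    have eq: "(\<lambda>(s, y :: real). indicator {y..} s :: real) = (\<lambda>p. if snd p \<le> fst p then 1 else 0)"
      by (auto simp: indicator_def)
    show ?thesis unfolding eq by measurable
  qed
  have K: "0 \<le> K" using qb[of 0] by linarith
  have "integrable (lborel \<Otimes>\<^sub>M lborel) (\<lambda>(s, y). ?g s y)"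
  proof (rule Bochner_Integration.integrable_bound[of _ "\<lambda>(s, y). F s * (K * indicator {0..H} y)"])
    show "integrable (lborel \<Otimes>\<^sub>M lborel) (\<lambda>(s, y). F s * (K * indicator {0..H} y))"
    proof (rule lborel_pair.Fubini_integrable)
      show "integrable lborel (\<lambda>s. \<integral>y. norm (case (s, y) of (s, y) \<Rightarrow> F s * (K * indicator {0..H} y)) \<partial>lborel)"
        using F K by (simp add: abs_mult)
    qed (use F in \<open>auto simp: integrable_Icc\<close>)
    show "AE p in lborel \<Otimes>\<^sub>M lborel. norm (case p of (s, y) \<Rightarrow> ?g s y)
        \<le> norm (case p of (s, y) \<Rightarrow> F s * (K * indicator {0..H} y))"
    proof (rule AE_I2, clarify)
      fix s y :: real
      show "norm (?g s y) \<le> norm (F s * (K * indicator {0..H} y))"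
        using mult_left_mono[OF qb[of y] abs_ge_zero[of "F s"]] K
        by (auto simp: abs_mult indicator_def)
    qed
  qed auto
  then have "(\<integral>y. \<integral>s. ?g s y \<partial>lborel \<partial>lborel) = (\<integral>s. \<integral>y. ?g s y \<partial>lborel \<partial>lborel)"
    by (rule lborel_pair.Fubini_integral)
  moreover have "(\<integral>y. ?g s y \<partial>lborel) = F s * (\<integral>y. q y * indicator {0..s} y \<partial>lborel)" for s
  proof -
    have "?g s = (\<lambda>y. F s * (q y * indicator {0..s} y))"
      using supp[of s] by (auto simp: indicator_def fun_eq_iff)
    then show ?thesis by (simp only: integral_mult_right_zero)
  qed
  moreover have "(\<integral>s. ?g s y \<partial>lborel) = q y * indicator {0..H} y * (\<integral>s. F s * indicator {y..} s \<partial>lborel)" for y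
  proof -
    have "(\<lambda>s. ?g s y) = (\<lambda>s. q y * indicator {0..H} y * (F s * indicator {y..} s))"
      by (simp add: fun_eq_iff)
    then show ?thesis by (simp only: integral_mult_right_zero)
  qed
  ultimately show ?thesis by simp
qed

text \<open>The hypothesis says that F is the distributional derivative of k, and the tail integral
  has derivative -F, so their sum should be constant. Bumps of mean zero are derivatives of bumps
  and can be used in the hypothesis; a general bump is reduced to that case by subtracting a
  multiple of a reference bump.\<close>

lemma du_bois_reymond:
  fixes F k :: "real \<Rightarrow> real"
  assumes F: "integrable lborel F" and k: "integrable lborel k" and H: "0 < H"
    and supp: "\<And>y. y \<notin> {0..H} \<Longrightarrow> F y = 0" "\<And>y. y \<notin> {0..H} \<Longrightarrow> k y = 0"
    and weak: "\<And>\<psi>. bump H \<psi> \<Longrightarrow> (\<integral>y. F y * \<psi> y \<partial>lborel) + (\<integral>y. k y * deriv \<psi> y \<partial>lborel) = 0"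
  obtains c where "AE y in lborel. y \<in> {0..H} \<longrightarrow> k y + (\<integral>s. F s * indicator {y..} s \<partial>lborel) = c"
proof -
  have [measurable]: "F \<in> borel_measurable borel" "k \<in> borel_measurable borel" using F k by auto
  define G where "G y = (\<integral>s. F s * indicator {y..} s \<partial>lborel)" for y
  have [measurable]: "(\<lambda>(y :: real, s). indicator {y..} s :: real) \<in> borel_measurable (lborel \<Otimes>\<^sub>M lborel)"
  proof -
    have eq: "(\<lambda>(y :: real, s). indicator {y..} s :: real) = (\<lambda>p. if fst p \<le> snd p then 1 else 0)"
      by (auto simp: indicator_def)
    show ?thesis unfolding eq by measurable
  qed
  have [measurable]: "G \<in> borel_measurable borel"
    unfolding G_def by measurable
  have Gb: "\<bar>G y\<bar> \<le> (\<integral>s. \<bar>F s\<bar> \<partial>lborel)" for y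
  proof -
    have "\<bar>G y\<bar> \<le> (\<integral>s. norm (F s * indicator {y..} s) \<partial>lborel)"
      unfolding G_def using integral_norm_bound[of lborel "\<lambda>s. F s * indicator {y..} s"] by simp
    also have "\<dots> \<le> (\<integral>s. \<bar>F s\<bar> \<partial>lborel)"
    proof (rule integral_mono)
      show "integrable lborel (\<lambda>s. norm (F s * indicator {y..} s))"
        using integrable_mult_indicator[OF _ F, of "{y..}"] by (simp add: mult.commute)
    qed (use F in \<open>auto simp: indicator_def\<close>)
    finally show ?thesis .
  qed
  define r where "r y = (k y + G y) * indicator {0..H} y" for y
  have r_int: "integrable lborel r"
  proof -
    have "integrable lborel (\<lambda>y. k y * indicator {0..H} y + G y * indicator {0..H} y)"
    proof (rule Bochner_Integration.integrable_add)
      show "integrable lborel (\<lambda>y. k y * indicator {0..H} y)"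
        using integrable_mult_indicator[OF _ k, of "{0..H}"] by (simp add: mult.commute)
      show "integrable lborel (\<lambda>y. G y * indicator {0..H} y)"
      proof (rule Bochner_Integration.integrable_bound[of lborel "\<lambda>y. (\<integral>s. \<bar>F s\<bar> \<partial>lborel) * indicator {0..H} y"])
        show "AE y in lborel. norm (G y * indicator {0..H} y) \<le> norm ((\<integral>s. \<bar>F s\<bar> \<partial>lborel) * indicator {0..H} y)"
          using order.trans[OF Gb abs_ge_self] by (auto simp: abs_mult intro: mult_right_mono)
      qed (auto simp: integrable_Icc)
    qed
    then show ?thesis unfolding r_def distrib_right .
  qed
  have r_mult: "integrable lborel (\<lambda>y. r y * \<psi> y)" if "bump H \<psi>" for \<psi>
  proof -
    obtain K where K: "\<And>y. \<bar>\<psi> y\<bar> \<le> K" "0 \<le> K" using bump_bounded[OF \<open>bump H \<psi>\<close>] by blast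
    have [measurable]: "\<psi> \<in> borel_measurable borel"
      using that by (intro smooth_borel_measurable) (simp add: bump_def)
    show ?thesis
      by (rule Bochner_Integration.integrable_bound[of lborel "\<lambda>y. r y * K"])
         (use r_int K in \<open>auto simp: abs_mult intro!: mult_left_mono\<close>)
  qed
  \<comment> \<open>The primitive \<Psi> of \<eta> that vanishes at 0 also vanishes at H because
    \<eta> has mean zero, hence is a bump. Testing with it is testing r with \<eta>.\<close>
  have mean0: "(\<integral>y. r y * \<eta> y \<partial>lborel) = 0"
    if \<eta>: "bump H \<eta>" and int0: "(\<integral>y. \<eta> y \<partial>lborel) = 0" for \<eta>
  proof -
    obtain \<delta> where \<delta>: "0 < \<delta>" "\<And>y. y \<le> \<delta> \<or> H - \<delta> \<le> y \<Longrightarrow> \<eta> y = 0" and sm: "smooth \<eta>"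
      using \<eta> by (auto simp: bump_def)
    obtain K where K: "\<And>y. \<bar>\<eta> y\<bar> \<le> K" "0 \<le> K" using bump_bounded[OF \<eta>] by blast
    have cont: "continuous_on A \<eta>" for A by (rule smooth_continuous[OF sm])
    have [measurable]: "\<eta> \<in> borel_measurable borel"
      by (intro borel_measurable_continuous_onI cont)
    obtain \<Phi> where \<Phi>: "\<And>y. (\<Phi> has_real_derivative \<eta> y) (at y)"
      using einterval_antiderivative[of "-\<infinity>" "\<infinity>" \<eta>] cont[of UNIV]
      by (auto simp: continuous_on_eq_continuous_at has_real_derivative_iff_has_vector_derivative)
    define \<Psi> where "\<Psi> y = \<Phi> y - \<Phi> 0" for y
    have \<Psi>': "(\<Psi> has_real_derivative \<eta> y) (at y)" for y
      unfolding \<Psi>_def by (rule derivative_eq_intros \<Phi> refl)+ simp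
    have FTC: "(\<integral>y. \<eta> y * indicator {a..b} y \<partial>lborel) = \<Psi> b - \<Psi> a" if "a \<le> b" for a b
    proof -
      have "isCont \<eta> y" for y
        using cont[of UNIV] by (simp add: continuous_on_eq_continuous_at)
      then show ?thesis
        using integral_FTC_Icc_real[OF that, of \<Psi> \<eta>] \<Psi>' by (simp add: mult.commute)
    qed
    have \<Psi>_eq: "\<Psi> s = (\<integral>y. \<eta> y * indicator {0..s} y \<partial>lborel)" if "0 \<le> s" for s
      using FTC[OF that] by (simp add: \<Psi>_def)
    have supp0: "\<eta> y = \<eta> y * indicator {0..H} y" for y
      using \<delta>(1) \<delta>(2)[of y] by (cases "y \<le> \<delta> \<or> H - \<delta> \<le> y") (auto simp: indicator_def)
    have \<Psi>H: "\<Psi> H = 0"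
      using int0 H \<Psi>_eq[of H] by (subst (asm) supp0) simp
    have "bump H \<Psi>"
      unfolding bump_def
    proof (intro conjI exI[of _ \<delta>] allI impI)
      show "smooth \<Psi>" by (rule smooth_antiderivative[OF \<Psi>' sm])
      fix y assume "y \<le> \<delta> \<or> H - \<delta> \<le> y"
      then show "\<Psi> y = 0"
      proof
        assume y: "y \<le> \<delta>"
        \<comment> \<open>The interval is written with \<open>min\<close> and \<open>max\<close> as
          y may lie on either side of 0; \<eta> vanishes on all of it.\<close>
        have "(\<integral>s. \<eta> s * indicator {min y 0..max y 0} s \<partial>lborel) = 0"
          by (intro integral_eq_zero_AE AE_I2) (use y \<delta> in \<open>auto simp: indicator_def min_def max_def split: if_splits\<close>)
        then show ?thesis
          using FTC[of "min y 0" "max y 0"] by (auto simp: \<Psi>_def min_def max_def split: if_splits)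
      next
        assume y: "H - \<delta> \<le> y"
        have "(\<integral>s. \<eta> s * indicator {min y H..max y H} s \<partial>lborel) = 0"
          by (intro integral_eq_zero_AE AE_I2) (use y \<delta> in \<open>auto simp: indicator_def min_def max_def split: if_splits\<close>)
        then show ?thesis
          using FTC[of "min y H" "max y H"] \<Psi>H by (auto simp: min_def max_def split: if_splits)
      qed
    qed (rule \<delta>(1))
    then have "(\<integral>y. F y * \<Psi> y \<partial>lborel) + (\<integral>y. k y * deriv \<Psi> y \<partial>lborel) = 0"
      by (rule weak)
    moreover have "deriv \<Psi> = \<eta>" using \<Psi>' DERIV_imp_deriv by blast
    moreover have "(\<integral>y. F y * \<Psi> y \<partial>lborel) = (\<integral>y. \<eta> y * indicator {0..H} y * G y \<partial>lborel)"
    proof -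
      have "F s * \<Psi> s = F s * (\<integral>y. \<eta> y * indicator {0..s} y \<partial>lborel)" for s
        using supp(1)[of s] \<Psi>_eq[of s] by (cases "s \<in> {0..H}") auto
      then show ?thesis
        unfolding G_def by (simp only: integral_tail_swap[OF F supp(1) \<open>\<eta> \<in> borel_measurable borel\<close> K(1)])
    qed
    moreover have "(\<integral>y. r y * \<eta> y \<partial>lborel) = (\<integral>y. \<eta> y * indicator {0..H} y * G y \<partial>lborel) + (\<integral>y. k y * \<eta> y \<partial>lborel)"
    proof -
      have int_k: "integrable lborel (\<lambda>y. k y * \<eta> y)"
        by (rule Bochner_Integration.integrable_bound[of lborel "\<lambda>y. k y * K"])
           (use k K in \<open>auto simp: abs_mult intro!: mult_left_mono\<close>)
      have eq: "\<eta> y * indicator {0..H} y * G y = r y * \<eta> y - k y * \<eta> y" for y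
        using supp0[of y] by (auto simp: r_def indicator_def algebra_simps)
      show ?thesis
        unfolding eq using r_mult[OF \<eta>] int_k by simp
    qed
    ultimately show ?thesis by simp
  qed
  have \<psi>0: "bump H (box_ramp 0 H n)" for n
    using H by (intro bump_box_ramp) auto
  have bump_int: "integrable lborel \<psi>" if "bump H \<psi>" for \<psi>
  proof -
    obtain K where K: "\<And>y. \<bar>\<psi> y\<bar> \<le> K" "0 \<le> K" using bump_bounded[OF \<open>bump H \<psi>\<close>] by blast
    have [measurable]: "\<psi> \<in> borel_measurable borel"
      using that by (intro smooth_borel_measurable) (simp add: bump_def)
    have supp: "\<psi> y = 0" if "y \<notin> {0..H}" for y
      using that \<open>bump H \<psi>\<close> by (force simp: bump_def)
    show ?thesis
    proof (rule Bochner_Integration.integrable_bound[of lborel "\<lambda>y. K * indicator {0..H} y"])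
      show "AE y in lborel. norm (\<psi> y) \<le> norm (K * indicator {0..H} y)"
        using K supp by (auto simp: indicator_def)
    qed (auto simp: integrable_Icc)
  qed
  \<comment> \<open>A reference bump of nonzero mean has to be found, as
    \<open>box_ramp 0 H 0\<close> vanishes identically. It exists because these integrals converge
    to H.\<close>
  have "\<exists>n. (\<integral>y. box_ramp 0 H n y \<partial>lborel) \<noteq> 0"
  proof (rule ccontr)
    assume "\<not> ?thesis"
    then have z: "(\<integral>y. box_ramp 0 H n y \<partial>lborel) = 0" for n by simp
    have "(\<lambda>n. \<integral>y. box_ramp 0 H n y \<partial>lborel) \<longlonglongrightarrow> (\<integral>y. indicator {0<..<H} y \<partial>lborel)"
    proof (rule integral_dominated_convergence[where w = "indicator {0..H}"])
      show "AE y in lborel. norm (box_ramp 0 H n y) \<le> indicator {0..H} y" for n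
        using box_ramp_bounds[of 0 H n] \<psi>0[of n] by (auto simp: indicator_def bump_def)
      show "AE y in lborel. (\<lambda>n. box_ramp 0 H n y) \<longlonglongrightarrow> indicator {0<..<H} y"
        using box_ramp_tendsto[of 0 H] H by auto
    qed (use bump_int[OF \<psi>0] in \<open>auto simp: integrable_Icc\<close>)
    then show False using H unfolding z by (simp add: LIMSEQ_const_iff)
  qed
  then obtain n where n: "(\<integral>y. box_ramp 0 H n y \<partial>lborel) \<noteq> 0" by blast
  define m where "m = (\<integral>y. box_ramp 0 H n y \<partial>lborel)"
  define c where "c = (\<integral>y. r y * box_ramp 0 H n y \<partial>lborel) / m"
  have "AE y in lborel. r y - c * indicator {0..H} y = 0"
  proof (rule AE_eq_0_if_bump_integrals_0[OF _ H])
    show "integrable lborel (\<lambda>y. r y - c * indicator {0..H} y)"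
      using r_int by (intro Bochner_Integration.integrable_diff) (auto simp: integrable_Icc)
    fix \<psi> assume \<psi>: "bump H \<psi>"
    \<comment> \<open>The multiple of the reference bump with the same mean as \<psi> is removed, so
      that \<open>mean0\<close> applies. What remains of r is the constant c.\<close>
    define \<eta> where "\<eta> y = \<psi> y - (\<integral>y. \<psi> y \<partial>lborel) / m * box_ramp 0 H n y" for y
    have "bump H \<eta>"
    proof -
      obtain \<delta>1 \<delta>2 where \<delta>: "0 < \<delta>1" "0 < \<delta>2" "\<And>y. y \<le> \<delta>1 \<or> H - \<delta>1 \<le> y \<Longrightarrow> \<psi> y = 0"
        "\<And>y. y \<le> \<delta>2 \<or> H - \<delta>2 \<le> y \<Longrightarrow> box_ramp 0 H n y = 0"
        using \<psi> \<psi>0[of n] unfolding bump_def by blast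
      have "smooth \<eta>"
        unfolding \<eta>_def using \<psi> by (intro smooth_diff smooth_mult smooth_const smooth_box_ramp) (simp add: bump_def)
      moreover have "\<eta> y = 0" if "y \<le> min \<delta>1 \<delta>2 \<or> H - min \<delta>1 \<delta>2 \<le> y" for y
      proof -
        have "y \<le> \<delta>1 \<or> H - \<delta>1 \<le> y" "y \<le> \<delta>2 \<or> H - \<delta>2 \<le> y" using that by linarith+
        then show ?thesis using \<delta>(3)[of y] \<delta>(4)[of y] by (simp add: \<eta>_def)
      qed
      ultimately show ?thesis
        unfolding bump_def using \<delta>(1,2) by (intro conjI exI[of _ "min \<delta>1 \<delta>2"]) auto
    qed
    moreover have "(\<integral>y. \<eta> y \<partial>lborel) = 0"
      using bump_int[OF \<psi>] bump_int[OF \<psi>0[of n]] n by (simp add: \<eta>_def m_def)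
    ultimately have "(\<integral>y. r y * \<eta> y \<partial>lborel) = 0" by (rule mean0)
    moreover have "r y * \<eta> y = r y * \<psi> y - (\<integral>y. \<psi> y \<partial>lborel) / m * (r y * box_ramp 0 H n y)" for y
      by (simp add: \<eta>_def algebra_simps)
    ultimately have "(\<integral>y. r y * \<psi> y \<partial>lborel) = c * (\<integral>y. \<psi> y \<partial>lborel)"
      using r_mult[OF \<psi>] r_mult[OF \<psi>0[of n]] by (simp add: c_def)
    moreover have "(r y - c * indicator {0..H} y) * \<psi> y = r y * \<psi> y - c * \<psi> y" for y
    proof (cases "y \<in> {0..H}")
      case False
      then have "\<psi> y = 0" using \<psi> by (force simp: bump_def)
      then show ?thesis by simp
    qed (simp add: algebra_simps)
    ultimately show "(\<integral>y. (r y - c * indicator {0..H} y) * \<psi> y \<partial>lborel) = 0"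
      using r_mult[OF \<psi>] bump_int[OF \<psi>] by simp
  qed (auto simp: r_def)
  then have "AE y in lborel. y \<in> {0..H} \<longrightarrow> k y + G y = c"
    by eventually_elim (auto simp: r_def)
  then show thesis unfolding G_def by (rule that)
qed

text \<open>Extends the weak identity from smooth bumps to profiles with a merely bounded slope q
  that vanish at both ends, such as a shear flow corrected by piecewise linear layers. By du
  Bois-Reymond k is a constant minus the tail of F: the constant is annihilated by the zero mean of
  q, and the tail is handled by \<open>integral_tail_swap\<close>.\<close>

lemma du_bois_reymond_Lipschitz:
  fixes F k :: "real \<Rightarrow> real"
  assumes F: "integrable lborel F" and k: "integrable lborel k" and H: "0 < H"
    and supp: "\<And>y. y \<notin> {0..H} \<Longrightarrow> F y = 0" "\<And>y. y \<notin> {0..H} \<Longrightarrow> k y = 0"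
    and weak: "\<And>\<psi>. bump H \<psi> \<Longrightarrow> (\<integral>y. F y * \<psi> y \<partial>lborel) + (\<integral>y. k y * deriv \<psi> y \<partial>lborel) = 0"
    and q: "q \<in> borel_measurable borel" "\<And>y. \<bar>q y\<bar> \<le> K" "(\<integral>y. q y * indicator {0..H} y \<partial>lborel) = 0"
  shows "(\<integral>s. F s * (\<integral>y. q y * indicator {0..s} y \<partial>lborel) \<partial>lborel) + (\<integral>y. k y * q y \<partial>lborel) = 0"
proof -
  have [measurable]: "F \<in> borel_measurable borel" "k \<in> borel_measurable borel" "q \<in> borel_measurable borel"
    using F k q by auto
  let ?G = "\<lambda>y. \<integral>s. F s * indicator {y..} s \<partial>lborel"
  obtain c where c: "AE y in lborel. y \<in> {0..H} \<longrightarrow> k y + ?G y = c"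
    using du_bois_reymond[OF F k H supp weak] by blast
  have int_k: "integrable lborel (\<lambda>y. k y * q y)"
    by (rule Bochner_Integration.integrable_bound[of lborel "\<lambda>y. k y * K"])
       (use k q order.trans[OF q(2) abs_ge_self] in \<open>auto simp: abs_mult intro!: mult_left_mono\<close>)
  have int_q: "integrable lborel (\<lambda>y. q y * indicator {0..H} y)"
  proof (rule Bochner_Integration.integrable_bound[of lborel "\<lambda>y. K * indicator {0..H} y"])
    show "AE y in lborel. norm (q y * indicator {0..H} y) \<le> norm (K * indicator {0..H} y)"
      using order.trans[OF q(2) abs_ge_self] by (auto simp: indicator_def)
  qed (auto simp: integrable_Icc)
  have [measurable]: "(\<lambda>(y :: real, s). indicator {y..} s :: real) \<in> borel_measurable (lborel \<Otimes>\<^sub>M lborel)"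
  proof -
    have eq: "(\<lambda>(y :: real, s). indicator {y..} s :: real) = (\<lambda>p. if fst p \<le> snd p then 1 else 0)"
      by (auto simp: indicator_def)
    show ?thesis unfolding eq by measurable
  qed
  have "(\<integral>s. F s * (\<integral>y. q y * indicator {0..s} y \<partial>lborel) \<partial>lborel)
      = (\<integral>y. q y * indicator {0..H} y * ?G y \<partial>lborel)"
    by (rule integral_tail_swap[OF F supp(1) q(1,2)])
  also have "\<dots> = (\<integral>y. c * (q y * indicator {0..H} y) - k y * q y \<partial>lborel)"
    by (rule integral_cong_AE)
       (use c supp(2) in \<open>auto elim!: eventually_mono simp: indicator_def algebra_simps\<close>)
  also have "\<dots> = - (\<integral>y. k y * q y \<partial>lborel)"
    using int_q int_k q(3) by simp
  finally show ?thesis by simp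
qed

section \<open>Differential inequalities in time\<close>

lemma integrable_mult_bounded:
  fixes f g :: "'a \<Rightarrow> real"
  assumes f: "integrable M f" and g: "g \<in> borel_measurable M" and b: "AE x in M. \<bar>g x\<bar> \<le> K"
  shows "integrable M (\<lambda>x. f x * g x)"
proof (rule Bochner_Integration.integrable_bound[of M "\<lambda>x. f x * K"])
  show "AE x in M. norm (f x * g x) \<le> norm (f x * K)"
    using b by eventually_elim (auto simp: abs_mult intro!: mult_left_mono)
qed (use f g in auto)

lemma integrable_mult_continuous_Icc:
  fixes f g :: "real \<Rightarrow> real"
  assumes f: "integrable lborel f" and supp: "\<And>s. s \<notin> {a..b} \<Longrightarrow> f s = 0" and g: "continuous_on UNIV g"
  shows "integrable lborel (\<lambda>s. f s * g s)"
proof -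
  obtain K where K: "\<And>y. y \<in> {a..b} \<Longrightarrow> \<bar>g y\<bar> \<le> K"
    using bounded_on_Icc[OF continuous_on_subset[OF g subset_UNIV]] by blast
  have [measurable]: "g \<in> borel_measurable borel" by (rule borel_measurable_continuous_onI[OF g])
  have "integrable lborel (\<lambda>s. f s * (g s * indicator {a..b} s))"
    by (rule integrable_mult_bounded[OF f, of _ "\<bar>K\<bar>"]) (use K in \<open>force simp: indicator_def\<close>)+
  moreover have "(\<lambda>s. f s * (g s * indicator {a..b} s)) = (\<lambda>s. f s * g s)"
    using supp by (auto simp: fun_eq_iff indicator_def)
  ultimately show ?thesis by (simp only:)
qed

lemma integral_deriv_Icc:
  fixes \<theta> :: "real \<Rightarrow> real"
  assumes \<theta>: "smooth \<theta>" and "a \<le> b"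
  shows "(\<integral>s. deriv \<theta> s * indicator {a..b} s \<partial>lborel) = \<theta> b - \<theta> a"
proof -
  have "isCont (deriv \<theta>) y" for y
    using smooth_continuous_deriv[OF \<theta>, of UNIV] by (simp add: continuous_on_eq_continuous_at)
  then show ?thesis
    using integral_FTC_Icc_real[OF assms(2), of \<theta> "deriv \<theta>"] smooth_has_real_derivative[OF \<theta>]
    by (simp add: mult.commute)
qed

text \<open>
  Tested with smooth approximations from below of the indicator of \<open>[0,t)\<close>. The minorant \<open>\<l>\<close> expresses lower semicontinuity at \<open>t\<close>.
\<close>

lemma integrate_distributional_inequality:
  fixes y R l :: "real \<Rightarrow> real"
  assumes t: "0 < t" "t \<le> T"
    and y: "integrable lborel y" "\<And>s. s \<notin> {0..T} \<Longrightarrow> y s = 0"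
    and R: "integrable lborel R" "\<And>s. s \<notin> {0..T} \<Longrightarrow> R s = 0"
    and l: "continuous_on {0..T} l" "AE s in lborel. s \<in> {0..T} \<longrightarrow> l s \<le> y s"
    and ineq: "\<And>\<theta>. smooth \<theta> \<Longrightarrow> (\<And>s. 0 \<le> \<theta> s) \<Longrightarrow> (\<exists>\<delta>>0. \<forall>s\<ge>T - \<delta>. \<theta> s = 0) \<Longrightarrow>
       - (1/2) * (\<integral>s. y s * deriv \<theta> s \<partial>lborel) - (1/2) * \<theta> 0 * y0 \<le> (\<integral>s. R s * \<theta> s \<partial>lborel)"
  shows "(1/2) * l t \<le> (1/2) * y0 + (\<integral>s. R s * indicator {0..t} s \<partial>lborel)"
proof (rule field_le_epsilon)
  fix e :: real assume "0 < e"
  define \<epsilon> where "\<epsilon> = 2 * e"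
  have \<epsilon>: "0 < \<epsilon>" using \<open>0 < e\<close> by (simp add: \<epsilon>_def)
  \<comment> \<open>The shift by 1 makes \<theta> vanish as soon as n (t - s) \<le> 1, that is,
    shortly before t. So it is admissible even for t = T.\<close>
  define \<theta> where "\<theta> n s = ramp (real n * (t - s) - 1)" for n s
  have sm: "smooth (\<theta> n)" for n
    unfolding \<theta>_def
    by (intro smooth_compose[OF smooth_flat_exp] smooth_diff smooth_mult smooth_const
        smooth_bounded_linear bounded_linear_ident)
  have cont: "continuous_on UNIV (\<theta> n)" "continuous_on UNIV (deriv (\<theta> n))" for n
    using smooth_continuous[OF sm] smooth_continuous_deriv[OF sm] by auto
  have [measurable]: "\<theta> n \<in> borel_measurable borel" "deriv (\<theta> n) \<in> borel_measurable borel" for n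
    by (intro borel_measurable_continuous_onI cont)+
  have [measurable]: "y \<in> borel_measurable borel" "R \<in> borel_measurable borel" using y(1) R(1) by auto
  have anti: "\<theta> n s' \<le> \<theta> n s" if "s \<le> s'" for n s s'
    unfolding \<theta>_def using that by (intro ramp_mono diff_right_mono mult_left_mono) auto
  have deriv_le: "deriv (\<theta> n) s \<le> 0" for n s
  proof -
    have "(\<theta> n has_real_derivative flat_exp 2 (real n * (t - s) - 1) * (- real n)) (at s)"
      unfolding \<theta>_def
      by (rule DERIV_chain2[OF DERIV_cong[OF flat_exp_has_derivative]])
         (auto intro!: derivative_eq_intros simp: numeral_2_eq_2)
    then have "deriv (\<theta> n) s = flat_exp 2 (real n * (t - s) - 1) * (- real n)"
      by (rule DERIV_imp_deriv)
    then show ?thesis by (simp add: flat_exp_def)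
  qed
  have \<theta>_late: "\<theta> n s = 0" if "t \<le> s" for n s
  proof -
    have "real n * (t - s) \<le> 0" using that by (simp add: mult_nonneg_nonpos)
    then show ?thesis unfolding \<theta>_def by (intro ramp_bounds(3)) simp
  qed
  have lim: "(\<lambda>n. \<theta> n s) \<longlonglongrightarrow> (if s < t then 1 else 0)" for s
    using ramp_scaled_tendsto[of 1 "t - s"] by (simp add: \<theta>_def)
  obtain \<eta> where \<eta>: "0 < \<eta>" "\<eta> < t" and near: "\<And>s. s \<in> {0..T} \<Longrightarrow> t - \<eta> < s \<Longrightarrow> s \<le> t \<Longrightarrow> l t - \<epsilon> \<le> l s"
  proof -
    have "t \<in> {0..T}" using t by auto
    with l(1) \<epsilon> obtain d where d: "0 < d" "\<And>s. s \<in> {0..T} \<Longrightarrow> dist s t < d \<Longrightarrow> dist (l s) (l t) < \<epsilon>"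
      unfolding continuous_on_iff by blast
    show thesis
    proof (rule that[of "min d (t / 2)"])
      show "l t - \<epsilon> \<le> l s" if "s \<in> {0..T}" "t - min d (t / 2) < s" "s \<le> t" for s
      proof -
        have "t - d < s" using that by linarith
        then show ?thesis
          using d(2)[OF that(1)] that(3) by (simp add: dist_real_def abs_less_iff)
      qed
    qed (use d t in auto)
  qed
  obtain K0 where K: "\<And>s. s \<in> {0..T} \<Longrightarrow> \<bar>l s\<bar> \<le> K0"
    using bounded_on_Icc[OF l(1)] by blast
  \<comment> \<open>A lower bound for the integral of y times -\<theta>'. The variation of \<theta>
    near t sees at least l t - \<epsilon>. On [0, t - \<eta>] only |l| \<le> K0 is known; replacing
    l t - \<epsilon> by -K0 there costs at most 2 K0 times the variation, which tends to 0 with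
    n.\<close>
  let ?m = "\<lambda>n. (l t - \<epsilon>) * \<theta> n 0 - 2 * K0 * (\<theta> n 0 - \<theta> n (t - \<eta>))"
  have le: "(1/2) * ?m n \<le> (1/2) * \<theta> n 0 * y0 + (\<integral>s. R s * \<theta> n s \<partial>lborel)" for n
  proof -
    have "- (1/2) * (\<integral>s. y s * deriv (\<theta> n) s \<partial>lborel) - (1/2) * \<theta> n 0 * y0 \<le> (\<integral>s. R s * \<theta> n s \<partial>lborel)"
    proof (rule ineq[OF sm])
      show "\<exists>\<delta>>0. \<forall>s\<ge>T - \<delta>. \<theta> n s = 0"
      proof (intro exI[of _ "1 / (real n + 1)"] conjI allI impI)
        fix s assume s: "T - 1 / (real n + 1) \<le> s"
        have "real n * (t - s) \<le> real n * (1 / (real n + 1))"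
          using s t by (intro mult_left_mono) auto
        also have "\<dots> \<le> 1" by simp
        finally show "\<theta> n s = 0" unfolding \<theta>_def by (intro ramp_bounds(3)) simp
      qed simp
    qed (simp add: \<theta>_def ramp_bounds)
    moreover have "?m n \<le> (\<integral>s. y s * (- deriv (\<theta> n) s) \<partial>lborel)"
    proof -
      let ?g = "\<lambda>s. - ((l t - \<epsilon>) * (deriv (\<theta> n) s * indicator {0..T} s)) + 2 * K0 * (deriv (\<theta> n) s * indicator {0..t - \<eta>} s)"
      have int: "integrable lborel (\<lambda>s. deriv (\<theta> n) s * indicator {a..b} s)" for a b
        using integrable_mult_continuous_Icc[OF integrable_Icc _ cont(2), of a b a b n]
        by (simp add: mult.commute)
      have "(\<integral>s. ?g s \<partial>lborel) \<le> (\<integral>s. y s * (- deriv (\<theta> n) s) \<partial>lborel)"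
      proof (rule integral_mono_AE)
        show "integrable lborel ?g" by (intro Bochner_Integration.integrable_add Bochner_Integration.integrable_minus integrable_mult_right int)
        show "integrable lborel (\<lambda>s. y s * (- deriv (\<theta> n) s))"
          by (rule integrable_mult_continuous_Icc[OF y]) (auto intro!: continuous_on_minus cont)
        show "AE s in lborel. ?g s \<le> y s * (- deriv (\<theta> n) s)"
          using l(2) AE_lborel_singleton[of t]
        proof eventually_elim
          case (elim s)
          show ?case
          proof (cases "s \<in> {0..T}")
            case True
            show ?thesis
            proof (cases "t < s")
              case late: True
              have "(\<theta> n has_real_derivative 0) (at s)"
                by (rule has_field_derivative_transform_within_open[of "\<lambda>_. 0" _ _ "{t<..}"])
                   (use late \<theta>_late in auto)
              then have "deriv (\<theta> n) s = 0" by (rule DERIV_imp_deriv)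
              then show ?thesis by simp
            next
              case False
              have "l t - \<epsilon> - 2 * K0 * indicator {0..t - \<eta>} s \<le> y s"
              proof (cases "s \<le> t - \<eta>")
                case True
                then show ?thesis
                  using K[of s] K[of t] \<open>s \<in> {0..T}\<close> t \<epsilon> elim by (auto simp: indicator_def)
              next
                case False
                then show ?thesis
                  using near[of s] \<open>s \<in> {0..T}\<close> \<open>\<not> t < s\<close> elim by auto
              qed
              \<comment> \<open>Monotonicity of \<theta> enters here: a lower bound for y can be
                multiplied by -\<theta>' because \<theta>' \<le> 0.\<close>
              then have "(l t - \<epsilon> - 2 * K0 * indicator {0..t - \<eta>} s) * (- deriv (\<theta> n) s) \<le> y s * (- deriv (\<theta> n) s)"
                using deriv_le[of n s] by (intro mult_right_mono) auto
              then show ?thesis using True by (simp add: algebra_simps)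
            qed
          next
            case False
            then have "s \<notin> {0..t - \<eta>}" using t \<eta> by auto
            then show ?thesis using False y(2)[of s] by simp
          qed
        qed
      qed
      moreover have "(\<integral>s. ?g s \<partial>lborel) = - ((l t - \<epsilon>) * (\<theta> n T - \<theta> n 0)) + 2 * K0 * (\<theta> n (t - \<eta>) - \<theta> n 0)"
        using int t \<eta> by (simp add: integral_deriv_Icc[OF sm])
      moreover have "\<theta> n T = 0" using \<theta>_late t by simp
      ultimately show ?thesis by (simp add: algebra_simps)
    qed
    ultimately show ?thesis by simp
  qed
  have "(1/2) * ((l t - \<epsilon>) * 1 - 2 * K0 * (1 - 1)) \<le> (1/2) * 1 * y0 + (\<integral>s. R s * indicator {0..t} s \<partial>lborel)"
  proof (rule LIMSEQ_le)
    have 1: "(\<lambda>n. \<theta> n 0) \<longlonglongrightarrow> 1" "(\<lambda>n. \<theta> n (t - \<eta>)) \<longlonglongrightarrow> 1"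
      using lim[of 0] lim[of "t - \<eta>"] t \<eta> by auto
    show "(\<lambda>n. (1/2) * ?m n) \<longlonglongrightarrow> (1/2) * ((l t - \<epsilon>) * 1 - 2 * K0 * (1 - 1))"
      by (intro tendsto_intros 1)
    have "(\<lambda>n. \<integral>s. R s * \<theta> n s \<partial>lborel) \<longlonglongrightarrow> (\<integral>s. R s * indicator {0..t} s \<partial>lborel)"
    proof (rule integral_dominated_convergence[where w = "\<lambda>s. norm (R s)"])
      show "AE s in lborel. (\<lambda>n. R s * \<theta> n s) \<longlonglongrightarrow> R s * indicator {0..t} s"
        using AE_lborel_singleton[of t]
      proof eventually_elim
        case (elim s)
        have "R s * indicator {0..t} s = R s * (if s < t then 1 else 0)"
          using elim R(2)[of s] t by (auto simp: indicator_def)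
        then show ?case using tendsto_mult_left[OF lim[of s], of "R s"] by (simp only:)
      qed
      show "AE s in lborel. norm (R s * \<theta> n s) \<le> norm (R s)" for n
        by (auto simp: abs_mult \<theta>_def ramp_bounds intro!: mult_left_le)
    qed (use R(1) in auto)
    then show "(\<lambda>n. (1/2) * \<theta> n 0 * y0 + (\<integral>s. R s * \<theta> n s \<partial>lborel))
        \<longlonglongrightarrow> (1/2) * 1 * y0 + (\<integral>s. R s * indicator {0..t} s \<partial>lborel)"
      by (intro tendsto_intros 1)
  qed (use le in blast)
  then show "(1/2) * l t \<le> (1/2) * y0 + (\<integral>s. R s * indicator {0..t} s \<partial>lborel) + e"
    by (simp add: \<epsilon>_def algebra_simps)
qed

text \<open>As f is only integrable and the inequality holds almost everywhere, the argument is run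
  for the continuous right-hand side Z. Inserting the inequality once gives Z \<le> a + c P, with P
  the differentiable primitive of Z, so (a + c P) exp(-c s) is nonincreasing.\<close>

lemma gronwall:
  fixes f :: "real \<Rightarrow> real"
  assumes f: "integrable lborel f" and c: "0 \<le> c" and t: "0 \<le> t" "t \<le> T"
    and le: "AE s in lborel. s \<in> {0..T} \<longrightarrow> f s \<le> a + c * (\<integral>r. f r * indicator {0..s} r \<partial>lborel)"
  shows "a + c * (\<integral>r. f r * indicator {0..t} r \<partial>lborel) \<le> a * exp (c * t)"
proof -
  have [measurable]: "f \<in> borel_measurable borel" using f by auto
  define Z where "Z s = a + c * (\<integral>r. f r * indicator {0..s} r \<partial>lborel)" for s
  have fint: "integrable lborel (\<lambda>r. f r * indicator {a..b} r)" for a b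
    by (rule integrable_mult_bounded[OF f, of _ 1]) (auto simp: indicator_def)
  have HK: "(\<integral>r. f r * indicator {a..b} r \<partial>lborel) = integral {a..b} f" and f_on: "f integrable_on {a..b}" for a b
  proof -
    have "set_integrable lborel {a..b} f"
      using fint[of a b] by (simp add: set_integrable_def mult.commute)
    from set_borel_integral_eq_integral[OF this]
    show "(\<integral>r. f r * indicator {a..b} r \<partial>lborel) = integral {a..b} f" "f integrable_on {a..b}"
      by (auto simp: set_lebesgue_integral_def mult.commute)
  qed
  have Zc: "continuous_on {0..T} Z"
    unfolding Z_def HK by (intro continuous_intros indefinite_integral_continuous_1 f_on)
  define P where "P s = integral {0..s} Z" for s
  have P': "(P has_real_derivative Z s) (at s within {0..T})" if "s \<in> {0..T}" for s
    unfolding P_def by (rule integral_has_real_derivative[OF Zc that])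
  have ZP: "Z s \<le> a + c * P s" if s: "s \<in> {0..T}" for s
  proof -
    have Zs: "continuous_on {0..s} Z" using Zc s by (auto intro: continuous_on_subset)
    have Zi: "set_integrable lborel {0..s} Z"
      by (rule borel_integrable_atLeastAtMost') (rule Zs)
    have "(\<integral>r. f r * indicator {0..s} r \<partial>lborel) \<le> (\<integral>r. Z r * indicator {0..s} r \<partial>lborel)"
    proof (rule integral_mono_AE[OF fint])
      show "integrable lborel (\<lambda>r. Z r * indicator {0..s} r)"
        using Zi by (simp add: set_integrable_def mult.commute)
      show "AE r in lborel. f r * indicator {0..s} r \<le> Z r * indicator {0..s} r"
        using le by eventually_elim (use s in \<open>auto simp: Z_def indicator_def\<close>)
    qed
    also have "\<dots> = P s"
      using set_borel_integral_eq_integral(2)[OF Zi] by (simp add: P_def set_lebesgue_integral_def mult.commute)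
    finally show ?thesis using c unfolding Z_def[of s] by (intro add_left_mono mult_left_mono)
  qed
  have "(a + c * P t) * exp (- c * t) \<le> (a + c * P 0) * exp (- c * 0)"
  proof (rule DERIV_nonpos_imp_decreasing_open[where f = "\<lambda>s. (a + c * P s) * exp (- c * s)", OF t(1)])
      fix s assume s: "0 < s" "s < t"
      have "(P has_real_derivative Z s) (at s)"
        using P'[of s] s t by (simp add: at_within_Icc_at)
      then have "((\<lambda>s. (a + c * P s) * exp (- c * s)) has_real_derivative
          (c * Z s) * exp (- c * s) + exp (- c * s) * (- c) * (a + c * P s)) (at s)"
        by (auto intro!: derivative_eq_intros)
      moreover have "(c * Z s) * exp (- c * s) + exp (- c * s) * (- c) * (a + c * P s)
          = c * exp (- c * s) * (Z s - (a + c * P s))"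
        by (simp add: algebra_simps)
      moreover have "\<dots> \<le> 0"
        using ZP[of s] s t c by (intro mult_nonneg_nonpos) auto
      ultimately show "\<exists>y. ((\<lambda>s. (a + c * P s) * exp (- c * s)) has_real_derivative y) (at s) \<and> y \<le> 0"
        by auto
    next
      have "continuous_on {0..T} P"
        using P' by (meson DERIV_continuous_on)
      then show "continuous_on {0..t} (\<lambda>s. (a + c * P s) * exp (- c * s))"
        using t by (intro continuous_intros) (auto intro: continuous_on_subset)
  qed
  then have "(a + c * P t) * exp (- c * t) \<le> a" by (simp add: P_def)
  then have "a + c * P t \<le> a * exp (c * t)" by (simp add: exp_minus field_simps)
  then show ?thesis using ZP[of t] t by (simp add: Z_def)
qed

section \<open>Test functions on the periodic channel\<close>

lemma axis_1_in_Basis: "axis i (1::real) \<in> Basis"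
  by (simp add: axis_in_Basis_iff)

lemma inner_axis_1: "x \<bullet> axis i (1::real) = x $ i"
  by (simp add: inner_axis)

lemma channel_eq_cbox: "channel v W H = cbox 0 (\<chi> i. if i = v then H else W)"
  by (rule set_eqI, unfold channel_def mem_box_cart) auto

lemma channel_borel [measurable]: "channel v W H \<in> sets borel"
  by (simp add: channel_eq_cbox)

lemma channel_fmeasurable: "channel v W H \<in> lmeasurable"
  by (simp add: channel_eq_cbox)

lemma measure_channel:
  fixes v :: "'n::finite"
  assumes "0 < W" "0 < H"
  shows "measure lebesgue (channel v W H) = H * W ^ (CARD('n) - 1)"
proof -
  have "cbox 0 (\<chi> i. if i = v then H else W) \<noteq> {}"
    using assms by (auto simp: interval_ne_empty_cart)
  then have "measure lebesgue (channel v W H) = (\<Prod>i\<in>UNIV. if i = v then H else W)"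
    unfolding channel_eq_cbox by (simp add: content_cbox_cart)
  also have "\<dots> = H * (\<Prod>i\<in>UNIV - {v}. if i = v then H else W)"
    by (subst prod.remove[of _ v]) auto
  also have "(\<Prod>i\<in>UNIV - {v}. if i = v then H else W) = (\<Prod>i\<in>UNIV - {v}. W)"
    by (rule prod.cong) auto
  finally show ?thesis by (simp add: card_Diff_singleton)
qed

lemma on_line_nth:
  "on_line (axis j 1) z s $ i = (if i = j then s else on_line (axis j 1) z 0 $ i)"
proof (cases "i = j")
  case True
  then show ?thesis using on_line_inner(1)[OF axis_1_in_Basis, of j z s] by (simp add: inner_axis)
next
  case False
  then show ?thesis using on_line_shift[of "axis j 1" z 0 s] by (simp add: axis_def)
qed

text \<open>The cell is a product of intervals containing 0, so a coordinate line meets it in a full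
  side or not at all, and the point with parameter 0 decides which.\<close>

lemma on_line_in_channel:
  assumes "0 < W" "0 < H"
  shows "on_line (axis j 1) z s \<in> channel v W H \<longleftrightarrow>
    s \<in> {0..if j = v then H else W} \<and> on_line (axis j 1) z 0 \<in> channel v W H"
proof -
  define y where "y = on_line (axis j 1) z 0"
  have y: "on_line (axis j 1) z s $ i = (if i = j then s else y $ i)" "y $ j = 0" for i
    unfolding y_def by (rule on_line_nth) (subst on_line_nth, simp)
  define L where "L i = (if i = v then H else W)" for i
  have L: "0 \<le> L i" for i using assms by (simp add: L_def)
  have in_channel: "x \<in> channel v W H \<longleftrightarrow> (\<forall>i. 0 \<le> x $ i \<and> x $ i \<le> L i)" for x
    by (simp add: channel_eq_cbox mem_box_cart L_def)
  have "on_line (axis j 1) z s \<in> channel v W H \<longleftrightarrow> s \<in> {0..L j} \<and> y \<in> channel v W H"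
  proof
    assume s: "on_line (axis j 1) z s \<in> channel v W H"
    have *: "0 \<le> (if i = j then s else y $ i) \<and> (if i = j then s else y $ i) \<le> L i" for i
      using spec[OF s[unfolded in_channel], of i] unfolding y(1) .
    have "s \<in> {0..L j}" using *[of j] by simp
    moreover have "0 \<le> y $ i \<and> y $ i \<le> L i" for i
      using *[of i] y(2) L[of j] by (cases "i = j") auto
    ultimately show "s \<in> {0..L j} \<and> y \<in> channel v W H"
      unfolding in_channel by blast
  next
    assume s: "s \<in> {0..L j} \<and> y \<in> channel v W H"
    then have "\<forall>i. 0 \<le> y $ i \<and> y $ i \<le> L i" unfolding in_channel by blast
    then show "on_line (axis j 1) z s \<in> channel v W H"
      unfolding in_channel y(1) using s by auto
  qed
  then show ?thesis unfolding L_def y_def .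
qed

lemma smooth_nth: "smooth (\<lambda>x::real^'n. x $ i)"
  by (intro smooth_bounded_linear bounded_linear_vec_nth)

lemma nth_has_derivative: "((\<lambda>x::real^'n. x $ i) has_derivative (\<lambda>h. h $ i)) (at x)"
  by (intro bounded_linear_imp_has_derivative bounded_linear_vec_nth)

lemma frechet_derivative_bump:
  fixes x :: "real^'n"
  assumes "smooth \<psi>"
  shows "frechet_derivative (\<lambda>x. \<psi> (x $ v)) (at x) h = deriv \<psi> (x $ v) * h $ v"
proof -
  have "((\<lambda>x. \<psi> (x $ v)) has_derivative (\<lambda>h. deriv \<psi> (x $ v) * (h $ v))) (at x)"
    using has_derivative_compose[OF nth_has_derivative
        smooth_has_real_derivative[OF assms, unfolded has_field_derivative_def], of v x] by simp
  from frechet_derivative_at[OF this] show ?thesis by metis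
qed

lemma shift_nth: "i \<noteq> v \<Longrightarrow> (x + W *\<^sub>R axis i 1) $ v = x $ v" for x :: "real^'n"
  by (simp add: axis_def)

lemma test_function_bump:
  assumes "bump H \<psi>"
  shows "test_function v W H (\<lambda>x::real^'n. \<psi> (x $ v))"
proof -
  obtain \<delta> where "0 < \<delta>" "\<And>y. y \<le> \<delta> \<or> H - \<delta> \<le> y \<Longrightarrow> \<psi> y = 0" and sm: "smooth \<psi>"
    using assms unfolding bump_def by blast
  then show ?thesis
    unfolding test_function_def periodic_def
    by (intro conjI exI[of _ \<delta>] smooth_compose[OF sm smooth_nth]) (auto simp: axis_def)
qed

text \<open>With m the midpoint, x lies in the interval iff the phase a = 2 \<pi> |x - m| / W is
  less than b = \<pi> (d - c) / W. On [0, \<pi>] the cosine reverses this order; a phase beyond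
  \<pi> is reflected to 2 \<pi> - a.\<close>

lemma cos_periodic_ramp:
  assumes "0 < W" "0 \<le> c" "c \<le> d" "d \<le> W" "0 \<le> x" "x \<le> W"
  shows "cos (pi * (d - c) / W) < cos (2 * pi * (x - (c + d) / 2) / W) \<longleftrightarrow> x \<in> {c<..<d}"
proof -
  define a b where "a = \<bar>2 * pi * (x - (c + d) / 2) / W\<bar>" and "b = pi * (d - c) / W"
  have b: "0 \<le> b" "b \<le> pi"
  proof -
    have "(d - c) / W \<le> 1" using assms by simp
    then have "pi * ((d - c) / W) \<le> pi * 1" by (intro mult_left_mono) auto
    then show "b \<le> pi" by (simp add: b_def)
  qed (use assms in \<open>auto simp: b_def\<close>)
  have pW: "0 < pi / W" using assms by simp
  have a_eq: "a = (pi / W) * \<bar>2 * x - (c + d)\<bar>"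
  proof -
    have "2 * pi * (x - (c + d) / 2) / W = (pi / W) * (2 * x - (c + d))"
      by (simp add: right_diff_distrib diff_divide_distrib add_divide_distrib distrib_left)
    then show ?thesis using assms(1) by (simp only: a_def abs_mult) simp
  qed
  have b_eq: "b = (pi / W) * (d - c)" "2 * pi = (pi / W) * (2 * W)"
    using assms by (auto simp: b_def)
  have ab: "a < b \<longleftrightarrow> \<bar>2 * x - (c + d)\<bar> < d - c"
    unfolding a_eq b_eq(1) using pW by (simp only: mult_less_cancel_left_pos)
  \<comment> \<open>The left-hand bracket is 2 max(x - c, d - x), at most 2 W in the cell. This
    keeps a away from the copy of the interval in the neighbouring cell.\<close>
  have "(pi / W) * (\<bar>2 * x - (c + d)\<bar> + (d - c)) \<le> (pi / W) * (2 * W)"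
    using assms pW by (intro mult_left_mono) auto
  then have a: "a \<le> 2 * pi - b"
    unfolding a_eq b_eq distrib_left by linarith
  have "cos b < cos a \<longleftrightarrow> a < b"
  proof (cases "a \<le> pi")
    case True
    then show ?thesis using b by (intro cos_mono_less_eq) (auto simp: a_def)
  next
    case False
    have "cos a = cos (2 * pi - a)" by (simp add: cos_diff)
    also have "\<dots> \<le> cos b" using False a b by (intro cos_monotone_0_pi_le) auto
    finally show ?thesis using False b by auto
  qed
  moreover have "cos a = cos (2 * pi * (x - (c + d) / 2) / W)"
    unfolding a_def by (simp only: cos_abs_real)
  ultimately show ?thesis using ab unfolding b_def by auto
qed

text \<open>
  In the period cell the interval \<open>(c, d)\<close> is the set where
  \<open>cos (2 \<pi> (x - (c + d) / 2) / W) > cos (\<pi> (d - c) / W)\<close>, so ramps of the difference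
  approximate its indicator by functions that are smooth and periodic without any gluing.
\<close>

definition cell_ramp :: "'n::finite \<Rightarrow> real \<Rightarrow> real^'n \<Rightarrow> real^'n \<Rightarrow> nat \<Rightarrow> real^'n \<Rightarrow> real" where
  "cell_ramp v W c d n x = box_ramp (c $ v) (d $ v) n (x $ v) *
     (\<Prod>i\<in>UNIV - {v}. ramp (real n *
        (cos (2 * pi * (x $ i - (c $ i + d $ i) / 2) / W) - cos (pi * (d $ i - c $ i) / W)) - 0))"

lemma cell_ramp_bounds: "0 \<le> cell_ramp v W c d n x" "cell_ramp v W c d n x \<le> 1"
proof -
  have "0 \<le> (\<Prod>i\<in>I. ramp (f i))" "(\<Prod>i\<in>I. ramp (f i)) \<le> 1" for I and f :: "'a \<Rightarrow> real"
    by (auto intro!: prod_nonneg prod_le_1 simp: ramp_bounds)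
  then show "0 \<le> cell_ramp v W c d n x" "cell_ramp v W c d n x \<le> 1"
    unfolding cell_ramp_def by (auto intro!: mult_nonneg_nonneg mult_le_one box_ramp_bounds)
qed

lemma test_function_cell_ramp:
  fixes v :: "'n::finite"
  assumes "0 < W" "0 < H" "0 \<le> c $ v" "c $ v \<le> d $ v" "d $ v \<le> H"
  shows "test_function v W H (cell_ramp v W c d n)"
proof -
  have lin: "smooth (\<lambda>x::real^'n. 2 * pi * (x $ i - e) / W)" for i and e :: real
  proof -
    have "smooth (\<lambda>x::real^'n. (2 * pi / W) * (x $ i - e))"
      by (intro smooth_diff smooth_mult smooth_const smooth_nth)
    then show ?thesis by simp
  qed
  have "smooth (cell_ramp v W c d n)"
    unfolding cell_ramp_def
    by (intro smooth_mult smooth_prod smooth_compose[OF smooth_flat_exp] smooth_diff smooth_const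
        smooth_compose[OF smooth_cos] lin smooth_compose[OF smooth_box_ramp] smooth_nth)
  moreover have "periodic v W H (cell_ramp v W c d n)"
    unfolding periodic_def
  proof (intro allI impI, elim conjE)
    fix x :: "real^'n" and j assume j: "j \<noteq> v"
    have "cos (2 * pi * ((x + W *\<^sub>R axis j 1) $ i - e) / W) = cos (2 * pi * (x $ i - e) / W)" for i e
    proof (cases "i = j")
      case True
      have "2 * pi * ((x + W *\<^sub>R axis j 1) $ i - e) / W = 2 * pi * (x $ i - e) / W + 2 * pi"
        using True assms(1) by (simp add: field_simps axis_def)
      then show ?thesis by simp
    qed (simp add: axis_def)
    then show "cell_ramp v W c d n (x + W *\<^sub>R axis j 1) = cell_ramp v W c d n x"
      unfolding cell_ramp_def shift_nth[OF j] by simp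
  qed
  moreover have "\<exists>\<delta>>0. \<forall>x. x $ v \<le> \<delta> \<or> H - \<delta> \<le> x $ v \<longrightarrow> cell_ramp v W c d n x = 0"
    using bump_box_ramp[of "c $ v" "d $ v" H n] assms unfolding bump_def cell_ramp_def by fastforce
  ultimately show ?thesis by (simp add: test_function_def)
qed

lemma cell_ramp_tendsto:
  assumes "0 < W" "0 < H" "x \<in> channel v W H" "x $ v \<noteq> 0" "x $ v \<noteq> H"
    and c: "\<And>i. 0 \<le> c $ i \<and> c $ i \<le> d $ i \<and> d $ i \<le> (if i = v then H else W)"
  shows "(\<lambda>n. cell_ramp v W c d n x) \<longlonglongrightarrow> indicator (box c d) x"
proof -
  have "(\<lambda>n. cell_ramp v W c d n x) \<longlonglongrightarrow>
      indicator {c $ v<..<d $ v} (x $ v) * (\<Prod>i\<in>UNIV - {v}. indicator {c $ i<..<d $ i} (x $ i))"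
    unfolding cell_ramp_def
  proof (intro tendsto_mult tendsto_prod)
    show "(\<lambda>n. box_ramp (c $ v) (d $ v) n (x $ v)) \<longlonglongrightarrow> indicator {c $ v<..<d $ v} (x $ v)"
      using c[of v] by (intro box_ramp_tendsto) auto
    fix i assume i: "i \<in> UNIV - {v}"
    let ?s = "cos (2 * pi * (x $ i - (c $ i + d $ i) / 2) / W) - cos (pi * (d $ i - c $ i) / W)"
    have "0 < ?s \<longleftrightarrow> x $ i \<in> {c $ i<..<d $ i}"
      using cos_periodic_ramp[of W "c $ i" "d $ i" "x $ i"] assms(1,3) c[of i] i by (auto simp: channel_def)
    then have "(if 0 < ?s then 1 else 0) = (indicator {c $ i<..<d $ i} (x $ i) :: real)"
      by (simp add: indicator_def)
    \<comment> \<open>The shift is 0 in the lateral directions: test functions are periodic there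
      and have nothing to avoid at the lateral faces.\<close>
    then show "(\<lambda>n. ramp (real n * ?s - 0)) \<longlonglongrightarrow> indicator {c $ i<..<d $ i} (x $ i)"
      using ramp_scaled_tendsto[of 0 ?s] by (simp only: order.refl)
  qed
  also have "indicator {c $ v<..<d $ v} (x $ v) * (\<Prod>i\<in>UNIV - {v}. indicator {c $ i<..<d $ i} (x $ i) :: real)
      = (\<Prod>i\<in>UNIV. indicator {c $ i<..<d $ i} (x $ i))"
    by (subst prod.remove[of UNIV v]) auto
  also have "\<dots> = indicator (box c d) x"
    by (auto simp: indicator_def mem_box_cart)
  finally show ?thesis .
qed

text \<open>Cell ramps approximate the indicators of all boxes inside the cell, including those that
  touch its faces, so vanishing pairings give vanishing box integrals. It identifies entries of a
  weak gradient.\<close>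

lemma fundamental_lemma_channel:
  fixes f :: "real^'n \<Rightarrow> real"
  assumes W: "0 < W" "0 < H" and f: "integrable (lebesgue_on (channel v W H)) f"
    and test: "\<And>\<phi>. test_function v W H \<phi> \<Longrightarrow> (\<integral>x. f x * \<phi> x \<partial>lebesgue_on (channel v W H)) = 0"
  shows "AE x in lebesgue_on (channel v W H). f x = 0"
proof -
  obtain f' where f'[measurable]: "f' \<in> borel_measurable borel" and f'_eq: "AE x in lborel. x \<in> channel v W H \<longrightarrow> f' x = f x"
    and f'_0: "\<And>x. x \<notin> channel v W H \<Longrightarrow> f' x = 0"
    using lebesgue_on_borel_representative[OF channel_borel borel_measurable_integrable[OF f]] by blast
  have int: "integrable lborel f'"
    using lebesgue_on_eq_lborel(1)[OF channel_borel f' f'_0 f'_eq] f by blast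
  have test': "(\<integral>x. f' x * \<phi> x \<partial>lborel) = 0" if \<phi>: "test_function v W H \<phi>" for \<phi>
  proof -
    have [measurable]: "\<phi> \<in> borel_measurable borel"
      using \<phi> by (intro borel_measurable_continuous_onI smooth_continuous) (simp add: test_function_def)
    have "(\<integral>x. f x * \<phi> x \<partial>lebesgue_on (channel v W H)) = (\<integral>x. f' x * \<phi> x \<partial>lborel)"
      by (rule lebesgue_on_eq_lborel(2)[OF channel_borel]) (use f'_eq f'_0 in auto)
    then show ?thesis using test[OF \<phi>] by simp
  qed
  have "AE x in lborel. f' x = 0"
  proof (rule AE_eq_0_if_box_integrals_0[OF int])
    fix c0 d0 :: "real^'n"
    \<comment> \<open>The box is cut to the cell, where the ramps can reach it. The lost points lie
      outside the cell or on its faces, and the faces are null sets.\<close>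
    define c d :: "real^'n" where "c = (\<chi> i. max 0 (c0 $ i))"
      and "d = (\<chi> i. min (if i = v then H else W) (d0 $ i))"
    have eq: "indicator (box c0 d0) x * f' x = indicator (box c d) x * f' x"
      if "f' x \<noteq> 0 \<Longrightarrow> \<forall>i. x $ i \<noteq> 0 \<and> x $ i \<noteq> (if i = v then H else W)" for x
    proof (cases "f' x = 0")
      case False
      then have "x \<in> channel v W H" using f'_0 by blast
      then have "0 < x $ i \<and> x $ i < (if i = v then H else W)" for i
        using that[OF False] by (auto simp: channel_eq_cbox mem_box_cart less_le split: if_splits)
      then show ?thesis by (auto simp: indicator_def mem_box_cart c_def d_def)
    qed simp
    have bdry_all: "AE x in lborel. \<forall>i. (x :: real^'n) $ i \<noteq> 0 \<and> x $ i \<noteq> (if i = v then H else W)"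
    proof -
      have "AE x in lborel. (x :: real^'n) $ i \<noteq> r" for i r
      proof -
        have "{x :: real^'n. axis i 1 \<bullet> x = r} \<in> null_sets lebesgue"
          using negligible_hyperplane[of "axis i (1::real) :: real^'n" r] by (simp add: negligible_iff_null_sets)
        then have "AE x in lebesgue. x \<notin> {x :: real^'n. axis i 1 \<bullet> x = r}" by (rule AE_not_in)
        then show ?thesis by (simp add: AE_completion_iff inner_commute inner_axis_1)
      qed
      then have "AE x in lborel. \<forall>i\<in>UNIV. (x :: real^'n) $ i \<noteq> 0 \<and> x $ i \<noteq> (if i = v then H else W)"
        by (intro AE_finite_allI) auto
      then show ?thesis by simp
    qed
    show "(\<integral>x. indicator (box c0 d0) x * f' x \<partial>lborel) = 0"
    proof (cases "\<forall>i. c $ i \<le> d $ i")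
      case True
      have cd: "0 \<le> c $ i \<and> c $ i \<le> d $ i \<and> d $ i \<le> (if i = v then H else W)" for i
        using True by (auto simp: c_def d_def)
      have tf: "test_function v W H (cell_ramp v W c d n)" for n
        using cd[of v] W by (intro test_function_cell_ramp) auto
      then have [measurable]: "cell_ramp v W c d n \<in> borel_measurable borel" for n
        by (intro borel_measurable_continuous_onI smooth_continuous) (simp add: test_function_def)
      have "(\<lambda>n. \<integral>x. f' x * cell_ramp v W c d n x \<partial>lborel) \<longlonglongrightarrow> (\<integral>x. indicator (box c0 d0) x * f' x \<partial>lborel)"
      proof (rule integral_dominated_convergence[where w = "\<lambda>x. norm (f' x)"])
        show "AE x in lborel. (\<lambda>n. f' x * cell_ramp v W c d n x) \<longlonglongrightarrow> indicator (box c0 d0) x * f' x"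
          using bdry_all
        proof eventually_elim
          case (elim x)
          show ?case
          proof (cases "f' x = 0")
            case False
            then have x: "x \<in> channel v W H" using f'_0 by blast
            have "(\<lambda>n. cell_ramp v W c d n x) \<longlonglongrightarrow> indicator (box c d) x"
              using spec[OF elim, of v] by (intro cell_ramp_tendsto[OF W x] cd) auto
            from tendsto_mult_left[OF this, of "f' x"]
            have "(\<lambda>n. f' x * cell_ramp v W c d n x) \<longlonglongrightarrow> indicator (box c d) x * f' x"
              by (simp only: mult.commute)
            moreover have "indicator (box c0 d0) x * f' x = indicator (box c d) x * f' x"
              using elim by (rule eq)
            ultimately show ?thesis by (simp only:)
          qed simp
        qed
        show "AE x in lborel. norm (f' x * cell_ramp v W c d n x) \<le> norm (f' x)" for n
          using cell_ramp_bounds[of v W c d n] by (auto simp: abs_mult intro!: mult_left_le)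
      qed (use int in auto)
      then have "(\<lambda>n::nat. 0 :: real) \<longlonglongrightarrow> (\<integral>x. indicator (box c0 d0) x * f' x \<partial>lborel)"
        using test'[OF tf] by simp
      then show ?thesis by (simp add: LIMSEQ_const_iff)
    next
      case False
      then obtain i where "d $ i < c $ i" by (auto simp: not_le)
      then have empty: "box c d = {}" by (auto simp: mem_box_cart) (metis less_trans less_asym)
      from bdry_all have "AE x in lborel. indicator (box c0 d0) x * f' x = 0"
        by eventually_elim (subst eq, simp_all add: empty)
      then show ?thesis by (rule integral_eq_zero_AE)
    qed
  qed
  with f'_eq have "AE x in lborel. x \<in> channel v W H \<longrightarrow> f x = 0"
    by eventually_elim simp
  then show ?thesis
    by (simp only: AE_lebesgue_on_iff[OF channel_borel])
qed

section \<open>Square integrable functions and marginals\<close>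

lemma in_L2_inner_integrable:
  assumes f: "in_L2 S f" and g: "in_L2 S g"
  shows "integrable (lebesgue_on S) (\<lambda>x. f x \<bullet> g x)"
proof (rule Bochner_Integration.integrable_bound)
  show "integrable (lebesgue_on S) (\<lambda>x. (norm (f x))\<^sup>2 + (norm (g x))\<^sup>2)"
    using f g by (intro Bochner_Integration.integrable_add) (auto simp: in_L2_def)
  show "(\<lambda>x. f x \<bullet> g x) \<in> borel_measurable (lebesgue_on S)"
    using f g by (intro borel_measurable_inner) (auto simp: in_L2_def)
  have "\<bar>f x \<bullet> g x\<bar> \<le> (norm (f x))\<^sup>2 + (norm (g x))\<^sup>2" for x
    using Cauchy_Schwarz_ineq2[of "f x" "g x"] sum_squares_bound[of "norm (f x)" "norm (g x)"]
      zero_le_power2[of "norm (f x)"] zero_le_power2[of "norm (g x)"]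
      mult_nonneg_nonneg[OF norm_ge_zero[of "f x"] norm_ge_zero[of "g x"]] by linarith
  then show "AE x in lebesgue_on S. norm (f x \<bullet> g x) \<le> norm ((norm (f x))\<^sup>2 + (norm (g x))\<^sup>2)"
    by simp
qed

lemma in_L2_add:
  assumes f: "in_L2 S f" and g: "in_L2 S g"
  shows "in_L2 S (\<lambda>x. f x + g x)"
proof -
  have eq: "(\<lambda>x. (norm (f x + g x))\<^sup>2) = (\<lambda>x. (norm (f x))\<^sup>2 + 2 * (f x \<bullet> g x) + (norm (g x))\<^sup>2)"
    by (simp add: fun_eq_iff power2_norm_eq_inner inner_add_left inner_add_right inner_commute)
  show ?thesis
    unfolding in_L2_def eq using f g in_L2_inner_integrable[OF f g]
    by (auto simp: in_L2_def)
qed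

lemma in_L2_cmult:
  assumes f: "in_L2 S f"
  shows "in_L2 S (\<lambda>x. c *\<^sub>R f x)"
  using f by (auto simp: in_L2_def power_mult_distrib)

lemma in_L2_diff:
  assumes f: "in_L2 S f" and g: "in_L2 S g"
  shows "in_L2 S (\<lambda>x. f x - g x)"
  using in_L2_add[OF f in_L2_cmult[OF g, of "-1"]] by simp

lemma in_L2_nth:
  fixes f :: "'a::euclidean_space \<Rightarrow> 'b::euclidean_space ^ 'n"
  assumes f: "in_L2 S f"
  shows "in_L2 S (\<lambda>x. f x $ i)"
  unfolding in_L2_def
proof
  show m: "(\<lambda>x. f x $ i) \<in> borel_measurable (lebesgue_on S)"
    using f by (intro borel_measurable_continuous_on[of "\<lambda>y. y $ i"] linear_continuous_on bounded_linear_vec_nth) (auto simp: in_L2_def)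
  show "integrable (lebesgue_on S) (\<lambda>x. (norm (f x $ i))\<^sup>2)"
  proof (rule Bochner_Integration.integrable_bound[of _ "\<lambda>x. (norm (f x))\<^sup>2"])
    show "AE x in lebesgue_on S. norm ((norm (f x $ i))\<^sup>2) \<le> norm ((norm (f x))\<^sup>2)"
      by (intro AE_I2) (simp add: Finite_Cartesian_Product.norm_nth_le)
  qed (use f m in \<open>auto simp: in_L2_def\<close>)
qed

lemma L2sq_nonneg: "0 \<le> L2sq S f"
  by (simp add: L2sq_def)

lemma L2sq_add_le:
  assumes f: "in_L2 S f" and g: "in_L2 S g"
  shows "L2sq S (\<lambda>x. f x + g x) \<le> 2 * L2sq S f + 2 * L2sq S g"
proof -
  have "L2sq S (\<lambda>x. f x + g x) \<le> (\<integral>x. 2 * (norm (f x))\<^sup>2 + 2 * (norm (g x))\<^sup>2 \<partial>lebesgue_on S)"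
    unfolding L2sq_def
  proof (rule integral_mono)
    fix x
    have "(norm (f x + g x))\<^sup>2 \<le> (norm (f x) + norm (g x))\<^sup>2"
      by (intro power_mono norm_triangle_ineq norm_ge_zero)
    also have "\<dots> \<le> 2 * (norm (f x))\<^sup>2 + 2 * (norm (g x))\<^sup>2"
      using sum_squares_bound[of "norm (f x)" "norm (g x)"] by (simp add: power2_sum)
    finally show "(norm (f x + g x))\<^sup>2 \<le> 2 * (norm (f x))\<^sup>2 + 2 * (norm (g x))\<^sup>2" .
  qed (use f g in_L2_add[OF f g] in \<open>auto simp: in_L2_def\<close>)
  also have "\<dots> = 2 * L2sq S f + 2 * L2sq S g"
    using f g by (simp add: L2sq_def in_L2_def)
  finally show ?thesis .
qed

lemma in_L2_bounded:
  assumes S: "S \<in> lmeasurable" and f: "f \<in> borel_measurable (lebesgue_on S)" and b: "\<And>x. x \<in> S \<Longrightarrow> norm (f x) \<le> K"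
  shows "in_L2 S f"
  unfolding in_L2_def
proof
  have "(norm (f x))\<^sup>2 \<le> K\<^sup>2" if "x \<in> S" for x
    using b[OF that] by (simp add: power_mono)
  then show "integrable (lebesgue_on S) (\<lambda>x. (norm (f x))\<^sup>2)"
    using f by (intro finite_measure.integrable_const_bound[OF finite_measure_lebesgue_on[OF S], of _ "K\<^sup>2"] AE_I2) auto
qed (rule f)

text \<open>The infimum is attained: the bounds exceeding it by 1 / (n + 1) hold almost everywhere,
  simultaneously for all n since these are countably many conditions.\<close>

lemma Linf_norm_props:
  assumes "ess_bounded M f"
  shows "0 \<le> Linf_norm M f" and "AE x in M. norm (f x) \<le> Linf_norm M f"
proof -
  let ?S = "{c. 0 \<le> c \<and> (AE x in M. norm (f x) \<le> c)}"
  obtain c where c: "AE x in M. norm (f x) \<le> c" using assms by (auto simp: ess_bounded_def)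
  have "AE x in M. norm (f x) \<le> max c 0" using c by eventually_elim simp
  then have "max c 0 \<in> ?S" by simp
  then have ne: "?S \<noteq> {}" by blast
  have bdd: "bdd_below ?S" by (rule bdd_belowI[of _ 0]) auto
  show "0 \<le> Linf_norm M f"
    unfolding Linf_norm_def using ne by (rule cInf_greatest) auto
  have "AE x in M. \<forall>n::nat. norm (f x) \<le> Linf_norm M f + 1 / Suc n"
  proof (subst AE_all_countable, intro allI)
    fix n :: nat
    have "\<exists>c\<in>?S. c < Linf_norm M f + 1 / Suc n"
      unfolding Linf_norm_def using cInf_lessD[OF ne] by (simp add: Bex_def)
    then obtain c where "AE x in M. norm (f x) \<le> c" "c < Linf_norm M f + 1 / Suc n" by blast
    then show "AE x in M. norm (f x) \<le> Linf_norm M f + 1 / Suc n"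
      by (auto elim!: eventually_mono)
  qed
  then show "AE x in M. norm (f x) \<le> Linf_norm M f"
  proof eventually_elim
    case (elim x)
    show ?case
    proof (rule field_le_epsilon)
      fix e :: real assume "0 < e"
      then obtain n where "1 / Suc n < e" using nat_approx_posE by blast
      then show "norm (f x) \<le> Linf_norm M f + e" using elim[rule_format, of n] by linarith
    qed
  qed
qed

lemma borel_measurable_lebesgue_on:
  "f \<in> borel_measurable borel \<Longrightarrow> f \<in> borel_measurable (lebesgue_on S)"
  by (simp add: measurable_restrict_space1 measurable_completion)

lemma integrable_lebesgue_on_mult_bounded:
  fixes f g :: "real^'n \<Rightarrow> real"
  assumes f: "integrable (lebesgue_on S) f" and g: "g \<in> borel_measurable borel" and b: "\<And>x. x \<in> S \<Longrightarrow> \<bar>g x\<bar> \<le> K"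
  shows "integrable (lebesgue_on S) (\<lambda>x. f x * g x)"
  by (rule integrable_mult_bounded[OF f, of _ K]) (use g b in \<open>auto intro!: borel_measurable_lebesgue_on AE_I2\<close>)

lemma integrable_const_channel: "integrable (lebesgue_on (channel v W H)) (\<lambda>x. c :: real)"
  by (rule finite_measure.integrable_const[OF finite_measure_lebesgue_on[OF channel_fmeasurable]])

lemma integrable_bounded_channel:
  fixes g :: "real^'n \<Rightarrow> real"
  assumes "g \<in> borel_measurable borel" "\<And>x. x \<in> channel v W H \<Longrightarrow> \<bar>g x\<bar> \<le> K"
  shows "integrable (lebesgue_on (channel v W H)) g"
  using integrable_lebesgue_on_mult_bounded[OF integrable_const_channel[of v W H 1] assms] by simp

lemma integral_channel_lborel:
  fixes f :: "real^'n \<Rightarrow> real"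
  assumes "f \<in> borel_measurable borel"
  shows "integrable (lebesgue_on (channel v W H)) f \<longleftrightarrow> integrable lborel (\<lambda>x. indicator (channel v W H) x * f x)"
    and "(\<integral>x. f x \<partial>lebesgue_on (channel v W H)) = (\<integral>x. indicator (channel v W H) x * f x \<partial>lborel)"
  by (rule lebesgue_on_eq_lborel[OF channel_borel]; use assms in auto)+

lemma bounded_on_channel:
  fixes g :: "real^'n \<Rightarrow> 'b::real_normed_vector"
  assumes "continuous_on UNIV g"
  obtains K where "\<And>x. x \<in> channel v W H \<Longrightarrow> norm (g x) \<le> K"
proof -
  have "bounded (g ` channel v W H)"
    unfolding channel_eq_cbox
    by (intro compact_imp_bounded compact_continuous_image compact_cbox continuous_on_subset[OF assms]) auto
  then obtain K where "\<forall>x\<in>g ` channel v W H. norm x \<le> K" unfolding bounded_iff by blast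
  then show thesis using that by blast
qed

section \<open>Reduction to the wall-normal variable\<close>

text \<open>Stated for a general set and direction, since it is needed both in the cell and in the
  space-time cylinder. Only the pairing with functions of one coordinate is exported, so the choice
  of a Borel representative stays hidden.\<close>

lemma set_marginal:
  fixes f :: "'a::euclidean_space \<Rightarrow> real"
  assumes b: "b \<in> Basis" and S: "S \<in> sets borel" "\<And>x. x \<in> S \<Longrightarrow> x \<bullet> b \<in> {0..H}"
    and f: "integrable (lebesgue_on S) f"
  obtains F where "integrable lborel F" "\<And>y. y \<notin> {0..H} \<Longrightarrow> F y = 0"
    "\<And>q K. q \<in> borel_measurable borel \<Longrightarrow> (\<And>y. \<bar>q y\<bar> \<le> K) \<Longrightarrow>
       (\<integral>x. f x * q (x \<bullet> b) \<partial>lebesgue_on S) = (\<integral>y. F y * q y \<partial>lborel)"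
proof -
  obtain f' where f'[measurable]: "f' \<in> borel_measurable borel" and f'_eq: "AE x in lborel. x \<in> S \<longrightarrow> f' x = f x"
    and f'_0: "\<And>x. x \<notin> S \<Longrightarrow> f' x = 0"
    using lebesgue_on_borel_representative[OF S(1) borel_measurable_integrable[OF f]] by blast
  have int: "integrable lborel f'"
    using lebesgue_on_eq_lborel(1)[OF S(1) f' f'_0 f'_eq] f by blast
  show thesis
  proof
    show "integrable lborel (marginal b f')"
      by (rule integrable_marginal[OF b int])
    show "marginal b f' y = 0" if "y \<notin> {0..H}" for y
      using that S(2) by (intro marginal_eq_0[OF b] f'_0) blast
    fix q :: "real \<Rightarrow> real" and K assume q [measurable]: "q \<in> borel_measurable borel" "\<And>y. \<bar>q y\<bar> \<le> K"
    have "(\<integral>x. f x * q (x \<bullet> b) \<partial>lebesgue_on S) = (\<integral>x. f' x * q (x \<bullet> b) \<partial>lborel)"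
      by (rule lebesgue_on_eq_lborel(2)[OF S(1)]) (use f'_eq f'_0 in auto)
    also have "\<dots> = (\<integral>y. marginal b f' y * q y \<partial>lborel)"
      by (rule integral_marginal[OF b int q])
    finally show "(\<integral>x. f x * q (x \<bullet> b) \<partial>lebesgue_on S) = (\<integral>y. marginal b f' y * q y \<partial>lborel)" .
  qed
qed

lemma channel_marginal:
  fixes f :: "real^'n \<Rightarrow> real"
  assumes f: "integrable (lebesgue_on (channel v W H)) f"
  obtains F where "integrable lborel F" "\<And>y. y \<notin> {0..H} \<Longrightarrow> F y = 0"
    "\<And>q K. q \<in> borel_measurable borel \<Longrightarrow> (\<And>y. \<bar>q y\<bar> \<le> K) \<Longrightarrow>
       (\<integral>x. f x * q (x $ v) \<partial>lebesgue_on (channel v W H)) = (\<integral>y. F y * q y \<partial>lborel)"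
  by (rule set_marginal[OF axis_1_in_Basis[of v] channel_borel _ f, of H, unfolded inner_axis_1])
     (auto simp: channel_def)

lemma indicator_channel_on_line:
  assumes "0 < W" "0 < H"
  shows "indicator (channel v W H) (on_line (axis j 1) z s) =
    indicator {0..if j = v then H else W} s * (indicator (channel v W H) (on_line (axis j 1) z 0) :: real)"
  unfolding indicator_def on_line_in_channel[OF assms, of j z s v] by (rule of_bool_conj)

text \<open>All sections of the cell by planes of constant x_v are equal, so the marginal of its
  indicator is a constant times the indicator of [0, H]. The case q = 1 identifies the constant
  through the known volume.\<close>

lemma integral_channel_profile:
  fixes v :: "'n::finite"
  assumes W: "0 < W" "0 < H" and q[measurable]: "q \<in> borel_measurable borel" and b: "\<And>y. \<bar>q y\<bar> \<le> K"
  shows "(\<integral>x. q (x $ v) \<partial>lebesgue_on (channel v W H))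
       = W ^ (CARD('n) - 1) * (\<integral>y. q y * indicator {0..H} y \<partial>lborel)"
proof -
  let ?f = "indicator (channel v W H) :: real^'n \<Rightarrow> real"
  let ?J = "\<integral>z. ?f (on_line (axis v 1) z 0) \<partial>hyperplane_measure (axis v (1::real))"
  have f: "integrable lborel ?f"
    unfolding channel_eq_cbox by (rule integrable_real_indicator[OF _ emeasure_lborel_cbox_finite]) simp
  have J: "marginal (axis v 1) ?f y = ?J * indicator {0..H} y" for y
  proof -
    have "?f (on_line (axis v 1) z y) = ?f (on_line (axis v 1) z 0) * indicator {0..H} y" for z
      by (subst indicator_channel_on_line[OF W]) (simp only: if_True mult.commute refl)
    then show ?thesis unfolding marginal_def by (simp only: integral_mult_left_zero)
  qed
  have *: "(\<integral>x. q (x $ v) \<partial>lebesgue_on (channel v W H)) = ?J * (\<integral>y. q y * indicator {0..H} y \<partial>lborel)"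
    if [measurable]: "q \<in> borel_measurable borel" and "\<And>y. \<bar>q y\<bar> \<le> K" for q K
  proof -
    have "(\<integral>x. q (x $ v) \<partial>lebesgue_on (channel v W H)) = (\<integral>x. ?f x * q (x \<bullet> axis v 1) \<partial>lborel)"
      by (subst integral_channel_lborel(2)) (auto simp: inner_axis_1)
    also have "\<dots> = (\<integral>y. marginal (axis v 1) ?f y * q y \<partial>lborel)"
      by (rule integral_marginal[OF axis_1_in_Basis f that])
    also have "\<dots> = (\<integral>y. ?J * (q y * indicator {0..H} y) \<partial>lborel)"
      unfolding J by (intro Bochner_Integration.integral_cong refl) simp
    finally show ?thesis by (simp only: integral_mult_right_zero)
  qed
  have "measure lebesgue (channel v W H) = ?J * H"
    using *[of "\<lambda>_. 1" 1] W channel_fmeasurable[of v W H]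
    by (simp add: measure_restrict_space fmeasurable_def)
  then have "?J = W ^ (CARD('n) - 1)"
    using measure_channel[OF W, of v] W by simp
  then show ?thesis using *[OF q b] by simp
qed

text \<open>On each line in direction j the factor h is constant, and the derivative integrates to a
  difference of two values one period apart.\<close>

lemma integral_tangential_derivative:
  fixes \<phi> :: "real^'n \<Rightarrow> real"
  assumes W: "0 < W" "0 < H" and \<phi>: "test_function v W H \<phi>" and j: "j \<noteq> v"
    and h[measurable]: "h \<in> borel_measurable borel" and hb: "\<And>y. \<bar>h y\<bar> \<le> K"
  shows "(\<integral>x. h (x $ v) * frechet_derivative \<phi> (at x) (axis j 1) \<partial>lebesgue_on (channel v W H)) = 0"
proof -
  let ?d = "\<lambda>x. frechet_derivative \<phi> (at x) (axis j 1)"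
  let ?I = "indicator (channel v W H) :: real^'n \<Rightarrow> real"
  have sm: "smooth \<phi>" and per: "periodic v W H \<phi>" using \<phi> by (auto simp: test_function_def)
  have cont: "continuous_on UNIV ?d"
    by (rule smooth_continuous_derivative[OF sm axis_1_in_Basis])
  then have [measurable]: "?d \<in> borel_measurable borel" by (rule borel_measurable_continuous_onI)
  obtain K' where K': "\<And>x. x \<in> channel v W H \<Longrightarrow> norm (?d x) \<le> K'" using bounded_on_channel[OF cont] by blast
  have int: "integrable (lebesgue_on (channel v W H)) (\<lambda>x. h (x $ v) * ?d x)"
    by (rule integrable_lebesgue_on_mult_bounded[of _ _ _ K'])
       (use K' hb in \<open>auto intro!: integrable_bounded_channel\<close>)
  have int': "integrable lborel (\<lambda>x. ?I x * (h (x $ v) * ?d x))"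
    using integral_channel_lborel(1)[of "\<lambda>x. h (x $ v) * ?d x" v W H] int by simp
  have "(\<integral>s. ?I (on_line (axis j 1) z s) * (h (on_line (axis j 1) z s $ v) * ?d (on_line (axis j 1) z s)) \<partial>lborel) = 0" for z
  proof (cases "on_line (axis j 1) z 0 \<in> channel v W H")
    case True
    define y0 where "y0 = on_line (axis j 1) z 0"
    let ?l = "\<lambda>s. y0 + s *\<^sub>R axis j 1"
    have l: "on_line (axis j 1) z s = ?l s" for s
      using on_line_shift[of "axis j 1" z 0 s] unfolding y0_def by (simp only: add_0_left)
    have y0: "y0 \<in> channel v W H" using True by (simp only: y0_def)
    have l': "(?l has_derivative (\<lambda>t. t *\<^sub>R axis j 1)) (at s)" for s
      by (auto intro!: derivative_eq_intros)
    have d: "((\<lambda>s. \<phi> (?l s)) has_real_derivative ?d (?l s)) (at s)" for s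
    proof -
      have "((\<lambda>s. \<phi> (?l s)) has_derivative (\<lambda>t. frechet_derivative \<phi> (at (?l s)) (t *\<^sub>R axis j 1))) (at s)"
        by (rule has_derivative_compose[OF l' smooth_has_derivative[OF sm]])
      then show ?thesis
        unfolding has_field_derivative_def
        by (rule has_derivative_eq_rhs)
           (simp add: fun_eq_iff mult.commute linear_scale[OF has_derivative_linear[OF smooth_has_derivative[OF sm, of "?l s"]]])
    qed
    have "continuous_on UNIV ?l" by (intro continuous_intros)
    then have c: "isCont (\<lambda>s. ?d (?l s)) s" for s
      using continuous_on_compose2[OF cont, of UNIV ?l] by (simp add: continuous_on_eq_continuous_at)
    have "(\<integral>s. ?d (?l s) * indicator {0..W} s \<partial>lborel) = \<phi> (?l W) - \<phi> (?l 0)"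
      by (rule integral_FTC_Icc_real) (use W d c in auto)
    also have "\<phi> (?l W) = \<phi> y0"
      using per y0 j unfolding periodic_def by (auto simp: channel_def)
    finally have zero: "(\<integral>s. ?d (?l s) * indicator {0..W} s \<partial>lborel) = 0" by simp
    have v: "?l s $ v = y0 $ v" for s using j by (simp add: axis_def)
    have "?I y0 = 1" using y0 by (rule indicator_simps(1))
    then have "?I (?l s) = indicator {0..W} s" for s
      using indicator_channel_on_line[OF W, of v j z s] j unfolding l y0_def[symmetric]
      by (simp only: if_False mult_1_right scaleR_zero_left add_0_right)
    then have "(\<lambda>s. ?I (?l s) * (h (?l s $ v) * ?d (?l s))) = (\<lambda>s. h (y0 $ v) * (?d (?l s) * indicator {0..W} s))"
      unfolding v by (simp add: fun_eq_iff)
    then show ?thesis unfolding l using zero by (simp only: integral_mult_right_zero mult_zero_right)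
  next
    case False
    then have "?I (on_line (axis j 1) z 0) = 0" by (rule indicator_simps(2))
    then have "?I (on_line (axis j 1) z s) = 0" for s
      using indicator_channel_on_line[OF W, of v j z s] by (simp only: mult_zero_right)
    then show ?thesis by simp
  qed
  then show ?thesis
    by (subst integral_channel_lborel(2), simp, subst integral_on_line[OF axis_1_in_Basis[of j] int']) simp
qed

lemma continuous_AE_const_Icc:
  fixes f :: "real \<Rightarrow> real"
  assumes H: "0 < H" and f: "continuous_on {0..H} f" and ae: "AE y in lborel. y \<in> {0..H} \<longrightarrow> f y = c" and y: "y \<in> {0..H}"
  shows "f y = c"
proof (rule ccontr)
  assume "f y \<noteq> c"
  then have "0 < \<bar>f y - c\<bar>" by simp
  with f y obtain d where d: "0 < d" "\<And>s. s \<in> {0..H} \<Longrightarrow> dist s y < d \<Longrightarrow> dist (f s) (f y) < \<bar>f y - c\<bar>"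
    unfolding continuous_on_iff by blast
  define a b where "a = max 0 (y - d / 2)" and "b = min H (y + d / 2)"
  have ab: "a < b" using d(1) y H by (auto simp: a_def b_def)
  have "s \<notin> {a..b}" if "s \<in> {0..H} \<longrightarrow> f s = c" for s
  proof
    assume s: "s \<in> {a..b}"
    then have "s \<in> {0..H}" "dist s y < d" using d(1) by (auto simp: a_def b_def dist_real_def)
    then show False using d(2)[of s] that by (simp add: dist_real_def abs_minus_commute)
  qed
  then have "AE s in lborel. s \<notin> {a..b}" using ae by (auto elim: eventually_mono)
  then have "{a..b} \<in> null_sets lborel" by (subst (asm) AE_iff_null_sets[symmetric]) auto
  then show False using ab by (simp add: null_sets_def)
qed

lemma continuous_on_primitive:
  fixes f :: "real \<Rightarrow> real"
  assumes f: "integrable lborel f"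
  shows "continuous_on {0..H} (\<lambda>y. \<integral>r. f r * indicator {0..y} r \<partial>lborel)"
proof -
  have [measurable]: "f \<in> borel_measurable borel" using f by auto
  have "integrable lborel (\<lambda>r. f r * indicator {a..b} r)" for a b
    by (rule integrable_mult_bounded[OF f, of _ 1]) (auto simp: indicator_def)
  then have "set_integrable lborel {a..b} f" for a b
    by (simp add: set_integrable_def mult.commute)
  from set_borel_integral_eq_integral[OF this]
  have HK: "(\<integral>r. f r * indicator {a..b} r \<partial>lborel) = integral {a..b} f" and f_on: "f integrable_on {a..b}" for a b
    by (auto simp: set_lebesgue_integral_def mult.commute)
  show ?thesis
    unfolding HK by (intro indefinite_integral_continuous_1 f_on)
qed

lemma channel_nth_borel [measurable]: "(\<lambda>x::real^'n. x $ i) \<in> borel_measurable borel"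
  by (intro borel_measurable_continuous_onI continuous_intros)

text \<open>Duality: test the marginal against its own direction where it exceeds the bound.\<close>

lemma marginal_norm_bound:
  fixes f :: "'n::finite \<Rightarrow> real^'n \<Rightarrow> real" and F :: "'n \<Rightarrow> real \<Rightarrow> real"
  assumes W: "0 < W" "0 < H"
    and f: "\<And>i. integrable (lebesgue_on (channel (v::'n) W H)) (f i)"
    and bound: "AE x in lebesgue_on (channel v W H). norm (\<chi> i. f i x) \<le> G"
    and F: "\<And>i. integrable lborel (F i)"
    and Fq: "\<And>i q K. q \<in> borel_measurable borel \<Longrightarrow> (\<And>y. \<bar>q y\<bar> \<le> K) \<Longrightarrow>
       (\<integral>x. f i x * q (x $ v) \<partial>lebesgue_on (channel v W H)) = (\<integral>y. F i y * q y \<partial>lborel)"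
  shows "AE y in lborel. y \<in> {0..H} \<longrightarrow> norm (\<chi> i. F i y) \<le> G * W ^ (CARD('n) - 1)"
proof -
  let ?w = "W ^ (CARD('n) - 1)"
  have [measurable]: "F i \<in> borel_measurable borel" for i using F[of i] by auto
  define N where "N y = norm (\<chi> i. F i y)" for y
  have N: "N y = sqrt (\<Sum>i\<in>UNIV. (F i y)\<^sup>2)" for y
    by (simp add: N_def norm_vec_def L2_set_def)
  have [measurable]: "N \<in> borel_measurable borel" unfolding N by measurable
  define S where "S = {y \<in> {0..H}. G * ?w < N y}"
  have S [measurable]: "S \<in> sets borel" unfolding S_def by measurable
  \<comment> \<open>On the exceptional set S this is the unit vector in the direction of the
    marginal, so pairing with it returns the norm.\<close>
  define q where "q i y = F i y / N y * indicator S y" for i y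
  have [measurable]: "q i \<in> borel_measurable borel" for i unfolding q_def by measurable
  have FN: "\<bar>F i y\<bar> \<le> N y" for i y
    using component_le_norm_cart[of "\<chi> i. F i y" i] by (simp add: N_def)
  have qb: "\<bar>q i y\<bar> \<le> 1" for i y
    using FN[of i y] by (auto simp: q_def abs_mult indicator_def divide_le_eq_1)
  have N2: "(\<Sum>i\<in>UNIV. F i y * F i y) = N y * N y" for y
    unfolding N by (simp add: sum_nonneg power2_eq_square)
  have q2: "(\<Sum>i\<in>UNIV. (q i y)\<^sup>2) \<le> 1" "(\<Sum>i\<in>UNIV. F i y * q i y) = N y * indicator S y" for y
  proof -
    have "(\<Sum>i\<in>UNIV. F i y * q i y) = (\<Sum>i\<in>UNIV. F i y * F i y) / N y * indicator S y"
      by (simp add: q_def sum_divide_distrib sum_distrib_right mult.assoc)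
    then show "(\<Sum>i\<in>UNIV. F i y * q i y) = N y * indicator S y" by (simp add: N2)
    have "(\<Sum>i\<in>UNIV. (q i y)\<^sup>2) = (\<Sum>i\<in>UNIV. F i y * F i y) / (N y * N y) * indicator S y"
      by (simp add: q_def sum_divide_distrib sum_distrib_right power2_eq_square indicator_def)
    then show "(\<Sum>i\<in>UNIV. (q i y)\<^sup>2) \<le> 1" by (simp add: N2 indicator_def)
  qed
  have int_S: "integrable lborel (\<lambda>y. indicator S y :: real)"
    by (rule Bochner_Integration.integrable_bound[OF integrable_Icc[of 0 H]]) (auto simp: S_def indicator_def)
  have int_FS: "integrable lborel (\<lambda>y. N y * indicator S y)"
  proof -
    have "integrable lborel (\<lambda>y. \<Sum>i\<in>UNIV. F i y * q i y)"
      by (intro Bochner_Integration.integrable_sum integrable_mult_bounded[OF F, of _ 1]) (auto simp: qb)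
    then show ?thesis by (simp only: q2)
  qed
  have "(\<integral>y. N y * indicator S y \<partial>lborel) = (\<Sum>i\<in>UNIV. \<integral>y. F i y * q i y \<partial>lborel)"
    unfolding q2(2)[symmetric]
    by (intro Bochner_Integration.integral_sum integrable_mult_bounded[OF F, of _ 1]) (auto simp: qb)
  also have "\<dots> = (\<Sum>i\<in>UNIV. \<integral>x. f i x * q i (x $ v) \<partial>lebesgue_on (channel v W H))"
    by (intro sum.cong refl Fq[symmetric, of _ 1]) (auto simp: qb)
  also have "\<dots> = (\<integral>x. (\<Sum>i\<in>UNIV. f i x * q i (x $ v)) \<partial>lebesgue_on (channel v W H))"
    by (intro Bochner_Integration.integral_sum[symmetric] integrable_lebesgue_on_mult_bounded[OF f, of _ 1]) (auto simp: qb)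
  also have "\<dots> \<le> (\<integral>x. G * indicator S (x $ v) \<partial>lebesgue_on (channel v W H))"
  proof (rule integral_mono_AE)
    show "integrable (lebesgue_on (channel v W H)) (\<lambda>x. \<Sum>i\<in>UNIV. f i x * q i (x $ v))"
      by (intro Bochner_Integration.integrable_sum integrable_lebesgue_on_mult_bounded[OF f, of _ 1]) (auto simp: qb)
    show "integrable (lebesgue_on (channel v W H)) (\<lambda>x. G * indicator S (x $ v))"
      by (rule integrable_bounded_channel[of _ _ _ _ "\<bar>G\<bar>"]) (auto simp: indicator_def)
    show "AE x in lebesgue_on (channel v W H). (\<Sum>i\<in>UNIV. f i x * q i (x $ v)) \<le> G * indicator S (x $ v)"
      using bound
    proof eventually_elim
      case (elim x)
      show ?case
      proof (cases "x $ v \<in> S")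
        case True
        have "(\<Sum>i\<in>UNIV. f i x * q i (x $ v)) = (\<chi> i. f i x) \<bullet> (\<chi> i. q i (x $ v))"
          by (simp add: inner_vec_def)
        also have "\<dots> \<le> norm (\<chi> i. f i x) * norm (\<chi> i. q i (x $ v))" by (rule norm_cauchy_schwarz)
        also have "\<dots> \<le> G * 1"
        proof (rule mult_mono)
          show "norm (\<chi> i. q i (x $ v)) \<le> 1"
            using q2(1)[of "x $ v"] by (simp add: norm_vec_def L2_set_def)
        qed (use elim order.trans[OF norm_ge_zero elim] in auto)
        finally show ?thesis using True by simp
      qed (simp add: q_def)
    qed
  qed
  also have "\<dots> = ?w * (\<integral>y. G * indicator S y * indicator {0..H} y \<partial>lborel)"
    by (rule integral_channel_profile[OF W, of _ "\<bar>G\<bar>"]) (auto simp: indicator_def)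
  also have "(\<lambda>y. G * indicator S y * indicator {0..H} y) = (\<lambda>y. G * indicator S y)"
    by (auto simp: S_def indicator_def)
  finally have "(\<integral>y. N y * indicator S y \<partial>lborel) \<le> G * ?w * (\<integral>y. indicator S y \<partial>lborel)"
    by (simp add: mult_ac)
  \<comment> \<open>The integrand is nonnegative and strictly positive on S, so this forces S to be
    null.\<close>
  then have "(\<integral>y. (N y - G * ?w) * indicator S y \<partial>lborel) \<le> 0"
    using int_S int_FS by (simp add: left_diff_distrib)
  moreover have nn: "0 \<le> (N y - G * ?w) * indicator S y" for y
    by (auto simp: S_def indicator_def)
  ultimately have "(\<integral>y. (N y - G * ?w) * indicator S y \<partial>lborel) = 0"
    by (intro antisym integral_nonneg_AE) auto
  moreover have "integrable lborel (\<lambda>y. (N y - G * ?w) * indicator S y)"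
    using int_S int_FS by (simp add: left_diff_distrib)
  ultimately have "AE y in lborel. (N y - G * ?w) * indicator S y = 0"
    using integral_nonneg_eq_0_iff_AE[of lborel "\<lambda>y. (N y - G * ?w) * indicator S y"] nn by auto
  then have "AE y in lborel. y \<in> {0..H} \<longrightarrow> N y \<le> G * ?w"
    by eventually_elim (auto simp: S_def indicator_def)
  then show ?thesis by (simp only: N_def)
qed

section \<open>Shear flows with bounded vorticity\<close>

lemma norm_matrix_le:
  fixes A :: "real^'n^'m"
  shows "norm A \<le> (\<Sum>i\<in>UNIV. \<Sum>j\<in>UNIV. \<bar>A $ i $ j\<bar>)"
proof -
  have "norm A \<le> (\<Sum>i\<in>UNIV. norm (A $ i))"
    unfolding norm_vec_def[of A] by (rule L2_set_le_sum) simp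
  also have "\<dots> \<le> (\<Sum>i\<in>UNIV. \<Sum>j\<in>UNIV. \<bar>A $ i $ j\<bar>)"
    by (intro sum_mono norm_le_l1_cart)
  finally show ?thesis .
qed

lemma abs_entry_le_norm: "\<bar>A $ i $ j\<bar> \<le> norm (A :: real^'n^'m)"
  using component_le_norm_cart[of "A $ i" j] Finite_Cartesian_Product.norm_nth_le[of A i] by linarith

lemma norm_column_le:
  fixes A :: "real^'n^'m"
  shows "norm (\<chi> i. A $ i $ j) \<le> norm A"
proof -
  have "(\<Sum>i\<in>UNIV. (A $ i $ j)\<^sup>2) \<le> (\<Sum>i\<in>UNIV. (norm (A $ i))\<^sup>2)"
    using component_le_norm_cart by (intro sum_mono) (simp add: abs_le_square_iff[symmetric])
  then show ?thesis by (simp add: norm_vec_def L2_set_def)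
qed

lemma integrable_nth:
  fixes f :: "'a \<Rightarrow> 'b::euclidean_space^'n"
  assumes "integrable M f"
  shows "integrable M (\<lambda>x. f x $ i)"
  by (rule integrable_bounded_linear[OF bounded_linear_vec_nth assms])

text \<open>Tangential derivatives and the v-component of a shear flow vanish, so D has only entries
  (i, v) with i different from v. There D agrees with the vorticity, which makes D essentially
  bounded and G a genuine bound. The marginals of these entries, divided by the area of the section,
  are the slopes p of the profile by du Bois-Reymond.\<close>

lemma shear_flow_profile:
  fixes v :: "'n::finite"
  assumes W: "0 < W" "0 < H" and shear: "shear_flow_bounded_vorticity v W H ub D"
  defines "G \<equiv> Linf_norm (lebesgue_on (channel v W H)) D"
  obtains U p :: "real \<Rightarrow> real^'n" where
    "0 \<le> G" "\<And>x. x \<in> channel v W H \<Longrightarrow> ub x = U (x $ v)"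
    "\<And>y. U y $ v = 0" "\<And>i. (\<lambda>y. p y $ i) \<in> borel_measurable borel" "\<And>y. norm (p y) \<le> G" "\<And>y. p y $ v = 0"
    "\<And>y i. y \<in> {0..H} \<Longrightarrow> U y $ i = U 0 $ i + (\<integral>r. p r $ i * indicator {0..y} r \<partial>lborel)"
proof -
  let ?\<Omega> = "channel v W H" and ?w = "W ^ (CARD('n) - 1)"
  from shear obtain V :: "'n \<Rightarrow> real \<Rightarrow> real" where V: "\<And>i. continuous_on {0..H} (V i)"
    and ub: "\<And>x. 0 \<le> x $ v \<Longrightarrow> x $ v \<le> H \<Longrightarrow> ub x = (\<Sum>i\<in>UNIV - {v}. V i (x $ v) *\<^sub>R axis i 1)"
    unfolding shear_flow_bounded_vorticity_def shear_flow_def by blast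
  have wg: "weak_gradient v W H ub D" and vort: "ess_bounded (lebesgue_on ?\<Omega>) (vorticity D)"
    using shear by (auto simp: shear_flow_bounded_vorticity_def)
  define U :: "real \<Rightarrow> real^'n" where "U y = (\<chi> i. if i = v then 0 else V i y)" for y
  have ubU: "ub x = U (x $ v)" if "x \<in> ?\<Omega>" for x
  proof -
    have "(\<Sum>i\<in>UNIV - {v}. V i (x $ v) *\<^sub>R axis i 1) $ j = U (x $ v) $ j" for j
    proof -
      have "(\<Sum>i\<in>UNIV - {v}. V i (x $ v) *\<^sub>R axis i 1) $ j = (\<Sum>i\<in>UNIV - {v}. if i = j then V i (x $ v) else 0)"
        by (simp add: axis_def if_distrib[of "\<lambda>t. _ * t"] cong: if_cong)
      then show ?thesis by (simp add: U_def)
    qed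
    then show ?thesis using that ub[of x] by (simp add: channel_def vec_eq_iff)
  qed
  have Uc: "continuous_on {0..H} (\<lambda>y. U y $ i)" for i
    using V[of i] by (cases "i = v") (auto simp: U_def)
  have Dint: "integrable (lebesgue_on ?\<Omega>) (\<lambda>x. D x $ i $ j)" for i j
    using wg by (intro integrable_nth) (simp add: weak_gradient_def)
  have weak: "(\<integral>x. ub x $ i * frechet_derivative \<phi> (at x) (axis j 1) \<partial>lebesgue_on ?\<Omega>)
      = - (\<integral>x. D x $ i $ j * \<phi> x \<partial>lebesgue_on ?\<Omega>)" if "test_function v W H \<phi>" for \<phi> :: "real^'n \<Rightarrow> real" and i j
    using wg that unfolding weak_gradient_def by blast
  \<comment> \<open>The profile is arbitrary outside [0, H]; the cutoff makes it bounded and Borel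
    on the whole line.\<close>
  define h where "h i y = U y $ i * indicator {0..H} y" for i y
  have h_meas [measurable]: "h i \<in> borel_measurable borel" for i
    unfolding h_def using borel_measurable_continuous_on_indicator[OF _ Uc[of i]] by (simp add: mult.commute)
  have hb: "\<exists>K. \<forall>y. \<bar>h i y\<bar> \<le> K" for i
  proof -
    obtain K where K: "\<And>y. y \<in> {0..H} \<Longrightarrow> \<bar>U y $ i\<bar> \<le> K" using bounded_on_Icc[OF Uc[of i]] by blast
    have "\<bar>h i y\<bar> \<le> \<bar>K\<bar>" for y
      using K[of y] by (cases "y \<in> {0..H}") (auto simp: h_def)
    then show ?thesis by blast
  qed
  have ub_h: "ub x $ i = h i (x $ v)" if "x \<in> ?\<Omega>" for x i
    using ubU[OF that] that by (simp add: h_def channel_def)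
  have weak': "(\<integral>x. D x $ i $ j * \<phi> x \<partial>lebesgue_on ?\<Omega>)
      = - (\<integral>x. h i (x $ v) * frechet_derivative \<phi> (at x) (axis j 1) \<partial>lebesgue_on ?\<Omega>)" if "test_function v W H \<phi>" for \<phi> :: "real^'n \<Rightarrow> real" and i j
  proof -
    have "(\<integral>x. ub x $ i * frechet_derivative \<phi> (at x) (axis j 1) \<partial>lebesgue_on ?\<Omega>)
        = (\<integral>x. h i (x $ v) * frechet_derivative \<phi> (at x) (axis j 1) \<partial>lebesgue_on ?\<Omega>)"
      by (rule Bochner_Integration.integral_cong) (use ub_h in auto)
    then show ?thesis using weak[OF that, of i j] by simp
  qed
  have D0: "AE x in lebesgue_on ?\<Omega>. D x $ i $ j = 0" if "i = v \<or> j \<noteq> v" for i j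
  proof (rule fundamental_lemma_channel[OF W Dint])
    fix \<phi> :: "real^'n \<Rightarrow> real" assume \<phi>: "test_function v W H \<phi>"
    obtain K where K: "\<And>y. \<bar>h i y\<bar> \<le> K" using hb by blast
    have "(\<integral>x. h i (x $ v) * frechet_derivative \<phi> (at x) (axis j 1) \<partial>lebesgue_on ?\<Omega>) = 0"
    proof (cases "i = v")
      case True
      then show ?thesis by (simp add: h_def U_def)
    next
      case False
      then have "j \<noteq> v" using that by simp
      then show ?thesis by (rule integral_tangential_derivative[OF W \<phi> _ h_meas K])
    qed
    then show "(\<integral>x. D x $ i $ j * \<phi> x \<partial>lebesgue_on ?\<Omega>) = 0" using weak'[OF \<phi>] by simp
  qed
  have D0_all: "AE x in lebesgue_on ?\<Omega>. \<forall>i j. (i = v \<or> j \<noteq> v) \<longrightarrow> D x $ i $ j = 0"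
  proof -
    have "AE x in lebesgue_on ?\<Omega>. \<forall>i\<in>UNIV. \<forall>j\<in>UNIV. (i = v \<or> j \<noteq> v) \<longrightarrow> D x $ i $ j = 0"
      by (intro AE_finite_allI finite) (use D0 in \<open>auto elim!: eventually_mono\<close>)
    then show ?thesis by simp
  qed
  have "ess_bounded (lebesgue_on ?\<Omega>) D"
  proof -
    obtain c where c: "AE x in lebesgue_on ?\<Omega>. norm (vorticity D x) \<le> c" using vort by (auto simp: ess_bounded_def)
    have "AE x in lebesgue_on ?\<Omega>. norm (D x) \<le> (\<Sum>i\<in>(UNIV::'n set). \<Sum>j\<in>(UNIV::'n set). c)"
      using D0_all c
    proof eventually_elim
      case (elim x)
      have "\<bar>D x $ i $ j\<bar> \<le> c" for i j
      proof (cases "i = v \<or> j \<noteq> v")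
        case True
        then have "D x $ i $ j = 0" using elim(1) by blast
        then show ?thesis using order.trans[OF norm_ge_zero elim(2)] by simp
      next
        case False
        \<comment> \<open>In this case j = v, so the transposed entry belongs to the vanishing
          v-component and the antisymmetric part retains the whole entry.\<close>
        have "D x $ j $ i = 0" using elim(1) False by blast
        then have "D x $ i $ j = vorticity D x $ i $ j"
          by (simp add: vorticity_def transpose_def)
        then show ?thesis using abs_entry_le_norm[of "vorticity D x" i j] elim(2) by simp
      qed
      then show ?case by (intro order.trans[OF norm_matrix_le] sum_mono)
    qed
    then show ?thesis unfolding ess_bounded_def by blast
  qed
  note G = Linf_norm_props[OF this, folded G_def]
  have "\<forall>i. \<exists>F. integrable lborel F \<and> (\<forall>y. y \<notin> {0..H} \<longrightarrow> F y = 0) \<and>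
      (\<forall>q K. q \<in> borel_measurable borel \<longrightarrow> (\<forall>y. \<bar>q y\<bar> \<le> K) \<longrightarrow>
       (\<integral>x. D x $ i $ v * q (x $ v) \<partial>lebesgue_on ?\<Omega>) = (\<integral>y. F y * q y \<partial>lborel))"
  proof
    fix i
    show "\<exists>F. integrable lborel F \<and> (\<forall>y. y \<notin> {0..H} \<longrightarrow> F y = 0) \<and>
      (\<forall>q K. q \<in> borel_measurable borel \<longrightarrow> (\<forall>y. \<bar>q y\<bar> \<le> K) \<longrightarrow>
       (\<integral>x. D x $ i $ v * q (x $ v) \<partial>lebesgue_on ?\<Omega>) = (\<integral>y. F y * q y \<partial>lborel))"
      by (rule channel_marginal[OF Dint[of i v]]) blast
  qed
  from choice[OF this] obtain F where F': "\<forall>i. integrable lborel (F i) \<and> (\<forall>y. y \<notin> {0..H} \<longrightarrow> F i y = 0) \<and>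
      (\<forall>q K. q \<in> borel_measurable borel \<longrightarrow> (\<forall>y. \<bar>q y\<bar> \<le> K) \<longrightarrow>
       (\<integral>x. D x $ i $ v * q (x $ v) \<partial>lebesgue_on ?\<Omega>) = (\<integral>y. F i y * q y \<partial>lborel))" by blast
  have F: "integrable lborel (F i)" "y \<notin> {0..H} \<Longrightarrow> F i y = 0"
    "q \<in> borel_measurable borel \<Longrightarrow> (\<And>y. \<bar>q y\<bar> \<le> K) \<Longrightarrow>
       (\<integral>x. D x $ i $ v * q (x $ v) \<partial>lebesgue_on ?\<Omega>) = (\<integral>y. F i y * q y \<partial>lborel)" for i y q K
    using F' by blast+
  have [measurable]: "F i \<in> borel_measurable borel" for i using F(1)[of i] by auto
  have w: "0 < ?w" using W by simp
  have "AE x in lebesgue_on ?\<Omega>. norm (\<chi> i. D x $ i $ v) \<le> G"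
    using G(2) by eventually_elim (rule order.trans[OF norm_column_le])
  then have FG: "AE y in lborel. y \<in> {0..H} \<longrightarrow> norm (\<chi> i. F i y) \<le> G * ?w"
    by (rule marginal_norm_bound[OF W Dint _ F(1) F(3)])
  \<comment> \<open>Setting p to 0 on the null set where the bound fails, and in the component v,
    makes both properties hold everywhere instead of almost everywhere.\<close>
  define p :: "real \<Rightarrow> real^'n" where
    "p y = (if norm (\<chi> i. F i y) \<le> G * ?w then (1 / ?w) *\<^sub>R (\<chi> i. if i = v then 0 else F i y) else 0)" for y
  have normF [measurable]: "(\<lambda>y. norm (\<chi> i. F i y)) \<in> borel_measurable borel"
    by (simp add: norm_vec_def L2_set_def)
  have pv: "p y $ v = 0" for y by (simp add: p_def)
  show thesis
  proof (rule that[of U p])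
    show "0 \<le> G" by (rule G(1))
    show "U y $ v = 0" for y by (simp add: U_def)
    show "p y $ v = 0" for y by (rule pv)
    show "(\<lambda>y. p y $ i) \<in> borel_measurable borel" for i
    proof -
      have "(\<lambda>y. p y $ i) = (\<lambda>y. if norm (\<chi> i. F i y) \<le> G * ?w then (1 / ?w) * (if i = v then 0 else F i y) else 0)"
        by (auto simp: p_def)
      then show ?thesis by simp
    qed
    show "norm (p y) \<le> G" for y
    proof -
      have "norm (\<chi> i. if i = v then 0 else F i y) \<le> norm (\<chi> i. F i y)"
        by (rule norm_le_componentwise_cart) auto
      then show ?thesis
        using G(1) w by (auto simp: p_def divide_le_eq)
    qed
    show "ub x = U (x $ v)" if "x \<in> ?\<Omega>" for x by (rule ubU[OF that])
    fix y i assume y: "y \<in> {0..H}"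
    show "U y $ i = U 0 $ i + (\<integral>r. p r $ i * indicator {0..y} r \<partial>lborel)"
    proof (cases "i = v")
      case True
      then show ?thesis by (simp add: U_def pv)
    next
      case i: False
      obtain K where K: "\<And>y. \<bar>h i y\<bar> \<le> K" using hb by blast
      have hi: "integrable lborel (h i)"
      proof (rule Bochner_Integration.integrable_bound[of lborel "\<lambda>y. K * indicator {0..H} y"])
        show "AE y in lborel. norm (h i y) \<le> norm (K * indicator {0..H} y)"
        proof (rule AE_I2)
          fix y show "norm (h i y) \<le> norm (K * indicator {0..H} y)"
            using K[of y] by (cases "y \<in> {0..H}") (simp_all add: h_def)
        qed
      qed (auto simp: integrable_Icc)
      have "\<exists>c. AE y in lborel. y \<in> {0..H} \<longrightarrow> ?w * h i y + (\<integral>s. F i s * indicator {y..} s \<partial>lborel) = c"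
      proof (rule du_bois_reymond[of "F i" "\<lambda>y. ?w * h i y" H])
        show "integrable lborel (\<lambda>y. ?w * h i y)" using hi by simp
        show "?w * h i y = 0" if "y \<notin> {0..H}" for y using that by (simp add: h_def)
        fix \<psi> assume \<psi>: "bump H \<psi>"
        then have sm: "smooth \<psi>" by (simp add: bump_def)
        obtain K1 where K1: "\<And>y. \<bar>\<psi> y\<bar> \<le> K1" using bump_bounded[OF \<psi>] by blast
        have [measurable]: "\<psi> \<in> borel_measurable borel" "deriv \<psi> \<in> borel_measurable borel"
          using smooth_continuous[OF sm] smooth_continuous_deriv[OF sm] by (auto intro: borel_measurable_continuous_onI)
        obtain K2 where K2: "\<And>y. y \<in> {0..H} \<Longrightarrow> \<bar>deriv \<psi> y\<bar> \<le> K2"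
          using bounded_on_Icc[OF smooth_continuous_deriv[OF sm]] by blast
        have bd: "\<bar>h i y * deriv \<psi> y\<bar> \<le> \<bar>K\<bar> * \<bar>K2\<bar>" for y
        proof (cases "y \<in> {0..H}")
          case True
          then show ?thesis using K[of y] K2[of y] by (auto simp: abs_mult intro!: mult_mono)
        qed (simp add: h_def)
        have "(\<integral>y. F i y * \<psi> y \<partial>lborel) = (\<integral>x. D x $ i $ v * \<psi> (x $ v) \<partial>lebesgue_on ?\<Omega>)"
          by (rule F(3)[symmetric, OF _ K1]) simp
        also have "\<dots> = - (\<integral>x. h i (x $ v) * deriv \<psi> (x $ v) \<partial>lebesgue_on ?\<Omega>)"
          using weak'[OF test_function_bump[OF \<psi>], of i v] by (simp add: frechet_derivative_bump[OF sm])
        also have "(\<integral>x. h i (x $ v) * deriv \<psi> (x $ v) \<partial>lebesgue_on ?\<Omega>)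
            = ?w * (\<integral>y. h i y * deriv \<psi> y * indicator {0..H} y \<partial>lborel)"
          by (rule integral_channel_profile[OF W _ bd]) simp
        also have "(\<lambda>y. h i y * deriv \<psi> y * indicator {0..H} y) = (\<lambda>y. h i y * deriv \<psi> y)"
          by (auto simp: h_def indicator_def)
        finally show "(\<integral>y. F i y * \<psi> y \<partial>lborel) + (\<integral>y. ?w * h i y * deriv \<psi> y \<partial>lborel) = 0"
          by (simp add: mult.assoc)
      qed (use F W in auto)
      then obtain c where c: "AE y in lborel. y \<in> {0..H} \<longrightarrow> ?w * h i y + (\<integral>s. F i s * indicator {y..} s \<partial>lborel) = c" by blast
      define P where "P y = (\<integral>s. F i s * indicator {0..y} s \<partial>lborel)" for y
      have tail: "(\<integral>s. F i s * indicator {y..} s \<partial>lborel) = (\<integral>s. F i s \<partial>lborel) - P y" if "y \<in> {0..H}" for y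
      proof -
        have int: "integrable lborel (\<lambda>s. F i s * indicator A s)" if "A \<in> sets borel" for A
          by (rule integrable_mult_bounded[OF F(1), of _ 1]) (use that in \<open>auto simp: indicator_def\<close>)
        have "(\<integral>s. F i s \<partial>lborel) = (\<integral>s. F i s * indicator {0..y} s + F i s * indicator {y..} s \<partial>lborel)"
        proof (rule integral_cong_AE)
          show "AE s in lborel. F i s = F i s * indicator {0..y} s + F i s * indicator {y..} s"
            using AE_lborel_singleton[of y]
          proof eventually_elim
            case (elim s)
            then show ?case using F(2)[of s i] that by (cases "s < 0") (auto simp: indicator_def)
          qed
        qed auto
        also have "\<dots> = P y + (\<integral>s. F i s * indicator {y..} s \<partial>lborel)"
          unfolding P_def by (intro Bochner_Integration.integral_add int) auto
        finally show ?thesis by simp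
      qed
      have "continuous_on {0..H} (\<lambda>y. ?w * U y $ i - P y)"
        unfolding P_def by (intro continuous_intros Uc continuous_on_primitive F)
      moreover have "AE y in lborel. y \<in> {0..H} \<longrightarrow> ?w * U y $ i - P y = c - (\<integral>s. F i s \<partial>lborel)"
        using c
      proof eventually_elim
        case (elim y)
        show ?case
        proof
          assume "y \<in> {0..H}"
          then show "?w * U y $ i - P y = c - (\<integral>s. F i s \<partial>lborel)"
            using elim tail[of y] by (simp add: h_def)
        qed
      qed
      \<comment> \<open>Constancy almost everywhere becomes constancy everywhere because both U and
        the primitive P are continuous. This is where the continuous representative gives access to
        the values at the walls.\<close>
      ultimately have const: "?w * U y $ i - P y = c - (\<integral>s. F i s \<partial>lborel)" if "y \<in> {0..H}" for y
        using continuous_AE_const_Icc[OF W(2)] that by blast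
      have "P 0 = 0"
      proof -
        have "AE s in lborel. F i s * indicator {0..0} s = 0"
          using AE_lborel_singleton[of 0] by eventually_elim (auto simp: indicator_def)
        then show ?thesis unfolding P_def by (rule integral_eq_zero_AE)
      qed
      then have "?w * U y $ i = ?w * U 0 $ i + P y"
        using const[OF y] const[of 0] W by simp
      moreover have "P y = ?w * (\<integral>r. p r $ i * indicator {0..y} r \<partial>lborel)"
      proof -
        have "P y = (\<integral>r. ?w * (p r $ i * indicator {0..y} r) \<partial>lborel)"
          unfolding P_def
        proof (rule integral_cong_AE)
          show "AE r in lborel. F i r * indicator {0..y} r = ?w * (p r $ i * indicator {0..y} r)"
            using FG by eventually_elim (use y i W(1) in \<open>auto simp: p_def indicator_def\<close>)
          show "(\<lambda>r. ?w * (p r $ i * indicator {0..y} r)) \<in> borel_measurable lborel"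
          proof -
            have "(\<lambda>y. p y $ i) = (\<lambda>y. if norm (\<chi> i. F i y) \<le> G * ?w then (1 / ?w) * (if i = v then 0 else F i y) else 0)"
              by (auto simp: p_def)
            then have "(\<lambda>y. p y $ i) \<in> borel_measurable borel" by simp
            then show ?thesis by simp
          qed
        qed auto
        then show ?thesis by (simp only: integral_mult_right_zero)
      qed
      ultimately have "?w * U y $ i = ?w * (U 0 $ i + (\<integral>r. p r $ i * indicator {0..y} r \<partial>lborel))"
        by (simp add: distrib_left)
      then show ?thesis using W(1) by simp
    qed
  qed
qed

section \<open>Hardy's inequality and the flux\<close>

text \<open>The fundamental theorem of calculus followed by Cauchy-Schwarz, the latter obtained from
  the nonnegative variance of |f'| over [a, b].\<close>

lemma norm_diff_sq_le_integral:
  fixes f :: "real \<Rightarrow> 'b::euclidean_space"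
  assumes ab: "a \<le> b" and f: "\<And>s. (f has_vector_derivative f' s) (at s)" and c: "continuous_on UNIV f'"
  shows "(norm (f b - f a))\<^sup>2 \<le> (b - a) * integral {a..b} (\<lambda>s. (norm (f' s))\<^sup>2)"
proof (cases "a = b")
  case False
  then have ab': "0 < b - a" using ab by simp
  have cn: "continuous_on {a..b} (\<lambda>s. norm (f' s))"
    by (intro continuous_intros continuous_on_subset[OF c]) auto
  define J where "J = integral {a..b} (\<lambda>s. norm (f' s))"
  define I where "I = integral {a..b} (\<lambda>s. (norm (f' s))\<^sup>2)"
  have int: "(\<lambda>s. norm (f' s)) integrable_on {a..b}" "(\<lambda>s. (norm (f' s))\<^sup>2) integrable_on {a..b}"
    by (intro integrable_continuous_interval cn continuous_on_power)+
  have hi: "(f' has_integral (f b - f a)) {a..b}"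
    by (rule fundamental_theorem_of_calculus[OF ab]) (use f has_vector_derivative_at_within in blast)
  have "norm (f b - f a) \<le> J"
    unfolding J_def integral_unique[OF hi, symmetric]
    by (rule integral_norm_bound_integral) (use hi int in auto)
  then have fJ: "(norm (f b - f a))\<^sup>2 \<le> J\<^sup>2" by (intro power_mono) auto
  define m where "m = J / (b - a)"
  have "0 \<le> integral {a..b} (\<lambda>s. (norm (f' s) - m)\<^sup>2)"
    by (rule integral_nonneg) (auto intro!: integrable_continuous_interval continuous_intros cn)
  also have "(\<lambda>s. (norm (f' s) - m)\<^sup>2) = (\<lambda>s. (norm (f' s))\<^sup>2 - 2 * m * norm (f' s) + m\<^sup>2)"
    by (auto simp: power2_diff algebra_simps)
  also have "integral {a..b} \<dots> = I - 2 * m * J + m\<^sup>2 * (b - a)"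
  proof -
    have "((\<lambda>s. (norm (f' s))\<^sup>2 - 2 * m * norm (f' s) + m\<^sup>2) has_integral (I - 2 * m * J + (b - a) * m\<^sup>2)) {a..b}"
      unfolding I_def J_def using int ab
      by (intro has_integral_add has_integral_diff has_integral_mult_right integrable_integral)
         (auto intro: has_integral_const_real[of _ a b, unfolded scaleR_conv_of_real, simplified, THEN has_integral_eq_rhs])
    then show ?thesis by (simp add: integral_unique mult.commute)
  qed
  also have "\<dots> = I - J\<^sup>2 / (b - a)"
  proof -
    have "m * (b - a) = J" using ab' by (simp add: m_def)
    then have "m\<^sup>2 * (b - a) = m * J" by (simp add: power2_eq_square mult.assoc)
    moreover have "J\<^sup>2 / (b - a) = m * J" by (simp add: m_def power2_eq_square)
    ultimately show ?thesis by simp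
  qed
  finally have "J\<^sup>2 \<le> (b - a) * I" using ab' by (simp add: field_simps)
  then show ?thesis using fJ by (simp add: I_def)
qed simp

lemma frechet_eq_grad:
  "frechet_derivative \<phi> (at x) (axis j 1) $ i = grad \<phi> x $ i $ j"
  by (simp add: grad_def jacobian_def matrix_def)

lemma continuous_on_grad:
  fixes \<phi> :: "real^'n \<Rightarrow> real^'n"
  assumes "smooth \<phi>"
  shows "continuous_on UNIV (grad \<phi>)"
proof -
  have "continuous_on UNIV (\<lambda>x. \<chi> i j. frechet_derivative \<phi> (at x) (axis j 1) $ i)"
    by (intro continuous_on_vec_lambda continuous_on_component
        smooth_continuous_derivative[OF assms axis_1_in_Basis])
  moreover have "grad \<phi> = (\<lambda>x. \<chi> i j. frechet_derivative \<phi> (at x) (axis j 1) $ i)"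
    by (simp add: fun_eq_iff vec_eq_iff frechet_eq_grad)
  ultimately show ?thesis by simp
qed

lemma in_L2_continuous:
  fixes f :: "real^'n \<Rightarrow> 'b::euclidean_space"
  assumes "continuous_on UNIV f"
  shows "in_L2 (channel v W H) f"
proof -
  obtain K where "\<And>x. x \<in> channel v W H \<Longrightarrow> norm (f x) \<le> K" using bounded_on_channel[OF assms] by blast
  then show ?thesis
    by (intro in_L2_bounded[OF channel_fmeasurable] borel_measurable_lebesgue_on borel_measurable_continuous_onI assms)
qed

text \<open>On a wall-normal line the value at s is the integral of the derivative from the wall e,
  so its square is at most |s - e| times the energy on that line. Integration over a strip of width
  b - a whose points are no further than that from e produces the second factor b - a. Both walls
  are covered by the choice of e.\<close>

lemma hardy_test_function:
  fixes \<phi> :: "real^'n \<Rightarrow> real^'n"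
  assumes W: "0 < W" "0 < H" and \<phi>: "test_function v W H \<phi>"
    and ab: "0 \<le> a" "a \<le> b" "b \<le> H" and e: "e \<in> {0, H}" and near: "\<And>s. s \<in> {a..b} \<Longrightarrow> \<bar>s - e\<bar> \<le> b - a"
  shows "(\<integral>x. indicator {a..b} (x $ v) * (norm (\<phi> x))\<^sup>2 \<partial>lebesgue_on (channel v W H))
    \<le> (b - a)\<^sup>2 * L2sq (channel v W H) (grad \<phi>)"
proof -
  let ?\<Omega> = "channel v W H" and ?\<delta> = "b - a"
  let ?I = "indicator ?\<Omega> :: real^'n \<Rightarrow> real"
  let ?d = "\<lambda>x. frechet_derivative \<phi> (at x) (axis v 1)"
  have sm: "smooth \<phi>" using \<phi> by (simp add: test_function_def)
  have \<phi>0: "\<phi> x = 0" if "x $ v = e" for x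
    using \<phi> that e unfolding test_function_def by force
  have cd: "continuous_on UNIV ?d" and c\<phi>: "continuous_on UNIV \<phi>"
    by (rule smooth_continuous_derivative[OF sm axis_1_in_Basis] smooth_continuous[OF sm])+
  have [measurable]: "?d \<in> borel_measurable borel" "\<phi> \<in> borel_measurable borel"
    by (intro borel_measurable_continuous_onI cd c\<phi>)+
  have intd: "integrable (lebesgue_on ?\<Omega>) (\<lambda>x. (norm (?d x))\<^sup>2)"
    using in_L2_continuous[OF cd] by (simp add: in_L2_def)
  have int\<phi>: "integrable (lebesgue_on ?\<Omega>) (\<lambda>x. indicator {a..b} (x $ v) * (norm (\<phi> x))\<^sup>2)"
    using integrable_lebesgue_on_mult_bounded[of ?\<Omega> "\<lambda>x. (norm (\<phi> x))\<^sup>2" "\<lambda>x. indicator {a..b} (x $ v)" 1]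
      in_L2_continuous[OF c\<phi>, of v W H] by (simp add: in_L2_def mult.commute)
  let ?L = "\<lambda>x. ?I x * (indicator {a..b} (x $ v) * (norm (\<phi> x))\<^sup>2)"
  let ?R = "\<lambda>x. ?I x * (norm (?d x))\<^sup>2"
  have intL: "integrable lborel ?L" and intR: "integrable lborel ?R"
    using integral_channel_lborel(1)[of "\<lambda>x. indicator {a..b} (x $ v) * (norm (\<phi> x))\<^sup>2" v W H] int\<phi>
      integral_channel_lborel(1)[of "\<lambda>x. (norm (?d x))\<^sup>2" v W H] intd by auto
  interpret P: pair_sigma_finite "hyperplane_measure (axis v (1::real) :: real^'n)" "lborel :: real measure"
    by (rule pair_sigma_finite_hyperplane)
  have line: "(\<integral>s. ?L (on_line (axis v 1) z s) \<partial>lborel) \<le> ?\<delta>\<^sup>2 * (\<integral>s. ?R (on_line (axis v 1) z s) \<partial>lborel)" for z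
  proof (cases "on_line (axis v 1) z 0 \<in> ?\<Omega>")
    case False
    then have "?I (on_line (axis v 1) z 0) = 0" by (rule indicator_simps(2))
    then have "?I (on_line (axis v 1) z s) = 0" for s
      using indicator_channel_on_line[OF W, of v v z s] by (simp only: mult_zero_right)
    then show ?thesis by simp
  next
    case True
    define y0 where "y0 = on_line (axis v 1) z 0"
    let ?l = "\<lambda>s. y0 + s *\<^sub>R axis v 1"
    have l: "on_line (axis v 1) z s = ?l s" for s
      using on_line_shift[of "axis v 1" z 0 s] unfolding y0_def by (simp only: add_0_left)
    have y0: "?I y0 = 1" using True unfolding y0_def[symmetric] by (rule indicator_simps(1))
    have y0v: "y0 $ v = 0" unfolding y0_def by (subst on_line_nth) simp
    have lv: "?l s $ v = s" for s using y0v by (simp add: axis_def)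
    have I: "?I (?l s) = indicator {0..H} s" for s
      using indicator_channel_on_line[OF W, of v v z s] y0 unfolding l y0_def[symmetric]
      by (simp only: if_True refl mult_1_right scaleR_zero_left add_0_right)
    have l': "(?l has_derivative (\<lambda>t. t *\<^sub>R axis v 1)) (at s)" for s
      by (auto intro!: derivative_eq_intros)
    have f': "((\<lambda>s. \<phi> (?l s)) has_vector_derivative ?d (?l s)) (at s)" for s
    proof -
      have "((\<lambda>s. \<phi> (?l s)) has_derivative (\<lambda>t. frechet_derivative \<phi> (at (?l s)) (t *\<^sub>R axis v 1))) (at s)"
        by (rule has_derivative_compose[OF l' smooth_has_derivative[OF sm]])
      then show ?thesis
        unfolding has_vector_derivative_def
        by (rule has_derivative_eq_rhs)
           (simp add: fun_eq_iff linear_scale[OF has_derivative_linear[OF smooth_has_derivative[OF sm, of "?l s"]]])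
    qed
    have cl: "continuous_on UNIV ?l" by (intro continuous_intros)
    have cdl: "continuous_on UNIV (\<lambda>s. ?d (?l s))" and c\<phi>l: "continuous_on UNIV (\<lambda>s. \<phi> (?l s))"
      by (rule continuous_on_compose2[OF cd cl] continuous_on_compose2[OF c\<phi> cl]; simp)+
    define K where "K = integral {0..H} (\<lambda>s. (norm (?d (?l s)))\<^sup>2)"
    have cdl2: "continuous_on A (\<lambda>s. (norm (?d (?l s)))\<^sup>2)" for A
      by (intro continuous_intros continuous_on_subset[OF cdl]) auto
    have int_on: "(\<lambda>s. (norm (?d (?l s)))\<^sup>2) integrable_on {a..b}" for a b :: real
      by (rule integrable_continuous_interval[OF cdl2])
    have K0: "0 \<le> K" unfolding K_def by (rule integral_nonneg[OF int_on]) simp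
    \<comment> \<open>The integral runs upwards from the lower wall or downwards from s to the upper
      one; either way it is dominated by the energy K of the whole line.\<close>
    have pt: "(norm (\<phi> (?l s)))\<^sup>2 \<le> ?\<delta> * K" if s: "s \<in> {a..b}" for s
    proof -
      have \<phi>e: "\<phi> (?l e) = 0" by (rule \<phi>0) (rule lv)
      have sub: "integral {c..d} (\<lambda>s. (norm (?d (?l s)))\<^sup>2) \<le> K" if "0 \<le> c" "d \<le> H" for c d
        unfolding K_def using that by (intro integral_subset_le int_on) auto
      have sn: "0 \<le> s" "s \<le> H" using s ab by auto
      have "(norm (\<phi> (?l s)))\<^sup>2 \<le> \<bar>s - e\<bar> * K"
      proof (cases "e = 0")
        case True
        have "(norm (\<phi> (?l s) - \<phi> (?l e)))\<^sup>2 \<le> (s - e) * integral {e..s} (\<lambda>s. (norm (?d (?l s)))\<^sup>2)"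
          using sn True by (intro norm_diff_sq_le_integral f' cdl) auto
        also have "\<dots> \<le> (s - e) * K"
          using sn True by (intro mult_left_mono sub) auto
        finally show ?thesis using \<phi>e sn True by simp
      next
        case False
        then have eH: "e = H" using e by simp
        have "(norm (\<phi> (?l e) - \<phi> (?l s)))\<^sup>2 \<le> (e - s) * integral {s..e} (\<lambda>s. (norm (?d (?l s)))\<^sup>2)"
          using sn eH by (intro norm_diff_sq_le_integral f' cdl) auto
        also have "\<dots> \<le> (e - s) * K"
          using sn eH by (intro mult_left_mono sub) auto
        finally show ?thesis using \<phi>e sn eH by simp
      qed
      also have "\<dots> \<le> ?\<delta> * K" using near[OF s] K0 by (intro mult_right_mono)
      finally show ?thesis .
    qed
    have RK: "(\<integral>s. indicator {0..H} s * (norm (?d (?l s)))\<^sup>2 \<partial>lborel) = K"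
      unfolding K_def
      using set_borel_integral_eq_integral(2)[OF borel_integrable_atLeastAtMost'[OF cdl2, of 0 H]]
      by (simp add: set_lebesgue_integral_def)
    have "(\<integral>s. indicator {0..H} s * (indicator {a..b} s * (norm (\<phi> (?l s)))\<^sup>2) \<partial>lborel)
        \<le> (\<integral>s. indicator {a..b} s * (?\<delta> * K) \<partial>lborel)"
    proof (rule integral_mono)
      have "set_integrable lborel {a..b} (\<lambda>s. (norm (\<phi> (?l s)))\<^sup>2)"
        by (rule borel_integrable_atLeastAtMost') (intro continuous_intros continuous_on_subset[OF c\<phi>l], simp)
      moreover have "(\<lambda>s. indicator {0..H} s * (indicator {a..b} s * (norm (\<phi> (?l s)))\<^sup>2)) = (\<lambda>s. indicator {a..b} s *\<^sub>R (norm (\<phi> (?l s)))\<^sup>2)"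
        using ab by (auto simp: indicator_def)
      ultimately show "integrable lborel (\<lambda>s. indicator {0..H} s * (indicator {a..b} s * (norm (\<phi> (?l s)))\<^sup>2))"
        by (simp only: set_integrable_def)
      show "integrable lborel (\<lambda>s. indicator {a..b} s * (?\<delta> * K))"
        by (intro integrable_mult_left integrable_Icc)
      show "indicator {0..H} s * (indicator {a..b} s * (norm (\<phi> (?l s)))\<^sup>2) \<le> indicator {a..b} s * (?\<delta> * K)" for s
        using pt[of s] ab by (auto simp: indicator_def)
    qed
    also have "\<dots> = ?\<delta>\<^sup>2 * K" using ab by (simp add: power2_eq_square)
    finally show ?thesis unfolding l I lv RK .
  qed
  have LR: "(\<integral>x. ?L x \<partial>lborel) \<le> ?\<delta>\<^sup>2 * (\<integral>x. ?R x \<partial>lborel)"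
  proof -
    have "(\<integral>x. ?L x \<partial>lborel) = (\<integral>z. (\<integral>s. ?L (on_line (axis v 1) z s) \<partial>lborel) \<partial>hyperplane_measure (axis v 1))"
      by (rule integral_on_line[OF axis_1_in_Basis intL])
    also have "\<dots> \<le> (\<integral>z. ?\<delta>\<^sup>2 * (\<integral>s. ?R (on_line (axis v 1) z s) \<partial>lborel) \<partial>hyperplane_measure (axis v 1))"
    proof (rule integral_mono[OF _ _ line])
      show "integrable (hyperplane_measure (axis v 1)) (\<lambda>z. \<integral>s. ?L (on_line (axis v 1) z s) \<partial>lborel)"
        using P.integrable_fst'[OF integrable_on_line[OF axis_1_in_Basis intL, unfolded case_prod_beta']] by simp
      show "integrable (hyperplane_measure (axis v 1)) (\<lambda>z. ?\<delta>\<^sup>2 * (\<integral>s. ?R (on_line (axis v 1) z s) \<partial>lborel))"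
        using P.integrable_fst'[OF integrable_on_line[OF axis_1_in_Basis intR, unfolded case_prod_beta']]
        by (intro integrable_mult_right) simp
    qed
    also have "\<dots> = ?\<delta>\<^sup>2 * (\<integral>x. ?R x \<partial>lborel)"
      by (subst integral_on_line[OF axis_1_in_Basis intR]) (simp only: integral_mult_right_zero)
    finally show ?thesis .
  qed
  have "(\<integral>x. ?R x \<partial>lborel) = (\<integral>x. (norm (?d x))\<^sup>2 \<partial>lebesgue_on ?\<Omega>)"
    by (rule integral_channel_lborel(2)[symmetric]) simp
  also have "\<dots> \<le> L2sq ?\<Omega> (grad \<phi>)"
    unfolding L2sq_def
  proof (rule integral_mono[OF intd])
    show "integrable (lebesgue_on ?\<Omega>) (\<lambda>x. (norm (grad \<phi> x))\<^sup>2)"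
      using in_L2_continuous[OF continuous_on_grad[OF sm]] by (simp add: in_L2_def)
    have "norm (?d x) \<le> norm (grad \<phi> x)" for x
    proof -
      have "?d x = (\<chi> i. grad \<phi> x $ i $ v)" by (simp add: vec_eq_iff frechet_eq_grad)
      then show ?thesis using norm_column_le[of "grad \<phi> x" v] by simp
    qed
    then show "(norm (?d x))\<^sup>2 \<le> (norm (grad \<phi> x))\<^sup>2" for x by (simp add: power_mono)
  qed
  finally have "?\<delta>\<^sup>2 * (\<integral>x. ?R x \<partial>lborel) \<le> ?\<delta>\<^sup>2 * L2sq ?\<Omega> (grad \<phi>)"
    by (rule mult_left_mono) simp
  with LR show ?thesis
    by (subst integral_channel_lborel(2)) auto
qed

text \<open>Passage to the limit along the approximating test functions, which is where the no-slip
  condition is used. The factor 4 arises from two uses of |a + b|^2 \<le> 2 |a|^2 + 2 |b|^2, one for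
  the field and one for its gradient.\<close>

lemma hardy_H10:
  assumes W: "0 < W" "0 < H" and f: "H10_gradient v W H f g"
    and ab: "0 \<le> a" "a \<le> b" "b \<le> H" and e: "e \<in> {0, H}" and near: "\<And>s. s \<in> {a..b} \<Longrightarrow> \<bar>s - e\<bar> \<le> b - a"
  shows "(\<integral>x. indicator {a..b} (x $ v) * (norm (f x))\<^sup>2 \<partial>lebesgue_on (channel v W H))
    \<le> 4 * (b - a)\<^sup>2 * L2sq (channel v W H) g"
proof -
  let ?\<Omega> = "channel v W H" and ?\<delta> = "b - a"
  let ?cut = "\<lambda>h x. indicator {a..b} (x $ v) *\<^sub>R h x"
  obtain \<phi> where \<phi>: "\<And>k::nat. test_function v W H (\<phi> k)"
    and lim: "(\<lambda>k. L2sq ?\<Omega> (\<lambda>x. \<phi> k x - f x)) \<longlonglongrightarrow> 0" "(\<lambda>k. L2sq ?\<Omega> (\<lambda>x. grad (\<phi> k) x - g x)) \<longlonglongrightarrow> 0"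
    using f unfolding H10_gradient_def by blast
  have fg: "in_L2 ?\<Omega> f" "in_L2 ?\<Omega> g" using f by (auto simp: H10_gradient_def)
  have sm: "smooth (\<phi> k)" for k using \<phi>[of k] by (simp add: test_function_def)
  have \<phi>L: "in_L2 ?\<Omega> (\<phi> k)" "in_L2 ?\<Omega> (grad (\<phi> k))" for k
    by (intro in_L2_continuous smooth_continuous continuous_on_grad sm)+
  have cutL: "in_L2 ?\<Omega> (?cut h)" and cut_le: "L2sq ?\<Omega> (?cut h) \<le> L2sq ?\<Omega> h"
    if h: "in_L2 ?\<Omega> h" for h :: "_ \<Rightarrow> real^'a"
  proof -
    have [measurable]: "(\<lambda>x::real^'a. indicator {a..b} (x $ v) :: real) \<in> borel_measurable borel" by measurable
    have eq: "(\<lambda>x. (norm (?cut h x))\<^sup>2) = (\<lambda>x. (norm (h x))\<^sup>2 * indicator {a..b} (x $ v))"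
      by (auto simp: indicator_def)
    have int: "integrable (lebesgue_on ?\<Omega>) (\<lambda>x. (norm (?cut h x))\<^sup>2)"
      unfolding eq using integrable_lebesgue_on_mult_bounded[of ?\<Omega> "\<lambda>x. (norm (h x))\<^sup>2" "\<lambda>x. indicator {a..b} (x $ v)" 1] h
      by (simp add: in_L2_def)
    show "in_L2 ?\<Omega> (?cut h)"
      unfolding in_L2_def using h int
      by (intro conjI borel_measurable_scaleR[OF borel_measurable_lebesgue_on]) (auto simp: in_L2_def)
    show "L2sq ?\<Omega> (?cut h) \<le> L2sq ?\<Omega> h"
      unfolding L2sq_def using h int by (intro integral_mono) (auto simp: in_L2_def indicator_def)
  qed
  have cut_eq: "L2sq ?\<Omega> (?cut h) = (\<integral>x. indicator {a..b} (x $ v) * (norm (h x))\<^sup>2 \<partial>lebesgue_on ?\<Omega>)"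
    for h :: "_ \<Rightarrow> real^'a"
    unfolding L2sq_def by (rule Bochner_Integration.integral_cong) (auto simp: indicator_def)
  have "L2sq ?\<Omega> (?cut f) \<le> 2 * ?\<delta>\<^sup>2 * (2 * L2sq ?\<Omega> g + 2 * L2sq ?\<Omega> (\<lambda>x. grad (\<phi> k) x - g x))
      + 2 * L2sq ?\<Omega> (\<lambda>x. \<phi> k x - f x)" for k
  proof -
    have "L2sq ?\<Omega> (?cut f) = L2sq ?\<Omega> (\<lambda>x. ?cut (\<phi> k) x + ?cut (\<lambda>x. f x - \<phi> k x) x)"
      by (simp add: scaleR_diff_right)
    also have "\<dots> \<le> 2 * L2sq ?\<Omega> (?cut (\<phi> k)) + 2 * L2sq ?\<Omega> (?cut (\<lambda>x. f x - \<phi> k x))"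
      by (intro L2sq_add_le cutL \<phi>L in_L2_diff fg)
    also have "L2sq ?\<Omega> (?cut (\<phi> k)) \<le> ?\<delta>\<^sup>2 * L2sq ?\<Omega> (grad (\<phi> k))"
      unfolding cut_eq by (rule hardy_test_function[OF W \<phi> ab e near])
    also have "L2sq ?\<Omega> (grad (\<phi> k)) = L2sq ?\<Omega> (\<lambda>x. g x + (grad (\<phi> k) x - g x))" by simp
    also have "\<dots> \<le> 2 * L2sq ?\<Omega> g + 2 * L2sq ?\<Omega> (\<lambda>x. grad (\<phi> k) x - g x)"
      by (intro L2sq_add_le in_L2_diff \<phi>L fg)
    also have "L2sq ?\<Omega> (?cut (\<lambda>x. f x - \<phi> k x)) \<le> L2sq ?\<Omega> (\<lambda>x. \<phi> k x - f x)"
      using cut_le[OF in_L2_diff[OF fg(1) \<phi>L(1)[of k]]] by (simp add: L2sq_def norm_minus_commute)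
    finally show ?thesis by (simp add: mult_left_mono)
  qed
  moreover have "(\<lambda>k. 2 * ?\<delta>\<^sup>2 * (2 * L2sq ?\<Omega> g + 2 * L2sq ?\<Omega> (\<lambda>x. grad (\<phi> k) x - g x))
      + 2 * L2sq ?\<Omega> (\<lambda>x. \<phi> k x - f x)) \<longlonglongrightarrow> 2 * ?\<delta>\<^sup>2 * (2 * L2sq ?\<Omega> g + 2 * 0) + 2 * 0"
    by (intro tendsto_intros lim)
  ultimately have "L2sq ?\<Omega> (?cut f) \<le> 2 * ?\<delta>\<^sup>2 * (2 * L2sq ?\<Omega> g + 2 * 0) + 2 * 0"
    by (intro LIMSEQ_le_const) auto
  then show ?thesis by (simp add: cut_eq)
qed

text \<open>Testing the vanishing divergence with \<psi>(x_v) shows that the flux through the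
  section at height y does not depend on y. It ought to be zero at the wall, but no pointwise trace
  is at hand; instead its average over a layer [0, \<delta>] is estimated by Hardy's inequality and
  \<delta> tends to 0.\<close>

lemma flux_eq_0:
  fixes f :: "real^'n \<Rightarrow> real^'n"
  assumes W: "0 < W" "0 < H" and f: "H10_gradient v W H f g"
    and div: "AE x in lebesgue_on (channel v W H). trace (g x) = 0"
    and q [measurable]: "q \<in> borel_measurable borel" and qb: "\<And>y. \<bar>q y\<bar> \<le> K"
  shows "(\<integral>x. f x $ v * q (x $ v) \<partial>lebesgue_on (channel v W H)) = 0"
proof -
  let ?\<Omega> = "channel v W H" and ?w = "W ^ (CARD('n) - 1)"
  have wg: "weak_gradient v W H f g" and fL: "in_L2 ?\<Omega> f"
    using f by (auto simp: H10_gradient_def)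
  have fint: "integrable (lebesgue_on ?\<Omega>) (\<lambda>x. f x $ i)" and gint: "integrable (lebesgue_on ?\<Omega>) (\<lambda>x. g x $ i $ j)" for i j
    using wg by (auto intro!: integrable_nth simp: weak_gradient_def)
  obtain m where m: "integrable lborel m" "\<And>y. y \<notin> {0..H} \<Longrightarrow> m y = 0"
    "\<And>q K. q \<in> borel_measurable borel \<Longrightarrow> (\<And>y. \<bar>q y\<bar> \<le> K) \<Longrightarrow>
       (\<integral>x. f x $ v * q (x $ v) \<partial>lebesgue_on ?\<Omega>) = (\<integral>y. m y * q y \<partial>lborel)"
    using channel_marginal[OF fint[of v]] by blast
  have "\<exists>c. AE y in lborel. y \<in> {0..H} \<longrightarrow> m y + (\<integral>s. 0 * indicator {y..} s \<partial>lborel) = c"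
  proof (rule du_bois_reymond[of "\<lambda>_. 0" m H])
    fix \<psi> assume \<psi>: "bump H \<psi>"
    have sm: "smooth \<psi>" using \<psi> by (simp add: bump_def)
    obtain K0 where K0: "\<And>y. \<bar>\<psi> y\<bar> \<le> K0" using bump_bounded[OF \<psi>] by blast
    have c: "continuous_on UNIV \<psi>" "continuous_on UNIV (deriv \<psi>)"
      using smooth_continuous[OF sm] smooth_continuous_deriv[OF sm] by auto
    have [measurable]: "\<psi> \<in> borel_measurable borel" "deriv \<psi> \<in> borel_measurable borel"
      using c by (auto intro: borel_measurable_continuous_onI)
    obtain K1 where K1: "\<And>y. y \<in> {0..H} \<Longrightarrow> \<bar>deriv \<psi> y\<bar> \<le> K1"
      using bounded_on_Icc[OF smooth_continuous_deriv[OF sm]] by blast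
    define d\<psi> where "d\<psi> y = deriv \<psi> y * indicator {0..H} y" for y
    have d\<psi>: "d\<psi> \<in> borel_measurable borel" "\<And>y. \<bar>d\<psi> y\<bar> \<le> \<bar>K1\<bar>"
      using K1 unfolding d\<psi>_def by (measurable, force simp: indicator_def)
    have tf: "test_function v W H (\<lambda>x::real^'n. \<psi> (x $ v))" by (rule test_function_bump[OF \<psi>])
    have weak: "(\<integral>x. f x $ j * (deriv \<psi> (x $ v) * axis j 1 $ v) \<partial>lebesgue_on ?\<Omega>)
        = - (\<integral>x. g x $ j $ j * \<psi> (x $ v) \<partial>lebesgue_on ?\<Omega>)" for j
      using wg tf unfolding weak_gradient_def frechet_derivative_bump[OF sm, symmetric] by blast
    have "(\<integral>y. m y * deriv \<psi> y \<partial>lborel) = (\<integral>y. m y * d\<psi> y \<partial>lborel)"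
      by (rule Bochner_Integration.integral_cong) (use m(2) in \<open>auto simp: d\<psi>_def indicator_def\<close>)
    also have "\<dots> = (\<integral>x. f x $ v * d\<psi> (x $ v) \<partial>lebesgue_on ?\<Omega>)"
      by (rule m(3)[OF d\<psi>, symmetric])
    also have "\<dots> = (\<integral>x. f x $ v * (deriv \<psi> (x $ v) * axis v 1 $ v) \<partial>lebesgue_on ?\<Omega>)"
      by (rule Bochner_Integration.integral_cong) (auto simp: d\<psi>_def channel_def)
    \<comment> \<open>The summands with j different from v are zero. They are added so that the weak
      gradient identity produces the full trace of g.\<close>
    also have "\<dots> = (\<Sum>j\<in>UNIV. \<integral>x. f x $ j * (deriv \<psi> (x $ v) * axis j 1 $ v) \<partial>lebesgue_on ?\<Omega>)"
      by (subst sum.remove[of _ v]) (auto simp: axis_def intro!: sum.neutral)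
    also have "\<dots> = - (\<Sum>j\<in>UNIV. \<integral>x. g x $ j $ j * \<psi> (x $ v) \<partial>lebesgue_on ?\<Omega>)"
      unfolding weak sum_negf ..
    also have "(\<Sum>j\<in>UNIV. \<integral>x. g x $ j $ j * \<psi> (x $ v) \<partial>lebesgue_on ?\<Omega>)
        = (\<integral>x. (\<Sum>j\<in>UNIV. g x $ j $ j * \<psi> (x $ v)) \<partial>lebesgue_on ?\<Omega>)"
      by (rule Bochner_Integration.integral_sum[symmetric])
         (rule integrable_lebesgue_on_mult_bounded[OF gint, of _ K0]; use K0 in simp)
    also have "\<dots> = 0"
      by (rule integral_eq_zero_AE)
         (use div in \<open>auto elim!: eventually_mono simp: trace_def sum_distrib_right[symmetric]\<close>)
    finally show "(\<integral>y. 0 * \<psi> y \<partial>lborel) + (\<integral>y. m y * deriv \<psi> y \<partial>lborel) = 0" by simp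
  qed (use m W in auto)
  then obtain c where c: "AE y in lborel. y \<in> {0..H} \<longrightarrow> m y = c" by auto
  have mq: "(\<integral>x. f x $ v * q (x $ v) \<partial>lebesgue_on ?\<Omega>) = c * (\<integral>y. q y * indicator {0..H} y \<partial>lborel)"
    if [measurable]: "q \<in> borel_measurable borel" and "\<And>y. \<bar>q y\<bar> \<le> K" for q K
  proof -
    have [measurable]: "m \<in> borel_measurable borel" using m(1) by auto
    have "(\<integral>y. m y * q y \<partial>lborel) = (\<integral>y. c * (q y * indicator {0..H} y) \<partial>lborel)"
      by (rule integral_cong_AE) (use c m(2) in \<open>auto elim!: eventually_mono simp: indicator_def\<close>)
    then show ?thesis using m(3)[OF that] by simp
  qed
  \<comment> \<open>Young's inequality |f| \<le> r + |f|^2 / r with r =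
    \<open>sqrt \<delta>\<close>: over the layer the first term contributes \<delta> r times the
    area, and Hardy bounds the second by 4 \<delta>^2 / r = 4 \<delta> r times the dissipation.
    Dividing by \<delta> leaves a factor r.\<close>
  have bound: "\<bar>c\<bar> \<le> sqrt \<delta> * (?w + 4 * L2sq ?\<Omega> g)" if \<delta>: "0 < \<delta>" "\<delta> \<le> H" for \<delta>
  proof -
    let ?r = "sqrt \<delta>" and ?i = "\<lambda>x. indicator {0..\<delta>} (x $ v) :: real"
    have r: "0 < ?r" "?r * ?r = \<delta>" using \<delta> by auto
    have f2: "integrable (lebesgue_on ?\<Omega>) (\<lambda>x. ?i x * (norm (f x))\<^sup>2)"
      using integrable_lebesgue_on_mult_bounded[of ?\<Omega> "\<lambda>x. (norm (f x))\<^sup>2" ?i 1] fL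
      by (simp add: in_L2_def mult.commute)
    have i1: "integrable (lebesgue_on ?\<Omega>) ?i"
      by (rule integrable_bounded_channel[of _ _ _ _ 1]) auto
    have fi: "integrable (lebesgue_on ?\<Omega>) (\<lambda>x. f x $ v * ?i x)"
      by (rule integrable_lebesgue_on_mult_bounded[OF fint, of _ 1]) auto
    have vol: "(\<integral>x. ?i x \<partial>lebesgue_on ?\<Omega>) = ?w * \<delta>"
    proof -
      have "(\<integral>x. ?i x \<partial>lebesgue_on ?\<Omega>) = ?w * (\<integral>y. indicator {0..\<delta>} y * indicator {0..H} y \<partial>lborel)"
        by (rule integral_channel_profile[OF W, of "indicator {0..\<delta>}" 1]) auto
      also have "(\<lambda>y. indicator {0..\<delta>} y * indicator {0..H} y :: real) = indicator {0..\<delta>}"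
        using \<delta> by (auto simp: indicator_def)
      finally show ?thesis using \<delta> by simp
    qed
    have "c * \<delta> = (\<integral>x. f x $ v * ?i x \<partial>lebesgue_on ?\<Omega>)"
    proof -
      have "(\<integral>y. indicator {0..\<delta>} y * indicator {0..H} y \<partial>lborel) = \<delta>"
      proof -
        have "(\<lambda>y. indicator {0..\<delta>} y * indicator {0..H} y :: real) = indicator {0..\<delta>}"
          using \<delta> by (auto simp: indicator_def)
        then show ?thesis using \<delta> by simp
      qed
      then show ?thesis using mq[of "indicator {0..\<delta>}" 1] by simp
    qed
    then have "\<bar>c\<bar> * \<delta> = \<bar>\<integral>x. f x $ v * ?i x \<partial>lebesgue_on ?\<Omega>\<bar>"
      using \<delta> by (metis abs_mult abs_of_pos)
    also have "\<dots> \<le> (\<integral>x. \<bar>f x $ v * ?i x\<bar> \<partial>lebesgue_on ?\<Omega>)"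
      using integral_norm_bound[of "lebesgue_on ?\<Omega>" "\<lambda>x. f x $ v * ?i x"] by simp
    also have "\<dots> \<le> (\<integral>x. ?r * ?i x + (1 / ?r) * (?i x * (norm (f x))\<^sup>2) \<partial>lebesgue_on ?\<Omega>)"
    proof (rule integral_mono)
      fix x
      have "\<bar>f x $ v\<bar> \<le> norm (f x)" by (rule component_le_norm_cart)
      also have "\<dots> \<le> ?r + (1 / ?r) * (norm (f x))\<^sup>2"
      proof -
        have "norm (f x) * ?r \<le> ?r * ?r + (norm (f x))\<^sup>2"
          using sum_squares_bound[of "norm (f x)" ?r] mult_nonneg_nonneg[OF norm_ge_zero[of "f x"] less_imp_le[OF r(1)]]
          unfolding power2_eq_square by linarith
        then show ?thesis using r(1) by (simp add: field_simps)
      qed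
      finally show "\<bar>f x $ v * ?i x\<bar> \<le> ?r * ?i x + (1 / ?r) * (?i x * (norm (f x))\<^sup>2)"
        by (auto simp: indicator_def)
    qed (use f2 i1 fi in auto)
    also have "\<dots> = ?r * (?w * \<delta>) + (1 / ?r) * (\<integral>x. ?i x * (norm (f x))\<^sup>2 \<partial>lebesgue_on ?\<Omega>)"
      using f2 i1 vol by simp
    also have "(\<integral>x. ?i x * (norm (f x))\<^sup>2 \<partial>lebesgue_on ?\<Omega>) \<le> 4 * \<delta>\<^sup>2 * L2sq ?\<Omega> g"
      using hardy_H10[OF W f, of 0 \<delta> 0] \<delta> by simp
    finally have "\<bar>c\<bar> * \<delta> \<le> ?r * (?w * \<delta>) + (1 / ?r) * (4 * \<delta>\<^sup>2 * L2sq ?\<Omega> g)"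
      using r(1) by (simp add: mult_left_mono divide_right_mono)
    also have "(1 / ?r) * (4 * \<delta>\<^sup>2 * L2sq ?\<Omega> g) = ?r * (4 * L2sq ?\<Omega> g) * \<delta>"
    proof -
      have \<delta>2: "\<delta>\<^sup>2 = ?r * ?r * \<delta>" using r(2) by (simp add: power2_eq_square)
      have "(1 / r) * (4 * (r * r * d) * L) = r * (4 * L) * d" if "0 < r" for r d L :: real
        using that by (simp add: field_simps)
      from this[OF r(1)] show ?thesis unfolding \<delta>2 .
    qed
    finally have "\<bar>c\<bar> * \<delta> \<le> (?r * (?w + 4 * L2sq ?\<Omega> g)) * \<delta>"
      by (simp add: algebra_simps)
    then show ?thesis using \<delta>(1) by (rule mult_right_le_imp_le)
  qed
  have "\<bar>c\<bar> \<le> 0"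
  proof (rule tendsto_lowerbound)
    show "((\<lambda>\<delta>. sqrt \<delta> * (?w + 4 * L2sq ?\<Omega> g)) \<longlongrightarrow> 0) (at_right 0)"
      by (auto intro!: tendsto_eq_intros)
    show "\<forall>\<^sub>F \<delta> in at_right 0. \<bar>c\<bar> \<le> sqrt \<delta> * (?w + 4 * L2sq ?\<Omega> g)"
      using eventually_at_right_real[OF W(2)] by eventually_elim (use bound in auto)
  qed simp
  then show ?thesis using mq[OF q qb] by simp
qed

section \<open>Comparison with a steady profile\<close>

lemma fst_snd_borel [measurable]:
  "(\<lambda>p::real \<times> (real^'n). fst p) \<in> borel_measurable borel" "(\<lambda>p::real \<times> (real^'n). snd p $ v) \<in> borel_measurable borel"
  by (intro borel_measurable_continuous_onI continuous_intros)+

section \<open>Slicing the space-time cylinder and testing with steady profiles\<close>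

text \<open>Fubini supplies an integrable function of time that agrees with the spatial integrals
  for almost every t. It replaces the function of these integrals, which need not be meaningful at
  exceptional times.\<close>

lemma time_slices:
  fixes h :: "real \<times> (real^'n) \<Rightarrow> real"
  assumes h: "integrable (lebesgue_on ({0..T} \<times> channel v W H)) h"
  obtains F where "integrable lborel F" "\<And>t. t \<notin> {0..T} \<Longrightarrow> F t = 0"
    "AE t in lborel. t \<in> {0..T} \<longrightarrow> F t = (\<integral>x. h (t, x) \<partial>lebesgue_on (channel v W H))"
    "\<And>t. t \<in> {0..T} \<Longrightarrow> (\<integral>p. h p \<partial>lebesgue_on ({0..t} \<times> channel v W H)) = (\<integral>s. F s * indicator {0..t} s \<partial>lborel)"
proof -
  let ?\<Omega> = "channel v W H" and ?S = "{0..T} \<times> channel v W H"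
  have S: "{0..t} \<times> ?\<Omega> \<in> sets borel" for t :: real
  proof -
    have "{0..t} \<times> ?\<Omega> \<in> sets (borel \<Otimes>\<^sub>M borel)" by (intro pair_measureI) auto
    then show ?thesis by (simp only: borel_prod)
  qed
  obtain h' where h'[measurable]: "h' \<in> borel_measurable borel" and h'_eq: "AE p in lborel. p \<in> ?S \<longrightarrow> h' p = h p"
    and h'_0: "\<And>p. p \<notin> ?S \<Longrightarrow> h' p = 0"
    using lebesgue_on_borel_representative[OF S borel_measurable_integrable[OF h]] by blast
  have int: "integrable lborel h'"
    using lebesgue_on_eq_lborel(1)[OF S h' h'_0 h'_eq] h by blast
  then have int2: "integrable (lborel \<Otimes>\<^sub>M lborel) h'" by (simp only: lborel_prod)
  define F where "F t = (\<integral>x. h' (t, x) \<partial>lborel)" for t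
  have h'm: "(\<lambda>x. h' (t, x)) \<in> borel_measurable borel" for t
  proof -
    have "h' \<in> borel_measurable (borel \<Otimes>\<^sub>M borel)" using h' by (simp only: borel_prod)
    then show ?thesis by measurable
  qed
  show thesis
  proof
    show "integrable lborel F"
      unfolding F_def by (rule lborel_pair.integrable_fst'[OF int2])
    show "F t = 0" if "t \<notin> {0..T}" for t
    proof -
      have "h' (t, x) = 0" for x by (rule h'_0) (use that in auto)
      then show ?thesis by (simp add: F_def)
    qed
    have "AE p in lborel \<Otimes>\<^sub>M lborel. p \<in> ?S \<longrightarrow> h' p = h p"
      using h'_eq by (simp only: lborel_prod)
    then have "AE t in lborel. AE x in lborel. (t, x) \<in> ?S \<longrightarrow> h' (t, x) = h (t, x)"
      by (rule lborel_pair.AE_pair)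
    then show "AE t in lborel. t \<in> {0..T} \<longrightarrow> F t = (\<integral>x. h (t, x) \<partial>lebesgue_on ?\<Omega>)"
    proof eventually_elim
      case (elim t)
      show ?case
      proof
        assume t: "t \<in> {0..T}"
        have ae: "AE x in lborel. x \<in> ?\<Omega> \<longrightarrow> h' (t, x) = h (t, x)"
          using elim t by auto
        have z: "h' (t, x) = 0" if "x \<notin> ?\<Omega>" for x using that h'_0 by auto
        show "F t = (\<integral>x. h (t, x) \<partial>lebesgue_on ?\<Omega>)"
          unfolding F_def by (rule lebesgue_on_eq_lborel(2)[OF channel_borel h'm z ae, symmetric])
      qed
    qed
    fix t assume t: "t \<in> {0..T}"
    let ?k = "\<lambda>p. h' p * indicator {0..t} (fst p)"
    have km: "?k \<in> borel_measurable borel"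
    proof -
      have "h' \<in> borel_measurable (borel \<Otimes>\<^sub>M borel)" using h' by (simp only: borel_prod)
      then have "?k \<in> borel_measurable (borel \<Otimes>\<^sub>M borel)" by measurable
      then show ?thesis by (simp only: borel_prod)
    qed
    have "(\<integral>p. h p \<partial>lebesgue_on ({0..t} \<times> ?\<Omega>)) = (\<integral>p. ?k p \<partial>lborel)"
    proof (rule lebesgue_on_eq_lborel(2)[OF S km])
      show "?k p = 0" if "p \<notin> {0..t} \<times> ?\<Omega>" for p
        using that h'_0[of p] t by (cases p) (auto simp: indicator_def)
      show "AE p in lborel. p \<in> {0..t} \<times> ?\<Omega> \<longrightarrow> ?k p = h p"
        using h'_eq by eventually_elim (use t in auto)
    qed
    also have "\<dots> = (\<integral>p. ?k p \<partial>(lborel \<Otimes>\<^sub>M lborel))" by (simp only: lborel_prod)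
    also have "\<dots> = (\<integral>s. \<integral>x. ?k (s, x) \<partial>lborel \<partial>lborel)"
    proof (rule lborel_pair.integral_fst'[symmetric])
      have "integrable lborel ?k"
      proof (rule integrable_mult_bounded[OF int, of _ 1])
        show "(\<lambda>p::real \<times> (real^'n). indicator {0..t} (fst p) :: real) \<in> borel_measurable lborel"
          by measurable
      qed (simp add: indicator_def)
      then show "integrable (lborel \<Otimes>\<^sub>M lborel) ?k" by (simp only: lborel_prod)
    qed
    also have "\<dots> = (\<integral>s. F s * indicator {0..t} s \<partial>lborel)"
      by (simp add: F_def)
    finally show "(\<integral>p. h p \<partial>lebesgue_on ({0..t} \<times> ?\<Omega>)) = (\<integral>s. F s * indicator {0..t} s \<partial>lborel)" .
  qed
qed

text \<open>A tangential field depending only on time and height is divergence-free and periodic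
  whatever its profile. It may have a nonzero mean flux along the channel, which the class of test
  fields permits.\<close>

lemma solenoidal_test_profile:
  fixes v i :: "'n::finite" and W H T :: real
  assumes i: "i \<noteq> v" and \<theta>: "smooth \<theta>" "\<exists>\<delta>>0. \<forall>t\<ge>T - \<delta>. \<theta> t = 0" and \<psi>: "bump H \<psi>"
  defines "\<Phi> \<equiv> \<lambda>t (x::real^'n). (\<theta> t * \<psi> (x $ v)) *\<^sub>R axis i (1::real)"
  shows "solenoidal_test_field v W H T \<Phi>"
    and "vector_derivative (\<lambda>s. \<Phi> s x) (at t) = (deriv \<theta> t * \<psi> (x $ v)) *\<^sub>R axis i 1"
    and "grad (\<Phi> t) x = (\<chi> k j. if k = i \<and> j = v then \<theta> t * deriv \<psi> (x $ v) else 0)"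
proof -
  have sm: "smooth \<psi>" using \<psi> by (simp add: bump_def)
  have d: "(\<Phi> t has_derivative (\<lambda>h. (\<theta> t * (deriv \<psi> (x $ v) * h $ v)) *\<^sub>R axis i 1)) (at x)" for t x
  proof -
    have "((\<lambda>x. \<psi> (x $ v)) has_derivative (\<lambda>h. deriv \<psi> (x $ v) * (h $ v))) (at x)"
      using has_derivative_compose[OF nth_has_derivative
          smooth_has_real_derivative[OF sm, unfolded has_field_derivative_def], of v x] by simp
    then show ?thesis
      unfolding \<Phi>_def by (intro has_derivative_scaleR_left has_derivative_mult_right)
  qed
  show g: "grad (\<Phi> t) x = (\<chi> k j. if k = i \<and> j = v then \<theta> t * deriv \<psi> (x $ v) else 0)" for t x
    unfolding grad_def jacobian_def frechet_derivative_at[OF d, symmetric]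
    by (simp add: matrix_def vec_eq_iff axis_def)
  have "((\<lambda>s. \<Phi> s x) has_vector_derivative (deriv \<theta> t * \<psi> (x $ v)) *\<^sub>R axis i 1) (at t)"
  proof -
    have "((\<lambda>s. \<theta> s * \<psi> (x $ v)) has_real_derivative deriv \<theta> t * \<psi> (x $ v)) (at t)"
      using smooth_has_real_derivative[OF \<theta>(1)] by (rule DERIV_cmult_right)
    then show ?thesis
      unfolding \<Phi>_def has_real_derivative_iff_has_vector_derivative
      by (rule bounded_linear.has_vector_derivative[OF bounded_linear_scaleR_left])
  qed
  then show "vector_derivative (\<lambda>s. \<Phi> s x) (at t) = (deriv \<theta> t * \<psi> (x $ v)) *\<^sub>R axis i 1"
    by (rule vector_derivative_at)
  have "smooth (\<lambda>p. (\<theta> (fst p) * \<psi> (snd p $ v)) *\<^sub>R (axis i 1 :: real^'n))"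
  proof (intro smooth_scaleR smooth_mult smooth_const)
    show "smooth (\<lambda>p::real \<times> (real^'n). \<theta> (fst p))"
      by (rule smooth_compose[OF \<theta>(1) smooth_bounded_linear[OF bounded_linear_fst]])
    show "smooth (\<lambda>p::real \<times> (real^'n). \<psi> (snd p $ v))"
      by (rule smooth_compose[OF sm smooth_bounded_linear[OF bounded_linear_compose[OF bounded_linear_vec_nth bounded_linear_snd]]])
  qed
  then have "smooth (\<lambda>(t, x). \<Phi> t x)" by (simp add: \<Phi>_def case_prod_beta')
  moreover have "periodic v W H (\<Phi> t)" for t
    by (auto simp: periodic_def \<Phi>_def axis_def)
  moreover have "divergence_free (\<Phi> t)" for t
    using i unfolding divergence_free_def g trace_def by (auto intro!: sum.neutral)
  moreover have "\<exists>\<delta>>0. \<forall>t x. T - \<delta> \<le> t \<or> x $ v \<le> \<delta> \<or> H - \<delta> \<le> x $ v \<longrightarrow> \<Phi> t x = 0"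
  proof -
    obtain \<delta>1 where \<delta>1: "0 < \<delta>1" "\<And>t. T - \<delta>1 \<le> t \<Longrightarrow> \<theta> t = 0" using \<theta>(2) by blast
    obtain \<delta>2 where \<delta>2: "0 < \<delta>2" "\<And>y. y \<le> \<delta>2 \<or> H - \<delta>2 \<le> y \<Longrightarrow> \<psi> y = 0"
      using \<psi> unfolding bump_def by blast
    have "\<Phi> t x = 0" if "T - min \<delta>1 \<delta>2 \<le> t \<or> x $ v \<le> min \<delta>1 \<delta>2 \<or> H - min \<delta>1 \<delta>2 \<le> x $ v" for t x
    proof -
      have "T - \<delta>1 \<le> t \<or> x $ v \<le> \<delta>2 \<or> H - \<delta>2 \<le> x $ v" using that by linarith
      then have "\<theta> t = 0 \<or> \<psi> (x $ v) = 0" using \<delta>1(2)[of t] \<delta>2(2)[of "x $ v"] by blast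
      then show ?thesis by (auto simp: \<Phi>_def)
    qed
    then show ?thesis using \<delta>1(1) \<delta>2(1) by (intro exI[of _ "min \<delta>1 \<delta>2"]) auto
  qed
  ultimately show "solenoidal_test_field v W H T \<Phi>"
    by (simp add: solenoidal_test_field_def)
qed

lemma spacetime_borel: "{0..t::real} \<times> channel v W H \<in> sets borel"
proof -
  have "{0..t} \<times> channel v W H \<in> sets (borel \<Otimes>\<^sub>M borel)" by (intro pair_measureI) auto
  then show ?thesis by (simp only: borel_prod)
qed

lemma spacetime_lmeasurable: "{0..T::real} \<times> channel v W H \<in> lmeasurable"
proof -
  have "{0..T} \<times> channel v W H = cbox (0, 0) (T, \<chi> i. if i = v then H else W)"
    by (simp only: channel_eq_cbox cbox_Pair_eq box_real(2))
  then show ?thesis by simp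
qed

lemma integrable_if_in_L2_spacetime:
  fixes f :: "real \<times> (real^'n) \<Rightarrow> real"
  assumes "in_L2 ({0..T} \<times> channel v W H) f"
  shows "integrable (lebesgue_on ({0..T} \<times> channel v W H)) f"
proof -
  have "in_L2 ({0..T} \<times> channel v W H) (\<lambda>_. 1 :: real)"
    by (rule in_L2_bounded[OF spacetime_lmeasurable, where K = 1]) auto
  from in_L2_inner_integrable[OF assms this] show ?thesis by simp
qed

lemma integrable_spacetime_mult_bounded:
  fixes f g :: "real \<times> (real^'n) \<Rightarrow> real"
  assumes f: "integrable (lebesgue_on ({0..T} \<times> channel v W H)) f" and g: "g \<in> borel_measurable borel"
    and b: "\<And>p. p \<in> {0..T} \<times> channel v W H \<Longrightarrow> \<bar>g p\<bar> \<le> K"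
  shows "integrable (lebesgue_on ({0..T} \<times> channel v W H)) (\<lambda>p. f p * g p)"
  by (rule integrable_mult_bounded[OF f, of _ K]) (use g b in \<open>auto intro!: borel_measurable_lebesgue_on AE_I2\<close>)

lemma primitive_props:
  fixes q P :: "real \<Rightarrow> real"
  assumes [measurable]: "q \<in> borel_measurable borel" and qb: "\<And>y. \<bar>q y\<bar> \<le> K" and q0: "\<And>y. y \<notin> {0..H} \<Longrightarrow> q y = 0"
    and H: "0 < H" and P: "\<And>y. P y = (\<integral>r. q r * indicator {0..y} r \<partial>lborel)"
  shows "P \<in> borel_measurable borel" and "\<bar>P y\<bar> \<le> K * H"
proof -
  have K0: "0 \<le> K" using qb[of 0] by linarith
  have [measurable]: "(\<lambda>(y :: real, s). indicator {0..y} s :: real) \<in> borel_measurable (lborel \<Otimes>\<^sub>M lborel)"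
  proof -
    have eq: "(\<lambda>(y :: real, s). indicator {0..y} s :: real) = (\<lambda>p. if 0 \<le> snd p \<and> snd p \<le> fst p then 1 else 0)"
      by (auto simp: indicator_def)
    show ?thesis unfolding eq by measurable
  qed
  show "P \<in> borel_measurable borel"
    unfolding P by measurable
  have "\<bar>P y\<bar> \<le> (\<integral>r. norm (q r * indicator {0..y} r) \<partial>lborel)"
    unfolding P using integral_norm_bound[of lborel "\<lambda>r. q r * indicator {0..y} r"] by simp
  also have "\<dots> \<le> (\<integral>r. K * indicator {0..H} r \<partial>lborel)"
  proof (rule integral_mono)
    show I: "integrable lborel (\<lambda>r. K * indicator {0..H} r)" by (simp add: integrable_Icc)
    have le: "norm (q r * indicator {0..y} r) \<le> K * indicator {0..H} r" for r
      using qb[of r] q0[of r] K0 by (auto simp: indicator_def)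
    show "integrable lborel (\<lambda>r. norm (q r * indicator {0..y} r))"
      by (rule Bochner_Integration.integrable_bound[OF I]) (use le K0 in \<open>auto simp: abs_mult\<close>)
    show "norm (q r * indicator {0..y} r) \<le> K * indicator {0..H} r" for r by (rule le)
  qed
  also have "\<dots> = K * H" using H by simp
  finally show "\<bar>P y\<bar> \<le> K * H" .
qed

text \<open>For fixed \<theta> and i, the equation tested with profiles \<psi> is the hypothesis of
  du Bois-Reymond: F collects the time derivative and the initial value, k is the marginal of
  convective minus viscous momentum flux. The Lipschitz version then admits the profile P with slope
  q.\<close>

lemma weak_solution_profile:
  fixes v i :: "'n::finite"
  assumes W: "0 < W" "0 < H" and sol: "weak_solution v W H \<nu> T u g" and T: "0 < T" and i: "i \<noteq> v"
    and \<theta>: "smooth \<theta>" "\<exists>\<delta>>0. \<forall>t\<ge>T - \<delta>. \<theta> t = 0"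
    and q [measurable]: "q \<in> borel_measurable borel" and qb: "\<And>y. \<bar>q y\<bar> \<le> K" and q0: "\<And>y. y \<notin> {0..H} \<Longrightarrow> q y = 0"
    and mean: "(\<integral>y. q y \<partial>lborel) = 0"
    and P: "\<And>y. P y = (\<integral>r. q r * indicator {0..y} r \<partial>lborel)"
  shows "(\<integral>p. u (fst p) (snd p) $ i * deriv \<theta> (fst p) * P (snd p $ v) \<partial>lebesgue_on ({0..T} \<times> channel v W H))
      + (\<integral>p. \<theta> (fst p) * (u (fst p) (snd p) $ i * u (fst p) (snd p) $ v - \<nu> * g (fst p) (snd p) $ i $ v) * q (snd p $ v)
          \<partial>lebesgue_on ({0..T} \<times> channel v W H))
      + \<theta> 0 * (\<integral>x. u 0 x $ i * P (x $ v) \<partial>lebesgue_on (channel v W H)) = 0"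
proof -
  let ?\<Omega> = "channel v W H" and ?S = "{0..T} \<times> channel v W H"
  let ?f1 = "\<lambda>p. u (fst p) (snd p) $ i * deriv \<theta> (fst p)"
  let ?f2 = "\<lambda>p. (u (fst p) (snd p) $ i * u (fst p) (snd p) $ v - \<nu> * g (fst p) (snd p) $ i $ v) * \<theta> (fst p)"
  let ?f0 = "\<lambda>x. u 0 x $ i"
  have uL: "in_L2 ?S (\<lambda>p. u (fst p) (snd p))" and gL: "in_L2 ?S (\<lambda>p. g (fst p) (snd p))"
    using sol by (simp_all add: weak_solution_def case_prod_beta')
  have u0L: "in_L2 ?\<Omega> (u 0)" using sol T by (simp add: weak_solution_def)
  have c\<theta>: "continuous_on UNIV \<theta>" "continuous_on UNIV (deriv \<theta>)"
    using smooth_continuous[OF \<theta>(1)] smooth_continuous_deriv[OF \<theta>(1)] by auto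
  have [measurable]: "\<theta> \<in> borel_measurable borel" "deriv \<theta> \<in> borel_measurable borel"
    by (intro borel_measurable_continuous_onI c\<theta>)+
  obtain B0 B1 where B: "\<And>t. t \<in> {0..T} \<Longrightarrow> \<bar>\<theta> t\<bar> \<le> B0" "\<And>t. t \<in> {0..T} \<Longrightarrow> \<bar>deriv \<theta> t\<bar> \<le> B1"
    using bounded_on_Icc[OF smooth_continuous[OF \<theta>(1)]] bounded_on_Icc[OF smooth_continuous_deriv[OF \<theta>(1)]] by blast
  have int1: "integrable (lebesgue_on ?S) ?f1"
    by (rule integrable_spacetime_mult_bounded[OF integrable_if_in_L2_spacetime[OF in_L2_nth[OF uL]], of _ B1])
       (use B in auto)
  have int2: "integrable (lebesgue_on ?S) ?f2"
  proof (rule integrable_spacetime_mult_bounded[of _ _ _ _ _ _ B0])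
    show "integrable (lebesgue_on ?S) (\<lambda>p. u (fst p) (snd p) $ i * u (fst p) (snd p) $ v - \<nu> * g (fst p) (snd p) $ i $ v)"
      using in_L2_inner_integrable[OF in_L2_nth[OF uL, of i] in_L2_nth[OF uL, of v]]
        integrable_if_in_L2_spacetime[OF in_L2_nth[OF in_L2_nth[OF gL]], of i v]
      by (intro Bochner_Integration.integrable_diff integrable_mult_right) simp_all
  qed (use B in auto)
  have int0: "integrable (lebesgue_on ?\<Omega>) ?f0"
    \<comment> \<open>Pairing with the constant 1 turns square integrability into integrability on
      the bounded cell.\<close>
    using in_L2_inner_integrable[OF in_L2_nth[OF u0L] in_L2_continuous[OF continuous_on_const[of _ "1::real"]]] by simp
  \<comment> \<open>The same marginal lemma is used in space-time, in the wall-normal direction, so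
    that time is integrated out along with the tangential variables.\<close>
  have b: "(0, axis v 1) \<in> (Basis :: (real \<times> (real^'n)) set)"
    using axis_1_in_Basis by (auto simp: Basis_prod_def)
  have inner: "p \<bullet> (0, axis v 1) = snd p $ v" for p :: "real \<times> (real^'n)"
    by (simp add: inner_prod_def inner_axis_1)
  have Sb: "p \<bullet> (0, axis v 1) \<in> {0..H}" if "p \<in> ?S" for p
    using that by (auto simp: inner channel_def)
  obtain F1 where F1: "integrable lborel F1" "\<And>y. y \<notin> {0..H} \<Longrightarrow> F1 y = 0"
    "\<And>q K. q \<in> borel_measurable borel \<Longrightarrow> (\<And>y. \<bar>q y\<bar> \<le> K) \<Longrightarrow>
       (\<integral>p. ?f1 p * q (snd p $ v) \<partial>lebesgue_on ?S) = (\<integral>y. F1 y * q y \<partial>lborel)"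
    using set_marginal[OF b spacetime_borel Sb int1, unfolded inner] by blast
  obtain k where k: "integrable lborel k" "\<And>y. y \<notin> {0..H} \<Longrightarrow> k y = 0"
    "\<And>q K. q \<in> borel_measurable borel \<Longrightarrow> (\<And>y. \<bar>q y\<bar> \<le> K) \<Longrightarrow>
       (\<integral>p. ?f2 p * q (snd p $ v) \<partial>lebesgue_on ?S) = (\<integral>y. k y * q y \<partial>lborel)"
    using set_marginal[OF b spacetime_borel Sb int2, unfolded inner] by blast
  obtain F0 where F0: "integrable lborel F0" "\<And>y. y \<notin> {0..H} \<Longrightarrow> F0 y = 0"
    "\<And>q K. q \<in> borel_measurable borel \<Longrightarrow> (\<And>y. \<bar>q y\<bar> \<le> K) \<Longrightarrow>
       (\<integral>x. ?f0 x * q (x $ v) \<partial>lebesgue_on ?\<Omega>) = (\<integral>y. F0 y * q y \<partial>lborel)"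
    using channel_marginal[OF int0] by blast
  define F where "F y = F1 y + \<theta> 0 * F0 y" for y
  have split: "(\<integral>y. F y * r y \<partial>lborel) = (\<integral>y. F1 y * r y \<partial>lborel) + \<theta> 0 * (\<integral>y. F0 y * r y \<partial>lborel)"
    if [measurable]: "r \<in> borel_measurable borel" and "\<And>y. \<bar>r y\<bar> \<le> B" for r B
  proof -
    have "integrable lborel (\<lambda>y. F1 y * r y)" "integrable lborel (\<lambda>y. F0 y * r y)"
      using that by (auto intro!: integrable_mult_bounded[of _ _ _ B] F1 F0)
    then show ?thesis by (simp add: F_def distrib_right mult.assoc)
  qed
  have K0: "0 \<le> K" using qb[of 0] by linarith
  have main: "(\<integral>s. F s * (\<integral>y. q y * indicator {0..s} y \<partial>lborel) \<partial>lborel) + (\<integral>y. k y * q y \<partial>lborel) = 0"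
  proof (rule du_bois_reymond_Lipschitz[OF _ k(1) W(2) _ k(2) _ q qb])
    show "integrable lborel F" unfolding F_def using F1 F0 by auto
    show "F y = 0" if "y \<notin> {0..H}" for y using that F1(2) F0(2) by (simp add: F_def)
    have "(\<lambda>y. q y * indicator {0..H} y) = q" using q0 by (auto simp: indicator_def fun_eq_iff)
    then show "(\<integral>y. q y * indicator {0..H} y \<partial>lborel) = 0" using mean by simp
    fix \<psi> assume \<psi>: "bump H \<psi>"
    have sm: "smooth \<psi>" using \<psi> by (simp add: bump_def)
    obtain K1 where K1: "\<And>y. \<bar>\<psi> y\<bar> \<le> K1" using bump_bounded[OF \<psi>] by blast
    have [measurable]: "\<psi> \<in> borel_measurable borel" "deriv \<psi> \<in> borel_measurable borel"
      using smooth_continuous[OF sm] smooth_continuous_deriv[OF sm] by (auto intro: borel_measurable_continuous_onI)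
    obtain K2 where K2: "\<And>y. y \<in> {0..H} \<Longrightarrow> \<bar>deriv \<psi> y\<bar> \<le> K2"
      using bounded_on_Icc[OF smooth_continuous_deriv[OF sm]] by blast
    \<comment> \<open>Pairing with marginals asks for a globally bounded function, and the bound K2
      is only available on [0, H].\<close>
    define d\<psi> where "d\<psi> y = deriv \<psi> y * indicator {0..H} y" for y
    have d\<psi> [measurable]: "d\<psi> \<in> borel_measurable borel" unfolding d\<psi>_def by measurable
    have d\<psi>b: "\<bar>d\<psi> y\<bar> \<le> \<bar>K2\<bar>" for y
      using K2 unfolding d\<psi>_def by (force simp: indicator_def)
    note test = solenoidal_test_profile(1)[OF i \<theta> \<psi>, where W = W] solenoidal_test_profile(2,3)[OF i \<theta> \<psi>]
    have "(\<integral>p. u (fst p) (snd p) \<bullet> ((deriv \<theta> (fst p) * \<psi> (snd p $ v)) *\<^sub>R axis i 1)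
        + u (fst p) (snd p) \<bullet> ((\<chi> k j. if k = i \<and> j = v then \<theta> (fst p) * deriv \<psi> (snd p $ v) else 0) *v u (fst p) (snd p))
        - \<nu> * (g (fst p) (snd p) \<bullet> (\<chi> k j. if k = i \<and> j = v then \<theta> (fst p) * deriv \<psi> (snd p $ v) else 0)) \<partial>lebesgue_on ?S)
        + (\<integral>x. u 0 x \<bullet> ((\<theta> 0 * \<psi> (x $ v)) *\<^sub>R axis i 1) \<partial>lebesgue_on ?\<Omega>) = 0"
      by (rule sol[unfolded weak_solution_def case_prod_beta', THEN conjunct2, THEN conjunct2, THEN conjunct2,
          THEN conjunct2, THEN conjunct2, THEN conjunct2, rule_format, OF test(1), unfolded test(2,3)])
    also have "(\<lambda>p. u (fst p) (snd p) \<bullet> ((deriv \<theta> (fst p) * \<psi> (snd p $ v)) *\<^sub>R axis i 1)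
        + u (fst p) (snd p) \<bullet> ((\<chi> k j. if k = i \<and> j = v then \<theta> (fst p) * deriv \<psi> (snd p $ v) else 0) *v u (fst p) (snd p))
        - \<nu> * (g (fst p) (snd p) \<bullet> (\<chi> k j. if k = i \<and> j = v then \<theta> (fst p) * deriv \<psi> (snd p $ v) else 0)))
        = (\<lambda>p. ?f1 p * \<psi> (snd p $ v) + ?f2 p * deriv \<psi> (snd p $ v))"
    proof
      fix p
      have e1: "a \<bullet> ((\<chi> k j. if k = i \<and> j = v then c else 0) *v a) = c * (a $ i * a $ v)" for a :: "real^'n" and c
      proof -
        have "((\<chi> k j. if k = i \<and> j = v then c else 0) *v a) = (c * a $ v) *\<^sub>R axis i 1"
          by (auto simp: matrix_vector_mult_def vec_eq_iff axis_def if_distrib[of "\<lambda>t. t * _"] cong: if_cong)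
        then show ?thesis by (simp add: inner_axis_1)
      qed
      have e2: "a \<bullet> (\<chi> k j. if k = i \<and> j = v then c else 0) = c * a $ i $ v" for a :: "real^'n^'n" and c
      proof -
        have "a \<bullet> (\<chi> k j. if k = i \<and> j = v then c else 0)
            = (\<Sum>k\<in>UNIV. \<Sum>j\<in>UNIV. a $ k $ j * (if k = i \<and> j = v then c else 0))"
          by (simp add: inner_vec_def)
        also have "\<dots> = (\<Sum>k\<in>UNIV. if k = i then (\<Sum>j\<in>UNIV. if j = v then a $ k $ j * c else 0) else 0)"
          by (intro sum.cong refl) (auto simp: if_distrib[of "\<lambda>t. _ * t"] cong: if_cong)
        finally show ?thesis by simp
      qed
      show "u (fst p) (snd p) \<bullet> ((deriv \<theta> (fst p) * \<psi> (snd p $ v)) *\<^sub>R axis i 1)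
        + u (fst p) (snd p) \<bullet> ((\<chi> k j. if k = i \<and> j = v then \<theta> (fst p) * deriv \<psi> (snd p $ v) else 0) *v u (fst p) (snd p))
        - \<nu> * (g (fst p) (snd p) \<bullet> (\<chi> k j. if k = i \<and> j = v then \<theta> (fst p) * deriv \<psi> (snd p $ v) else 0))
        = ?f1 p * \<psi> (snd p $ v) + ?f2 p * deriv \<psi> (snd p $ v)"
        unfolding e1 e2 by (simp add: inner_axis_1 algebra_simps)
    qed
    also have "(\<integral>p. ?f1 p * \<psi> (snd p $ v) + ?f2 p * deriv \<psi> (snd p $ v) \<partial>lebesgue_on ?S)
        = (\<integral>p. ?f1 p * \<psi> (snd p $ v) + ?f2 p * d\<psi> (snd p $ v) \<partial>lebesgue_on ?S)"
      by (rule Bochner_Integration.integral_cong) (auto simp: d\<psi>_def channel_def)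
    also have "\<dots> = (\<integral>p. ?f1 p * \<psi> (snd p $ v) \<partial>lebesgue_on ?S) + (\<integral>p. ?f2 p * d\<psi> (snd p $ v) \<partial>lebesgue_on ?S)"
    proof (rule Bochner_Integration.integral_add)
      show "integrable (lebesgue_on ?S) (\<lambda>p. ?f1 p * \<psi> (snd p $ v))"
        by (rule integrable_spacetime_mult_bounded[OF int1, of _ K1]) (use K1 in auto)
      show "integrable (lebesgue_on ?S) (\<lambda>p. ?f2 p * d\<psi> (snd p $ v))"
        by (rule integrable_spacetime_mult_bounded[OF int2, of _ "\<bar>K2\<bar>"]) (use d\<psi>b in auto)
    qed
    also have "(\<integral>x. u 0 x \<bullet> ((\<theta> 0 * \<psi> (x $ v)) *\<^sub>R axis i 1) \<partial>lebesgue_on ?\<Omega>) = \<theta> 0 * (\<integral>x. ?f0 x * \<psi> (x $ v) \<partial>lebesgue_on ?\<Omega>)"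
      by (simp add: inner_axis_1 mult_ac flip: integral_mult_right_zero)
    finally have "(\<integral>y. F1 y * \<psi> y \<partial>lborel) + (\<integral>y. k y * d\<psi> y \<partial>lborel) + \<theta> 0 * (\<integral>y. F0 y * \<psi> y \<partial>lborel) = 0"
      using F1(3)[of \<psi> K1] F0(3)[of \<psi> K1] k(3)[OF d\<psi> d\<psi>b] K1 by simp
    moreover have "(\<integral>y. k y * d\<psi> y \<partial>lborel) = (\<integral>y. k y * deriv \<psi> y \<partial>lborel)"
      by (rule Bochner_Integration.integral_cong) (use k(2) in \<open>auto simp: d\<psi>_def indicator_def\<close>)
    ultimately show "(\<integral>y. F y * \<psi> y \<partial>lborel) + (\<integral>y. k y * deriv \<psi> y \<partial>lborel) = 0"
      using split[of \<psi> K1] K1 by simp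
  qed
  have Pm: "P \<in> borel_measurable borel" by (rule primitive_props(1)[OF q qb q0 W(2) P])
  have Pb: "\<bar>P y\<bar> \<le> K * H" for y by (rule primitive_props(2)[OF q qb q0 W(2) P])
  have "(\<integral>s. F s * P s \<partial>lborel) + (\<integral>y. k y * q y \<partial>lborel) = 0"
    using main unfolding P .
  then show ?thesis
    unfolding split[OF Pm Pb] F1(3)[OF Pm Pb, symmetric] F0(3)[OF Pm Pb, symmetric] k(3)[OF q qb, symmetric]
    by (simp add: mult_ac)
qed

text \<open>A time density is determined only almost everywhere, so it is compared with the density
  obtained by slicing the weighted function; the weight is constant on each slice.\<close>

lemma time_slices_weighted:
  fixes h :: "real \<times> (real^'n) \<Rightarrow> real"
  assumes T: "0 \<le> T" and h: "integrable (lebesgue_on ({0..T} \<times> channel v W H)) h"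
    and F: "integrable lborel F" "\<And>t. t \<notin> {0..T} \<Longrightarrow> F t = 0"
      "AE t in lborel. t \<in> {0..T} \<longrightarrow> F t = (\<integral>x. h (t, x) \<partial>lebesgue_on (channel v W H))"
    and \<theta>: "continuous_on UNIV \<theta>"
  shows "(\<integral>p. h p * \<theta> (fst p) \<partial>lebesgue_on ({0..T} \<times> channel v W H)) = (\<integral>t. F t * \<theta> t \<partial>lborel)"
proof -
  have [measurable]: "\<theta> \<in> borel_measurable borel" "F \<in> borel_measurable borel"
    using \<theta> F(1) by (auto intro: borel_measurable_continuous_onI)
  obtain B where B: "\<And>t. t \<in> {0..T} \<Longrightarrow> \<bar>\<theta> t\<bar> \<le> B"
    using bounded_on_Icc[OF continuous_on_subset[OF \<theta> subset_UNIV]] by blast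
  have int: "integrable (lebesgue_on ({0..T} \<times> channel v W H)) (\<lambda>p. h p * \<theta> (fst p))"
    by (rule integrable_spacetime_mult_bounded[OF h, of _ B]) (use B in auto)
  then obtain F' where F': "integrable lborel F'" "\<And>t. t \<notin> {0..T} \<Longrightarrow> F' t = 0"
    "AE t in lborel. t \<in> {0..T} \<longrightarrow> F' t = (\<integral>x. h (t, x) * \<theta> (fst (t, x)) \<partial>lebesgue_on (channel v W H))"
    "\<And>t. t \<in> {0..T} \<Longrightarrow> (\<integral>p. h p * \<theta> (fst p) \<partial>lebesgue_on ({0..t} \<times> channel v W H)) = (\<integral>s. F' s * indicator {0..t} s \<partial>lborel)"
    by (rule time_slices) (rule that; (assumption | blast))
  have [measurable]: "F' \<in> borel_measurable borel" using F'(1) by auto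
  have "(\<integral>s. F' s * indicator {0..T} s \<partial>lborel) = (\<integral>t. F t * \<theta> t \<partial>lborel)"
  proof (rule integral_cong_AE)
    show "AE s in lborel. F' s * indicator {0..T} s = F s * \<theta> s"
      using F(3) F'(3)
    proof eventually_elim
      case (elim s)
      then show ?case using F(2)[of s] by (cases "s \<in> {0..T}") simp_all
    qed
  qed auto
  then show ?thesis using F'(4)[of T] T by simp
qed

lemma borel_measurable_vecI:
  fixes f :: "'a \<Rightarrow> real^'n"
  assumes "\<And>i. (\<lambda>x. f x $ i) \<in> borel_measurable M"
  shows "f \<in> borel_measurable M"
  using assms by (subst borel_measurable_euclidean_space) (auto simp: Basis_vec_def inner_axis_1)

lemma L2sq_diff:
  assumes f: "in_L2 S f" and g: "in_L2 S g"
  shows "L2sq S (\<lambda>x. f x - g x) = L2sq S f - 2 * (\<integral>x. f x \<bullet> g x \<partial>lebesgue_on S) + L2sq S g"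
proof -
  have "(norm (f x - g x))\<^sup>2 = (norm (f x))\<^sup>2 - 2 * (f x \<bullet> g x) + (norm (g x))\<^sup>2" for x
    by (simp add: power2_norm_eq_inner inner_diff_left inner_diff_right inner_commute)
  then show ?thesis
    unfolding L2sq_def using f g in_L2_inner_integrable[OF f g] by (simp add: in_L2_def)
qed

text \<open>Test the weak formulation with the steady profile \<open>\<phi>\<close> and add the energy inequality.\<close>

lemma energy_comparison:
  fixes v :: "'n::finite" and q \<phi> :: "real \<Rightarrow> real^'n"
  assumes W: "0 < W" "0 < H" and \<nu>: "0 < \<nu>" and T: "0 < T" and lh: "leray_hopf v W H \<nu> T u g"
    and qm: "\<And>i. (\<lambda>y. q y $ i) \<in> borel_measurable borel" and qb: "\<And>y. norm (q y) \<le> K"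
    and q0: "\<And>y. y \<notin> {0..H} \<Longrightarrow> q y = 0" and qv: "\<And>y. q y $ v = 0" and mean: "\<And>i. (\<integral>y. q y $ i \<partial>lborel) = 0"
    and \<phi>: "\<And>y i. \<phi> y $ i = (\<integral>r. q r $ i * indicator {0..y} r \<partial>lborel)"
    and c: "0 \<le> c" and \<kappa>: "0 \<le> \<kappa>"
    and rate: "\<And>w gw. H10_gradient v W H w gw \<Longrightarrow> (AE x in lebesgue_on (channel v W H). trace (gw x) = 0) \<Longrightarrow>
      - \<nu> * L2sq (channel v W H) gw
      - (\<integral>x. (\<Sum>i\<in>UNIV. (w x $ i * w x $ v - \<nu> * gw x $ i $ v) * q (x $ v) $ i) \<partial>lebesgue_on (channel v W H))
      \<le> (c / 2) * L2sq (channel v W H) (\<lambda>x. w x - \<phi> (x $ v)) - (\<nu> / 8) * L2sq (channel v W H) gw + \<kappa>"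
    and t: "t \<in> {0..T}"
  shows "L2sq (channel v W H) (\<lambda>x. u t x - \<phi> (x $ v)) + (\<nu> / 4) * L2sq ({0..t} \<times> channel v W H) (\<lambda>(s, x). g s x)
    \<le> (L2sq (channel v W H) (\<lambda>x. u 0 x - \<phi> (x $ v)) + 2 * \<kappa> * T) * exp (c * t)"
proof -
  let ?\<Omega> = "channel v W H" and ?S = "{0..T} \<times> channel v W H"
  let ?y = "\<lambda>s. L2sq ?\<Omega> (\<lambda>x. u s x - \<phi> (x $ v))"
  have sol: "weak_solution v W H \<nu> T u g" and en: "energy_inequality v W H \<nu> T u g"
    using lh by (auto simp: leray_hopf_def)
  have uL: "in_L2 ?S (\<lambda>p. u (fst p) (snd p))" and gL: "in_L2 ?S (\<lambda>p. g (fst p) (snd p))"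
    using sol by (simp_all add: weak_solution_def case_prod_beta')
  have utL: "in_L2 ?\<Omega> (u s)" if "s \<in> {0..T}" for s using sol that by (simp add: weak_solution_def)
  have cont: "continuous_on {0..T} (\<lambda>t. \<integral>x. u t x \<bullet> \<psi> x \<partial>lebesgue_on ?\<Omega>)" if "in_L2 ?\<Omega> \<psi>" for \<psi>
    using sol that by (simp add: weak_solution_def)
  have H10: "AE s in lborel. s \<in> {0..T} \<longrightarrow> H10_gradient v W H (u s) (g s) \<and> (AE x in lebesgue_on ?\<Omega>. trace (g s x) = 0)"
    using sol by (subst AE_lebesgue_on_iff[symmetric]) (simp_all add: weak_solution_def)
  have qi: "\<bar>q y $ i\<bar> \<le> K" for y i
    using component_le_norm_cart[of "q y" i] qb[of y] by linarith
  have q0': "q y $ i = 0" if "y \<notin> {0..H}" for y i using q0[OF that] by simp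
  note prim = primitive_props[OF qm qi q0' W(2) \<phi>]
  note [measurable] = qm prim(1)
  have \<phi>b: "norm (\<phi> y) \<le> real CARD('n) * (K * H)" for y
  proof -
    have "norm (\<phi> y) \<le> (\<Sum>i\<in>UNIV. \<bar>\<phi> y $ i\<bar>)" by (rule norm_le_l1_cart)
    also have "\<dots> \<le> (\<Sum>i\<in>(UNIV::'n set). K * H)" by (intro sum_mono prim(2))
    finally show ?thesis by simp
  qed
  have \<phi>v: "\<phi> y $ v = 0" for y by (simp add: \<phi> qv)
  have \<phi>L: "in_L2 ?\<Omega> (\<lambda>x. \<phi> (x $ v))"
    by (rule in_L2_bounded[OF channel_fmeasurable _ \<phi>b])
       (auto intro!: borel_measurable_lebesgue_on borel_measurable_vecI)
  have \<phi>SL: "in_L2 ?S (\<lambda>p. \<phi> (snd p $ v))"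
    by (rule in_L2_bounded[OF spacetime_lmeasurable _ \<phi>b])
       (auto intro!: borel_measurable_lebesgue_on borel_measurable_vecI)
  let ?hE = "\<lambda>p. (norm (u (fst p) (snd p)))\<^sup>2" and ?hG = "\<lambda>p. (norm (g (fst p) (snd p)))\<^sup>2"
  let ?hA = "\<lambda>p. u (fst p) (snd p) \<bullet> \<phi> (snd p $ v)"
  let ?hb = "\<lambda>i p. (u (fst p) (snd p) $ i * u (fst p) (snd p) $ v - \<nu> * g (fst p) (snd p) $ i $ v) * q (snd p $ v) $ i"
  let ?hB = "\<lambda>p. \<Sum>i\<in>UNIV. ?hb i p"
  have intb: "integrable (lebesgue_on ?S) (?hb i)" for i
  proof (rule integrable_spacetime_mult_bounded[of _ _ _ _ _ _ K])
    show "integrable (lebesgue_on ?S) (\<lambda>p. u (fst p) (snd p) $ i * u (fst p) (snd p) $ v - \<nu> * g (fst p) (snd p) $ i $ v)"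
      using in_L2_inner_integrable[OF in_L2_nth[OF uL, of i] in_L2_nth[OF uL, of v]]
        integrable_if_in_L2_spacetime[OF in_L2_nth[OF in_L2_nth[OF gL]], of i v]
      by (intro Bochner_Integration.integrable_diff integrable_mult_right) simp_all
  qed (use qi in auto)
  have inta: "integrable (lebesgue_on ?S) (\<lambda>p. u (fst p) (snd p) $ i * \<phi> (snd p $ v) $ i)" for i
    using in_L2_inner_integrable[OF in_L2_nth[OF uL, of i] in_L2_nth[OF \<phi>SL, of i]] by simp
  have intE: "integrable (lebesgue_on ?S) ?hE" and intG: "integrable (lebesgue_on ?S) ?hG"
    using uL gL by (auto simp: in_L2_def)
  have intA: "integrable (lebesgue_on ?S) ?hA" by (rule in_L2_inner_integrable[OF uL \<phi>SL])
  have intB: "integrable (lebesgue_on ?S) ?hB" by (intro Bochner_Integration.integrable_sum intb)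
  obtain E where E0: "integrable lborel E" "\<And>t. t \<notin> {0..T} \<Longrightarrow> E t = 0"
    "AE s in lborel. s \<in> {0..T} \<longrightarrow> E s = (\<integral>x. ?hE (s, x) \<partial>lebesgue_on ?\<Omega>)"
    "\<And>t. t \<in> {0..T} \<Longrightarrow> (\<integral>p. ?hE p \<partial>lebesgue_on ({0..t} \<times> ?\<Omega>)) = (\<integral>s. E s * indicator {0..t} s \<partial>lborel)"
    by (rule time_slices[OF intE]) (rule that; (assumption | blast))
  have E: "integrable lborel E" "t \<notin> {0..T} \<Longrightarrow> E t = 0" for t
    using E0(1,2) by blast+
  have E3: "AE s in lborel. s \<in> {0..T} \<longrightarrow> E s = L2sq ?\<Omega> (u s)"
    using E0(3) unfolding L2sq_def fst_conv snd_conv .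
  obtain D where D0: "integrable lborel D" "\<And>t. t \<notin> {0..T} \<Longrightarrow> D t = 0"
    "AE s in lborel. s \<in> {0..T} \<longrightarrow> D s = (\<integral>x. ?hG (s, x) \<partial>lebesgue_on ?\<Omega>)"
    "\<And>t. t \<in> {0..T} \<Longrightarrow> (\<integral>p. ?hG p \<partial>lebesgue_on ({0..t} \<times> ?\<Omega>)) = (\<integral>s. D s * indicator {0..t} s \<partial>lborel)"
    by (rule time_slices[OF intG]) (rule that; (assumption | blast))
  have D: "integrable lborel D" "t \<notin> {0..T} \<Longrightarrow> D t = 0" for t
    using D0(1,2) by blast+
  have D3: "AE s in lborel. s \<in> {0..T} \<longrightarrow> D s = L2sq ?\<Omega> (g s)"
    using D0(3) unfolding L2sq_def fst_conv snd_conv .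
  have D4: "L2sq ({0..t} \<times> ?\<Omega>) (\<lambda>(s, x). g s x) = (\<integral>s. D s * indicator {0..t} s \<partial>lborel)" if "t \<in> {0..T}" for t
    using D0(4)[OF that] unfolding L2sq_def case_prod_beta' .
  obtain A where A0: "integrable lborel A" "\<And>t. t \<notin> {0..T} \<Longrightarrow> A t = 0"
    "AE s in lborel. s \<in> {0..T} \<longrightarrow> A s = (\<integral>x. ?hA (s, x) \<partial>lebesgue_on ?\<Omega>)"
    "\<And>t. t \<in> {0..T} \<Longrightarrow> (\<integral>p. ?hA p \<partial>lebesgue_on ({0..t} \<times> ?\<Omega>)) = (\<integral>s. A s * indicator {0..t} s \<partial>lborel)"
    by (rule time_slices[OF intA]) (rule that; (assumption | blast))
  have A: "integrable lborel A" "t \<notin> {0..T} \<Longrightarrow> A t = 0" for t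
    using A0(1,2) by blast+
  have A3: "AE s in lborel. s \<in> {0..T} \<longrightarrow> A s = (\<integral>x. u s x \<bullet> \<phi> (x $ v) \<partial>lebesgue_on ?\<Omega>)"
    using A0(3) unfolding L2sq_def fst_conv snd_conv .
  obtain B where B0: "integrable lborel B" "\<And>t. t \<notin> {0..T} \<Longrightarrow> B t = 0"
    "AE s in lborel. s \<in> {0..T} \<longrightarrow> B s = (\<integral>x. ?hB (s, x) \<partial>lebesgue_on ?\<Omega>)"
    "\<And>t. t \<in> {0..T} \<Longrightarrow> (\<integral>p. ?hB p \<partial>lebesgue_on ({0..t} \<times> ?\<Omega>)) = (\<integral>s. B s * indicator {0..t} s \<partial>lborel)"
    by (rule time_slices[OF intB]) (rule that; (assumption | blast))
  have B: "integrable lborel B" "t \<notin> {0..T} \<Longrightarrow> B t = 0" for t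
    using B0(1,2) by blast+
  have B3: "AE s in lborel. s \<in> {0..T} \<longrightarrow> B s = (\<integral>x. (\<Sum>i\<in>UNIV. (u s x $ i * u s x $ v - \<nu> * g s x $ i $ v) * q (x $ v) $ i) \<partial>lebesgue_on ?\<Omega>)"
    using B0(3) unfolding L2sq_def fst_conv snd_conv .
  define c\<phi> where "c\<phi> = L2sq ?\<Omega> (\<lambda>x. \<phi> (x $ v))"
  \<comment> \<open>An integrable version of the squared distance to \<phi>, expanded: E is the
    energy, A the pairing with \<phi>. Each piece satisfies its own distributional relation in
    time.\<close>
  define Y where "Y s = E s - 2 * A s + c\<phi> * indicator {0..T} s" for s
  define R where "R s = (c / 2) * Y s - (\<nu> / 8) * D s + \<kappa> * indicator {0..T} s" for s
  have Yint: "integrable lborel Y" and Rint: "integrable lborel R"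
    unfolding R_def Y_def using E(1) A(1) D(1) by (auto simp: integrable_Icc)
  have Y0: "Y s = 0" and R0: "R s = 0" if "s \<notin> {0..T}" for s
    using that E(2) A(2) D(2) by (auto simp: Y_def R_def)
  have Yy: "AE s in lborel. s \<in> {0..T} \<longrightarrow> Y s = ?y s"
    using E3 A3
  proof eventually_elim
    case (elim s)
    show ?case
    proof
      assume s: "s \<in> {0..T}"
      then show "Y s = ?y s"
        using elim L2sq_diff[OF utL[OF s] \<phi>L] by (simp add: Y_def c\<phi>_def)
    qed
  qed
  have rateAE: "AE s in lborel. s \<in> {0..T} \<longrightarrow> - \<nu> * D s - B s \<le> R s"
    using H10 D3 B3 Yy
  proof eventually_elim
    case (elim s)
    show ?case
    proof
      assume s: "s \<in> {0..T}"
      have "- \<nu> * L2sq ?\<Omega> (g s) - (\<integral>x. (\<Sum>i\<in>UNIV. (u s x $ i * u s x $ v - \<nu> * g s x $ i $ v) * q (x $ v) $ i) \<partial>lebesgue_on ?\<Omega>)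
        \<le> (c / 2) * ?y s - (\<nu> / 8) * L2sq ?\<Omega> (g s) + \<kappa>"
        by (rule rate) (use elim(1) s in auto)
      then show "- \<nu> * D s - B s \<le> R s"
        using elim s by (simp add: R_def)
    qed
  qed
  have main: "(1/2) * ?y s \<le> (1/2) * ?y 0 + (\<integral>r. R r * indicator {0..s} r \<partial>lborel)" if s: "0 < s" "s \<le> T" for s
  proof -
    have sT: "s \<in> {0..T}" using s by simp
    let ?\<psi> = "\<lambda>x. u s x - \<phi> (x $ v)"
    have \<psi>L: "in_L2 ?\<Omega> ?\<psi>" by (intro in_L2_diff utL[OF sT] \<phi>L)
    \<comment> \<open>The tangent to the square of the norm at u s - \<phi>: it minorises the
      squared distance, with equality at r = s, and it is continuous since u is weakly continuous.
      This is lower semicontinuity in the form required at the time s.\<close>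
    define l where "l r = 2 * ((\<integral>x. u r x \<bullet> ?\<psi> x \<partial>lebesgue_on ?\<Omega>) - (\<integral>x. \<phi> (x $ v) \<bullet> ?\<psi> x \<partial>lebesgue_on ?\<Omega>)) - ?y s" for r
    have l_eq: "l r = 2 * (\<integral>x. (u r x - \<phi> (x $ v)) \<bullet> ?\<psi> x \<partial>lebesgue_on ?\<Omega>) - ?y s" if "r \<in> {0..T}" for r
      using in_L2_inner_integrable[OF utL[OF that] \<psi>L] in_L2_inner_integrable[OF \<phi>L \<psi>L]
      by (simp add: l_def inner_diff_left)
    have ls: "l s = ?y s"
      unfolding l_eq[OF sT] by (simp add: L2sq_def power2_norm_eq_inner)
    have "(1/2) * l s \<le> (1/2) * ?y 0 + (\<integral>r. R r * indicator {0..s} r \<partial>lborel)"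
    proof (rule integrate_distributional_inequality[OF s Yint Y0 Rint R0])
      show "continuous_on {0..T} l"
        unfolding l_def by (intro continuous_intros cont \<psi>L)
      show "AE r in lborel. r \<in> {0..T} \<longrightarrow> l r \<le> Y r"
        using Yy
      proof eventually_elim
        case (elim r)
        show ?case
        proof
          assume r: "r \<in> {0..T}"
          have "0 \<le> L2sq ?\<Omega> (\<lambda>x. (u r x - \<phi> (x $ v)) - ?\<psi> x)" by (rule L2sq_nonneg)
          also have "\<dots> = ?y r - 2 * (\<integral>x. (u r x - \<phi> (x $ v)) \<bullet> ?\<psi> x \<partial>lebesgue_on ?\<Omega>) + ?y s"
            by (rule L2sq_diff[OF in_L2_diff[OF utL[OF r] \<phi>L] \<psi>L])
          finally show "l r \<le> Y r" using elim r by (simp add: l_eq)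
        qed
      qed
    next
      fix \<theta> :: "real \<Rightarrow> real"
      assume \<theta>: "smooth \<theta>" "\<And>s. 0 \<le> \<theta> s" "\<exists>\<delta>>0. \<forall>s\<ge>T - \<delta>. \<theta> s = 0"
      have c\<theta>: "continuous_on UNIV \<theta>" "continuous_on UNIV (deriv \<theta>)"
        using smooth_continuous[OF \<theta>(1)] smooth_continuous_deriv[OF \<theta>(1)] by auto
      have [measurable]: "\<theta> \<in> borel_measurable borel" "deriv \<theta> \<in> borel_measurable borel"
        by (intro borel_measurable_continuous_onI c\<theta>)+
      have [measurable]: "E \<in> borel_measurable borel" "D \<in> borel_measurable borel" "R \<in> borel_measurable borel"
          "B \<in> borel_measurable borel"
        using E(1) D(1) B(1) Rint by auto
      obtain B0 B1 where Bd: "\<And>t. t \<in> {0..T} \<Longrightarrow> \<bar>\<theta> t\<bar> \<le> B0" "\<And>t. t \<in> {0..T} \<Longrightarrow> \<bar>deriv \<theta> t\<bar> \<le> B1"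
        using bounded_on_Icc[OF smooth_continuous[OF \<theta>(1)]] bounded_on_Icc[OF smooth_continuous_deriv[OF \<theta>(1)]] by blast
      have en\<theta>: "- (1/2) * (\<integral>s. E s * deriv \<theta> s \<partial>lborel) - (1/2) * \<theta> 0 * L2sq ?\<Omega> (u 0)
          \<le> - \<nu> * (\<integral>s. D s * \<theta> s \<partial>lborel)"
      proof -
        have "(\<integral>s. deriv \<theta> s * L2sq ?\<Omega> (u s) \<partial>lebesgue_on {0..T}) = (\<integral>s. E s * deriv \<theta> s \<partial>lborel)"
          by (rule lebesgue_on_eq_lborel(2)) (use E E3 in \<open>auto elim!: eventually_mono\<close>)
        moreover have "(\<integral>s. \<theta> s * L2sq ?\<Omega> (g s) \<partial>lebesgue_on {0..T}) = (\<integral>s. D s * \<theta> s \<partial>lborel)"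
          by (rule lebesgue_on_eq_lborel(2)) (use D D3 in \<open>auto elim!: eventually_mono\<close>)
        moreover have "- (1/2) * (\<integral>s. deriv \<theta> s * L2sq ?\<Omega> (u s) \<partial>lebesgue_on {0..T}) - (1/2) * \<theta> 0 * L2sq ?\<Omega> (u 0)
          \<le> - \<nu> * (\<integral>s. \<theta> s * L2sq ?\<Omega> (g s) \<partial>lebesgue_on {0..T})"
          using en \<theta> unfolding energy_inequality_def by blast
        ultimately show ?thesis by simp
      qed
      have weak\<theta>: "(\<integral>s. A s * deriv \<theta> s \<partial>lborel) + (\<integral>s. B s * \<theta> s \<partial>lborel)
          + \<theta> 0 * (\<integral>x. u 0 x \<bullet> \<phi> (x $ v) \<partial>lebesgue_on ?\<Omega>) = 0"
      proof -
        let ?a = "\<lambda>i. \<integral>p. u (fst p) (snd p) $ i * deriv \<theta> (fst p) * \<phi> (snd p $ v) $ i \<partial>lebesgue_on ?S"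
        let ?b = "\<lambda>i. \<integral>p. \<theta> (fst p) * (u (fst p) (snd p) $ i * u (fst p) (snd p) $ v - \<nu> * g (fst p) (snd p) $ i $ v) * q (snd p $ v) $ i \<partial>lebesgue_on ?S"
        let ?c = "\<lambda>i. \<integral>x. u 0 x $ i * \<phi> (x $ v) $ i \<partial>lebesgue_on ?\<Omega>"
        have "?a i + ?b i + \<theta> 0 * ?c i = 0" for i
        proof (cases "i = v")
          case True
          then show ?thesis by (simp add: \<phi>v qv)
        next
          case False
          show ?thesis by (rule weak_solution_profile[OF W sol T False \<theta>(1,3) qm qi q0' mean \<phi>])
        qed
        then have "(\<Sum>i\<in>UNIV. ?a i + ?b i + \<theta> 0 * ?c i) = 0" by simp
        then have sum0: "(\<Sum>i\<in>UNIV. ?a i) + (\<Sum>i\<in>UNIV. ?b i) + \<theta> 0 * (\<Sum>i\<in>UNIV. ?c i) = 0"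
          by (simp add: sum.distrib sum_distrib_left)
        have "(\<Sum>i\<in>UNIV. ?a i) = (\<integral>p. ?hA p * deriv \<theta> (fst p) \<partial>lebesgue_on ?S)"
        proof -
          have "(\<Sum>i\<in>UNIV. ?a i) = (\<Sum>i\<in>UNIV. \<integral>p. u (fst p) (snd p) $ i * \<phi> (snd p $ v) $ i * deriv \<theta> (fst p) \<partial>lebesgue_on ?S)"
            by (simp only: mult.assoc mult.commute[of "deriv \<theta> _"])
          also have "\<dots> = (\<integral>p. (\<Sum>i\<in>UNIV. u (fst p) (snd p) $ i * \<phi> (snd p $ v) $ i * deriv \<theta> (fst p)) \<partial>lebesgue_on ?S)"
            by (intro Bochner_Integration.integral_sum[symmetric] integrable_spacetime_mult_bounded[OF inta, of _ B1])
               (use Bd in auto)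
          finally show ?thesis by (simp add: inner_vec_def sum_distrib_right)
        qed
        moreover have "(\<Sum>i\<in>UNIV. ?b i) = (\<integral>p. ?hB p * \<theta> (fst p) \<partial>lebesgue_on ?S)"
        proof -
          have "(\<Sum>i\<in>UNIV. ?b i) = (\<Sum>i\<in>UNIV. \<integral>p. ?hb i p * \<theta> (fst p) \<partial>lebesgue_on ?S)"
            by (intro sum.cong refl Bochner_Integration.integral_cong) simp
          also have "\<dots> = (\<integral>p. (\<Sum>i\<in>UNIV. ?hb i p * \<theta> (fst p)) \<partial>lebesgue_on ?S)"
            by (intro Bochner_Integration.integral_sum[symmetric] integrable_spacetime_mult_bounded[OF intb, of _ B0])
               (use Bd in auto)
          finally show ?thesis by (simp only: sum_distrib_right)
        qed
        moreover have "(\<Sum>i\<in>UNIV. ?c i) = (\<integral>x. u 0 x \<bullet> \<phi> (x $ v) \<partial>lebesgue_on ?\<Omega>)"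
        proof -
          have u0: "in_L2 ?\<Omega> (u 0)" using T by (intro utL) simp
          have "integrable (lebesgue_on ?\<Omega>) (\<lambda>x. u 0 x $ i * \<phi> (x $ v) $ i)" for i
            using in_L2_inner_integrable[OF in_L2_nth[OF u0, of i] in_L2_nth[OF \<phi>L, of i]] by simp
          then show ?thesis
            by (subst Bochner_Integration.integral_sum[symmetric]) (auto simp: inner_vec_def)
        qed
        moreover have "(\<integral>p. ?hA p * deriv \<theta> (fst p) \<partial>lebesgue_on ?S) = (\<integral>s. A s * deriv \<theta> s \<partial>lborel)"
          by (rule time_slices_weighted[OF less_imp_le[OF T] intA A(1,2) _ c\<theta>(2)]) (use A3 in simp_all)
        moreover have "(\<integral>p. ?hB p * \<theta> (fst p) \<partial>lebesgue_on ?S) = (\<integral>s. B s * \<theta> s \<partial>lborel)"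
          by (rule time_slices_weighted[OF less_imp_le[OF T] intB B(1,2) _ c\<theta>(1)]) (use B3 in simp_all)
        ultimately show ?thesis using sum0 by simp
      qed
      have \<theta>T: "\<theta> T = 0" using \<theta>(3) by fastforce
      \<comment> \<open>The constant c\<phi> integrates to a boundary term at time 0 only, because
        \<theta> vanishes at T. This term cancels against c\<phi> in the initial distance.\<close>
      have IY: "(\<integral>s. Y s * deriv \<theta> s \<partial>lborel)
          = (\<integral>s. E s * deriv \<theta> s \<partial>lborel) - 2 * (\<integral>s. A s * deriv \<theta> s \<partial>lborel) - c\<phi> * \<theta> 0"
      proof -
        have "(\<integral>s. deriv \<theta> s * indicator {0..T} s \<partial>lborel) = - \<theta> 0"
          using integral_deriv_Icc[OF \<theta>(1), of 0 T] T \<theta>T by simp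
        moreover have "integrable lborel (\<lambda>s. deriv \<theta> s * indicator {0..T} s)"
          using integrable_mult_continuous_Icc[OF integrable_Icc _ c\<theta>(2), of 0 T 0 T] by (simp add: mult.commute)
        moreover have "integrable lborel (\<lambda>s. E s * deriv \<theta> s)"
          by (rule integrable_mult_continuous_Icc[OF E(1,2) c\<theta>(2)])
        moreover have "integrable lborel (\<lambda>s. A s * deriv \<theta> s)"
          by (rule integrable_mult_continuous_Icc[OF A(1,2) c\<theta>(2)])
        moreover have "Y s * deriv \<theta> s = E s * deriv \<theta> s - 2 * (A s * deriv \<theta> s) + c\<phi> * (deriv \<theta> s * indicator {0..T} s)" for s
          by (simp add: Y_def algebra_simps)
        ultimately show ?thesis by simp
      qed
      have y0: "?y 0 = L2sq ?\<Omega> (u 0) - 2 * (\<integral>x. u 0 x \<bullet> \<phi> (x $ v) \<partial>lebesgue_on ?\<Omega>) + c\<phi>"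
        unfolding c\<phi>_def using T by (intro L2sq_diff utL \<phi>L) simp
      \<comment> \<open>The cross term of the expanded square is exactly the part of the tested
        momentum equation containing the time derivative and the initial value, so subtracting that
        equation leaves -B.\<close>
      have "- (1/2) * (\<integral>s. Y s * deriv \<theta> s \<partial>lborel) - (1/2) * \<theta> 0 * ?y 0
          \<le> - \<nu> * (\<integral>s. D s * \<theta> s \<partial>lborel) - (\<integral>s. B s * \<theta> s \<partial>lborel)"
        using en\<theta> weak\<theta> unfolding IY y0 by (simp add: algebra_simps)
      also have "\<dots> = (\<integral>s. - \<nu> * (D s * \<theta> s) - B s * \<theta> s \<partial>lborel)"
        using integrable_mult_continuous_Icc[OF D(1,2) c\<theta>(1)] integrable_mult_continuous_Icc[OF B(1,2) c\<theta>(1)] by simp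
      also have "\<dots> \<le> (\<integral>s. R s * \<theta> s \<partial>lborel)"
      proof (rule integral_mono_AE)
        show "integrable lborel (\<lambda>s. - \<nu> * (D s * \<theta> s) - B s * \<theta> s)"
          using integrable_mult_continuous_Icc[OF D(1,2) c\<theta>(1)] integrable_mult_continuous_Icc[OF B(1,2) c\<theta>(1)] by simp
        show "integrable lborel (\<lambda>s. R s * \<theta> s)"
          by (rule integrable_mult_continuous_Icc[OF Rint R0 c\<theta>(1)])
        show "AE s in lborel. - \<nu> * (D s * \<theta> s) - B s * \<theta> s \<le> R s * \<theta> s"
          using rateAE
        proof eventually_elim
          case (elim s)
          show ?case
          proof (cases "s \<in> {0..T}")
            case True
            then have "(- \<nu> * D s - B s) * \<theta> s \<le> R s * \<theta> s"
              using elim \<theta>(2)[of s] by (intro mult_right_mono) auto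
            then show ?thesis by (simp add: algebra_simps)
          next
            case False
            then show ?thesis using D(2)[of s] B(2)[of s] R0[of s] by simp
          qed
        qed
      qed
      finally show "- (1/2) * (\<integral>s. Y s * deriv \<theta> s \<partial>lborel) - (1/2) * \<theta> 0 * ?y 0 \<le> (\<integral>s. R s * \<theta> s \<partial>lborel)" .
    qed
    then show ?thesis by (simp only: ls)
  qed
  let ?a = "?y 0 + 2 * \<kappa> * T"
  have Dnn: "0 \<le> (\<integral>r. D r * indicator {0..s} r \<partial>lborel)" if "s \<in> {0..T}" for s
    using D4[OF that] L2sq_nonneg by metis
  have step: "?y s + (\<nu> / 4) * (\<integral>r. D r * indicator {0..s} r \<partial>lborel) \<le> ?a + c * (\<integral>r. Y r * indicator {0..s} r \<partial>lborel)"
    if s: "0 < s" "s \<le> T" for s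
  proof -
    have int: "integrable lborel (\<lambda>r. f r * indicator {0..s} r)" if "integrable lborel f" for f :: "real \<Rightarrow> real"
      by (rule integrable_mult_bounded[OF that, of _ 1]) (auto simp: indicator_def)
    have "(\<integral>r. R r * indicator {0..s} r \<partial>lborel) = (\<integral>r. (c / 2) * (Y r * indicator {0..s} r)
        - (\<nu> / 8) * (D r * indicator {0..s} r) + \<kappa> * indicator {0..s} r \<partial>lborel)"
      by (rule Bochner_Integration.integral_cong) (use s in \<open>auto simp: R_def indicator_def\<close>)
    also have "\<dots> = (c / 2) * (\<integral>r. Y r * indicator {0..s} r \<partial>lborel) - (\<nu> / 8) * (\<integral>r. D r * indicator {0..s} r \<partial>lborel) + \<kappa> * s"
      using int[OF Yint] int[OF D(1)] s by (simp add: integrable_Icc)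
    finally have "?y s + (\<nu> / 4) * (\<integral>r. D r * indicator {0..s} r \<partial>lborel)
        \<le> ?y 0 + 2 * \<kappa> * s + c * (\<integral>r. Y r * indicator {0..s} r \<partial>lborel)"
      using main[OF s] by simp
    moreover have "\<kappa> * s \<le> \<kappa> * T" using \<kappa> s by (intro mult_left_mono)
    ultimately show ?thesis by simp
  qed
  show ?thesis
  \<comment> \<open>The integrated inequality is available for positive times. At t = 0 the
    dissipation is taken over a null set and the claim follows from nonnegativity of \<kappa>
    T.\<close>
  proof (cases "t = 0")
    case True
    have "(\<integral>s. D s * indicator {0..0} s \<partial>lborel) = 0"
    proof (rule integral_eq_zero_AE)
      show "AE s in lborel. D s * indicator {0..0} s = 0"
        using AE_lborel_singleton[of 0] by eventually_elim (auto simp: indicator_def)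
    qed
    then have "L2sq ({0..0} \<times> ?\<Omega>) (\<lambda>(s, x). g s x) = 0" using D4[of 0] T by simp
    then show ?thesis using True \<kappa> T by simp
  next
    case False
    then have t0: "0 < t" "t \<le> T" using t by auto
    have "?a + c * (\<integral>r. Y r * indicator {0..t} r \<partial>lborel) \<le> ?a * exp (c * t)"
    proof (rule gronwall[OF Yint c less_imp_le[OF t0(1)] t0(2)])
      show "AE s in lborel. s \<in> {0..T} \<longrightarrow> Y s \<le> ?a + c * (\<integral>r. Y r * indicator {0..s} r \<partial>lborel)"
        using Yy AE_lborel_singleton[of 0]
      proof eventually_elim
        case (elim s)
        show ?case
        proof
          assume s: "s \<in> {0..T}"
          then have s': "0 < s" "s \<le> T" using elim(2) by auto
          have "0 \<le> (\<nu> / 4) * (\<integral>r. D r * indicator {0..s} r \<partial>lborel)"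
            using Dnn[OF s] \<nu> by (intro mult_nonneg_nonneg) auto
          then show "Y s \<le> ?a + c * (\<integral>r. Y r * indicator {0..s} r \<partial>lborel)"
            using step[OF s'] elim(1) s by simp
        qed
      qed
    qed
    then show ?thesis using step[OF t0] D4[OF t] by simp
  qed
qed

section \<open>The boundary layer\<close>

text \<open>The set B selects walls. For a singleton it shows that each wall has positive measure by
  itself, so that no wall escapes an almost-everywhere bound.\<close>

lemma emeasure_wall:
  fixes v :: "'n::finite" and W H :: real
  assumes W: "0 < W" "0 < H" and B: "B \<subseteq> {0, H}"
  shows "emeasure (wall_measure v W H) {x \<in> channel v W H. x $ v \<in> B} = ennreal (card B * W ^ (CARD('n) - 1))"
    and "emeasure (wall_measure v W H) (- {x \<in> channel v W H. x $ v \<in> {0, H}}) = 0"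
    and "measure (wall_measure v W H) UNIV = 2 * W ^ (CARD('n) - 1)"
proof -
  let ?R = "\<lambda>i::'n. restrict_space lborel {0..W}"
  let ?C = "count_space {0, H}" and ?P = "PiM (UNIV - {v}) ?R"
  let ?f = "\<lambda>(a :: real, y :: 'n \<Rightarrow> real). (\<chi> i. if i = v then a else y i) :: real^'n"
  have "finite_measure (restrict_space lborel {0..W})"
    by (rule finite_measureI) (simp add: emeasure_restrict_space space_restrict_space emeasure_lborel_Icc_eq)
  then have "sigma_finite_measure (restrict_space lborel {0..W})"
    by (rule finite_measure.axioms(1))
  then interpret product_sigma_finite ?R
    by (simp add: product_sigma_finite_def)
  interpret P: sigma_finite_measure ?P by (rule sigma_finite) simp
  interpret C: sigma_finite_measure ?C by (rule sigma_finite_measure_count_space_finite) simp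
  have f [measurable]: "?f \<in> ?C \<Otimes>\<^sub>M ?P \<rightarrow>\<^sub>M borel"
  proof (rule borel_measurable_vecI)
    fix i
    show "(\<lambda>p. ?f p $ i) \<in> borel_measurable (?C \<Otimes>\<^sub>M ?P)"
    proof (cases "i = v")
      case True
      have "(\<lambda>a::real. a) \<in> ?C \<rightarrow>\<^sub>M borel" by simp
      from measurable_compose[OF measurable_fst this]
      show ?thesis using True by (simp add: case_prod_beta')
    next
      case False
      have "(\<lambda>a::real. a) \<in> restrict_space lborel {0..W} \<rightarrow>\<^sub>M borel"
        by (rule measurable_restrict_space1) simp
      moreover have "(\<lambda>p. snd p i) \<in> ?C \<Otimes>\<^sub>M ?P \<rightarrow>\<^sub>M restrict_space lborel {0..W}"
        by (rule measurable_compose[OF measurable_snd measurable_component_singleton]) (use False in simp)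
      ultimately have "(\<lambda>p. snd p i) \<in> borel_measurable (?C \<Otimes>\<^sub>M ?P)"
        by (rule measurable_compose[rotated])
      then show ?thesis using False by (simp add: case_prod_beta')
    qed
  qed
  have spP: "space ?P = PiE (UNIV - {v}) (\<lambda>_. {0..W})"
    by (simp add: space_PiM space_restrict_space)
  have "emeasure ?P (PiE (UNIV - {v}) (\<lambda>_. {0..W})) = (\<Prod>i\<in>UNIV - {v}. emeasure (?R i) {0..W})"
    by (rule emeasure_PiM) (auto simp: sets_restrict_space)
  also have "\<dots> = ennreal (W ^ (CARD('n) - 1))"
    using W by (simp add: emeasure_restrict_space ennreal_power card_Diff_singleton)
  finally have eP: "emeasure ?P (space ?P) = ennreal (W ^ (CARD('n) - 1))" by (simp only: spP)
  have in_channel: "?f (a, y) \<in> channel v W H" if "a \<in> {0, H}" "y \<in> space ?P" for a y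
    using that W unfolding spP by (auto simp: channel_def PiE_def Pi_def)
  have strip: "{x \<in> channel v W H. x $ v \<in> D} \<in> sets borel" if "finite D" for D
  proof -
    have "(\<lambda>x::real^'n. x $ v) -` D \<inter> space borel \<in> sets borel"
      by (rule measurable_sets[OF channel_nth_borel]) (use that in \<open>simp add: borel_closed finite_imp_closed\<close>)
    moreover have "{x \<in> channel v W H. x $ v \<in> D} = channel v W H \<inter> ((\<lambda>x. x $ v) -` D \<inter> space borel)" by auto
    ultimately show ?thesis by simp
  qed
  have finB: "finite B" using B finite_subset by blast
  have pre: "?f -` {x \<in> channel v W H. x $ v \<in> B} \<inter> space (?C \<Otimes>\<^sub>M ?P) = B \<times> space ?P"
    using B in_channel by (auto simp: space_pair_measure)
  have "emeasure (wall_measure v W H) {x \<in> channel v W H. x $ v \<in> B} = emeasure (?C \<Otimes>\<^sub>M ?P) (B \<times> space ?P)"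
    unfolding wall_measure_def using strip[OF finB] by (subst emeasure_distr) (auto simp only: f pre)
  also have "\<dots> = emeasure ?C B * emeasure ?P (space ?P)"
    by (rule P.emeasure_pair_measure_Times) (use B in auto)
  also have "emeasure ?C B = ennreal (card B)"
    using B finB by (simp add: emeasure_count_space ennreal_of_nat_eq_real_of_nat)
  finally show "emeasure (wall_measure v W H) {x \<in> channel v W H. x $ v \<in> B} = ennreal (card B * W ^ (CARD('n) - 1))"
    using W by (simp add: eP ennreal_mult')
  have pre0: "?f -` (- {x \<in> channel v W H. x $ v \<in> {0, H}}) \<inter> space (?C \<Otimes>\<^sub>M ?P) = {}"
    using in_channel by (auto simp: space_pair_measure)
  show "emeasure (wall_measure v W H) (- {x \<in> channel v W H. x $ v \<in> {0, H}}) = 0"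
    unfolding wall_measure_def using strip[of "{0, H}"]
    by (subst emeasure_distr) (auto simp only: f pre0 emeasure_empty intro!: borel_comp)
  have "emeasure (wall_measure v W H) UNIV = emeasure (?C \<Otimes>\<^sub>M ?P) ({0, H} \<times> space ?P)"
    unfolding wall_measure_def by (subst emeasure_distr) (auto simp: space_pair_measure)
  also have "\<dots> = emeasure ?C {0, H} * emeasure ?P (space ?P)"
    by (rule P.emeasure_pair_measure_Times) auto
  also have "\<dots> = ennreal (2 * W ^ (CARD('n) - 1))"
    using W by (simp add: eP emeasure_count_space ennreal_mult')
  finally show "measure (wall_measure v W H) UNIV = 2 * W ^ (CARD('n) - 1)"
    using W by (simp add: measure_def)
qed

text \<open>The flow is constant on each wall and each wall has positive measure, so a violation at
  one wall would contradict the essential bound.\<close>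

lemma wall_Linf:
  fixes v :: "'n::finite" and U :: "real \<Rightarrow> real^'n"
  assumes W: "0 < W" "0 < H" and ub: "\<And>x. x \<in> channel v W H \<Longrightarrow> ub x = U (x $ v)"
  shows "norm (U 0) \<le> Linf_norm (wall_measure v W H) ub" and "norm (U H) \<le> Linf_norm (wall_measure v W H) ub"
    and "0 \<le> Linf_norm (wall_measure v W H) ub"
proof -
  let ?M = "wall_measure v W H"
  have sets: "sets ?M = sets borel" by (simp add: wall_measure_def)
  have strip: "{x \<in> channel v W H. x $ v = a} \<in> sets borel" for a
  proof -
    have "(\<lambda>x::real^'n. x $ v) -` {a} \<inter> space borel \<in> sets borel"
      by (rule measurable_sets[OF channel_nth_borel]) simp
    moreover have "{x \<in> channel v W H. x $ v = a} = channel v W H \<inter> ((\<lambda>x. x $ v) -` {a} \<inter> space borel)" by auto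
    ultimately show ?thesis by simp
  qed
  have "AE x in ?M. norm (ub x) \<le> max (norm (U 0)) (norm (U H))"
  proof (rule AE_I')
    have "- {x \<in> channel v W H. x $ v \<in> {0, H}} = - ({x \<in> channel v W H. x $ v = 0} \<union> {x \<in> channel v W H. x $ v = H})"
      by auto
    then show "- {x \<in> channel v W H. x $ v \<in> {0, H}} \<in> null_sets ?M"
      using emeasure_wall(2)[OF W, of "{}" v] strip[of 0] strip[of H]
      by (intro null_setsI) (auto simp only: sets intro!: borel_comp sets.Un)
    show "{x \<in> space ?M. \<not> norm (ub x) \<le> max (norm (U 0)) (norm (U H))} \<subseteq> - {x \<in> channel v W H. x $ v \<in> {0, H}}"
      using ub by auto
  qed
  then have "ess_bounded ?M ub" by (auto simp: ess_bounded_def)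
  note L = Linf_norm_props[OF this]
  show "0 \<le> Linf_norm ?M ub" by (rule L(1))
  have wall: "norm (U a) \<le> Linf_norm ?M ub" if a: "a \<in> {0, H}" for a
  proof (rule ccontr)
    assume contra: "\<not> norm (U a) \<le> Linf_norm ?M ub"
    have "AE x in ?M. x \<notin> {x \<in> channel v W H. x $ v = a}"
      using L(2) by eventually_elim (use ub contra in auto)
    then have "{x \<in> channel v W H. x $ v = a} \<in> null_sets ?M"
      using strip[of a] sets by (subst (asm) AE_iff_null_sets[symmetric]) auto
    then have "emeasure ?M {x \<in> channel v W H. x $ v \<in> {a}} = 0" by auto
    then show False using emeasure_wall(1)[OF W, of "{a}" v] a W by simp
  qed
  show "norm (U 0) \<le> Linf_norm ?M ub" "norm (U H) \<le> Linf_norm ?M ub"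
    using wall by auto
qed

text \<open>Only the tangential part h of z meets p, and 2 |z_v| |h| \<le> |z_v|^2 + |h|^2 = |z|^2.
  The factor 1/2 gained in this way makes G, and not 2 G, the Gronwall rate for the squared
  norm.\<close>

lemma transverse_product_le:
  fixes z p :: "real^'n"
  assumes p: "p $ v = 0" "norm p \<le> G"
  shows "\<bar>z $ v * (z \<bullet> p)\<bar> \<le> (G / 2) * (norm z)\<^sup>2"
proof -
  define h where "h = z - (z $ v) *\<^sub>R axis v 1"
  have hp: "z \<bullet> p = h \<bullet> p"
    using p(1) by (simp add: h_def inner_diff_left inner_axis' )
  have hv: "h \<bullet> axis v 1 = 0" 
    by (simp add: h_def inner_diff_left inner_axis_1[of z v] inner_axis_axis)
  have z: "z = h + (z $ v) *\<^sub>R axis v 1" by (simp add: h_def)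
  have "(norm z)\<^sup>2 = (norm h)\<^sup>2 + (z $ v)\<^sup>2"
    by (subst z, subst power2_norm_eq_inner)
       (simp add: inner_add_left inner_add_right hv inner_commute[of "axis v 1" h] power2_norm_eq_inner[of h] power2_eq_square[of "z $ v"] inner_axis_axis)
  moreover have "2 * (\<bar>z $ v\<bar> * norm h) \<le> (z $ v)\<^sup>2 + (norm h)\<^sup>2"
    using sum_squares_bound[of "\<bar>z $ v\<bar>" "norm h"] by simp
  ultimately have zh: "2 * (\<bar>z $ v\<bar> * norm h) \<le> (norm z)\<^sup>2" by simp
  have G: "0 \<le> G" using order.trans[OF norm_ge_zero p(2)] .
  have "\<bar>z $ v * (z \<bullet> p)\<bar> \<le> \<bar>z $ v\<bar> * (norm h * norm p)"
    unfolding hp abs_mult by (intro mult_left_mono Cauchy_Schwarz_ineq2) simp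
  also have "\<dots> \<le> \<bar>z $ v\<bar> * (norm h * G)"
    using p(2) by (intro mult_left_mono) auto
  also have "\<dots> = (G / 2) * (2 * (\<bar>z $ v\<bar> * norm h))" by simp
  also have "\<dots> \<le> (G / 2) * (norm z)\<^sup>2" using zh G by (intro mult_left_mono) auto
  finally show ?thesis .
qed

lemma in_L2_cong:
  assumes "\<And>x. x \<in> S \<Longrightarrow> f x = g x"
  shows "in_L2 S f \<longleftrightarrow> in_L2 S g"
proof -
  have "f \<in> borel_measurable (lebesgue_on S) \<longleftrightarrow> g \<in> borel_measurable (lebesgue_on S)"
    using assms by (intro measurable_cong) simp
  moreover have "integrable (lebesgue_on S) (\<lambda>x. (norm (f x))\<^sup>2) \<longleftrightarrow> integrable (lebesgue_on S) (\<lambda>x. (norm (g x))\<^sup>2)"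
    using assms by (intro Bochner_Integration.integrable_cong) simp_all
  ultimately show ?thesis by (simp add: in_L2_def)
qed

text \<open>Linear layers carry the wall values of U to zero within distance \<delta>. Their slope A
  / \<delta> is paid for twice: in the convective term, which Hardy's inequality and 48 A \<delta>
  \<le> \<nu> absorb into the dissipation, and in the viscous term, which remains as a source of
  order \<nu> A^2 / \<delta> per unit time and wall area.\<close>

lemma boundary_layer_comparison:
  fixes v :: "'n::finite" and U p :: "real \<Rightarrow> real^'n"
  assumes W: "0 < W" "0 < H" and \<nu>: "0 < \<nu>" and T: "0 < T" and lh: "leray_hopf v W H \<nu> T u g"
    and G: "0 \<le> G" and Uv: "\<And>y. U y $ v = 0" and pm: "\<And>i. (\<lambda>y. p y $ i) \<in> borel_measurable borel"
    and pG: "\<And>y. norm (p y) \<le> G" and pv: "\<And>y. p y $ v = 0"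
    and U: "\<And>y i. y \<in> {0..H} \<Longrightarrow> U y $ i = U 0 $ i + (\<integral>r. p r $ i * indicator {0..y} r \<partial>lborel)"
    and A: "norm (U 0) \<le> A" "norm (U H) \<le> A" and \<delta>: "0 < \<delta>" "2 * \<delta> < H" "48 * A * \<delta> \<le> \<nu>"
    and t: "t \<in> {0..T}"
  defines "w \<equiv> W ^ (CARD('n) - 1)"
  shows "L2sq (channel v W H) (\<lambda>x. u t x - U (x $ v)) + (\<nu> / 2) * L2sq ({0..t} \<times> channel v W H) (\<lambda>(s, x). g s x)
    \<le> exp (2 * G * T) * (4 * L2sq (channel v W H) (\<lambda>x. u 0 x - U (x $ v))
      + 2 * \<nu> * G\<^sup>2 * T * (H * w) + 12 * A\<^sup>2 * \<delta> * w + 8 * \<nu> * A\<^sup>2 / \<delta> * T * w)"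
proof -
  let ?\<Omega> = "channel v W H"
  note [measurable] = pm
  have A0: "0 \<le> A" using order.trans[OF norm_ge_zero A(1)] .
  have w0: "0 < w" using W by (simp add: w_def)
  \<comment> \<open>The indicator of the two layers. They are disjoint because 2 \<delta> < H, so b
    takes only the values 0 and 1 and equals its square.\<close>
  define b where "b y = (indicator {0..\<delta>} y + indicator {H - \<delta>..H} y :: real)" for y
  have b01: "b y \<in> {0, 1}" for y using \<delta> by (auto simp: b_def indicator_def)
  have b_abs: "\<bar>b y\<bar> \<le> 1" for y using b01[of y] by auto
  have bm [measurable]: "b \<in> borel_measurable borel" unfolding b_def by measurable
  \<comment> \<open>The slope of the correction. Over the lower layer it adds U 0 and over the upper
    one it subtracts U H; together with the increment U H - U 0 of the shear this sums to zero, so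
    \<phi> vanishes at both walls.\<close>
  define s where "s y = (1 / \<delta>) *\<^sub>R (indicator {0..\<delta>} y *\<^sub>R U 0 - indicator {H - \<delta>..H} y *\<^sub>R U H)" for y
  define q where "q y = indicator {0..H} y *\<^sub>R p y + s y" for y
  define \<phi> where "\<phi> y = (\<chi> i. \<integral>r. q r $ i * indicator {0..y} r \<partial>lborel)" for y
  have sm [measurable]: "(\<lambda>y. s y $ i) \<in> borel_measurable borel" for i
    unfolding s_def by simp
  have qm [measurable]: "(\<lambda>y. q y $ i) \<in> borel_measurable borel" for i
    unfolding q_def by simp
  have sv: "s y $ v = 0" for y by (simp add: s_def Uv)
  have sb: "norm (s y) \<le> (A / \<delta>) * b y" for y
  proof -
    have "norm (indicator {0..\<delta>} y *\<^sub>R U 0 - indicator {H - \<delta>..H} y *\<^sub>R U H) \<le> A * b y"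
      using \<delta> A by (auto simp: b_def indicator_def)
    then have "(1 / \<delta>) * norm (indicator {0..\<delta>} y *\<^sub>R U 0 - indicator {H - \<delta>..H} y *\<^sub>R U H) \<le> (1 / \<delta>) * (A * b y)"
      using \<delta> by (intro mult_left_mono) auto
    then show ?thesis using \<delta> by (simp add: s_def)
  qed
  have sb1: "norm (s y) \<le> A / \<delta>" for y
    using sb[of y] b01[of y] A0 \<delta> by auto
  have qb: "norm (q y) \<le> G + A / \<delta>" for y
  proof -
    have "norm (q y) \<le> norm (indicator {0..H} y *\<^sub>R p y) + norm (s y)"
      unfolding q_def by (rule norm_triangle_ineq)
    also have "norm (indicator {0..H} y *\<^sub>R p y) \<le> G" using pG[of y] G by (auto simp: indicator_def)
    finally show ?thesis using sb1[of y] by simp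
  qed
  have q0: "q y = 0" if "y \<notin> {0..H}" for y
    using that \<delta> by (auto simp: q_def s_def indicator_def)
  have qv: "q y $ v = 0" for y by (simp add: q_def pv sv)
  have int_p: "integrable lborel (\<lambda>r. p r $ i * indicator {0..y} r)" for i y
  proof (rule Bochner_Integration.integrable_bound[of lborel "\<lambda>r. G * indicator {0..y} r"])
    have "\<bar>p r $ i\<bar> \<le> G" for r using component_le_norm_cart[of "p r" i] pG[of r] by linarith
    then show "AE r in lborel. norm (p r $ i * indicator {0..y} r) \<le> norm (G * indicator {0..y} r)"
      using G by (auto simp: indicator_def)
  qed (auto simp: integrable_Icc)
  have prim: "(\<integral>r. q r $ i * indicator {0..y} r \<partial>lborel)
      = U y $ i - U 0 $ i + (min y \<delta> / \<delta>) * U 0 $ i - (max 0 (y - (H - \<delta>)) / \<delta>) * U H $ i"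
    if y: "y \<in> {0..H}" for y i
  proof -
    have I1: "(\<integral>r. indicator {0..min y \<delta>} r \<partial>lborel) = min y \<delta>" using y \<delta> by simp
    have I2: "(\<integral>r. indicator {H - \<delta>..y} r \<partial>lborel) = max 0 (y - (H - \<delta>))" by simp
    have "q r $ i * indicator {0..y} r = p r $ i * indicator {0..y} r
        + ((1 / \<delta>) * U 0 $ i) * indicator {0..min y \<delta>} r - ((1 / \<delta>) * U H $ i) * indicator {H - \<delta>..y} r" for r
      using y \<delta> by (auto simp: q_def s_def indicator_def algebra_simps)
    then have "(\<integral>r. q r $ i * indicator {0..y} r \<partial>lborel) = (\<integral>r. p r $ i * indicator {0..y} r \<partial>lborel)
        + ((1 / \<delta>) * U 0 $ i) * min y \<delta> - ((1 / \<delta>) * U H $ i) * max 0 (y - (H - \<delta>))"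
      using int_p[of i y] I1 I2 by (simp add: integrable_Icc)
    then show ?thesis using U[OF y, of i] by (simp add: mult.commute)
  qed
  have mean: "(\<integral>y. q y $ i \<partial>lborel) = 0" for i
  proof -
    have "(\<lambda>y. q y $ i) = (\<lambda>y. q y $ i * indicator {0..H} y)"
    proof
      fix y show "q y $ i = q y $ i * indicator {0..H} y"
        using q0[of y] by (cases "y \<in> {0..H}") auto
    qed
    then have "(\<integral>y. q y $ i \<partial>lborel) = (\<integral>r. q r $ i * indicator {0..H} r \<partial>lborel)" by simp
    also have "\<dots> = 0" using prim[of H i] W \<delta> by simp
    finally show ?thesis .
  qed
  have \<phi>i: "\<phi> y $ i = (\<integral>r. q r $ i * indicator {0..y} r \<partial>lborel)" for y i by (simp add: \<phi>_def)
  \<comment> \<open>The difference U - \<phi>: it equals U 0 and U H at the walls, decays linearly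
    across the layers and vanishes between them.\<close>
  define ch where "ch y = (1 - min y \<delta> / \<delta>) *\<^sub>R U 0 + (max 0 (y - (H - \<delta>)) / \<delta>) *\<^sub>R U H" for y
  have U\<phi>: "U y = \<phi> y + ch y" if y: "y \<in> {0..H}" for y
    using prim[OF y] by (simp add: vec_eq_iff \<phi>i ch_def algebra_simps)
  have chb: "norm (ch y) \<le> A * b y" if y: "y \<in> {0..H}" for y
  proof -
    have "norm (ch y) \<le> \<bar>1 - min y \<delta> / \<delta>\<bar> * norm (U 0) + \<bar>max 0 (y - (H - \<delta>)) / \<delta>\<bar> * norm (U H)"
      unfolding ch_def using norm_triangle_ineq by (metis norm_scaleR)
    also have "\<dots> \<le> indicator {0..\<delta>} y * A + indicator {H - \<delta>..H} y * A"
    proof (intro add_mono mult_mono A)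
      show "\<bar>1 - min y \<delta> / \<delta>\<bar> \<le> indicator {0..\<delta>} y"
        using y \<delta> by (auto simp: indicator_def min_def abs_if divide_simps)
      show "\<bar>max 0 (y - (H - \<delta>)) / \<delta>\<bar> \<le> indicator {H - \<delta>..H} y"
        using y \<delta> by (auto simp: indicator_def max_def abs_if divide_simps)
    qed auto
    also have "\<dots> = A * b y" by (simp add: b_def algebra_simps)
    finally show ?thesis .
  qed
  have qi: "\<bar>q y $ i\<bar> \<le> G + A / \<delta>" for y i
    using component_le_norm_cart[of "q y" i] qb[of y] by linarith
  have q0i: "q y $ i = 0" if "y \<notin> {0..H}" for y i using q0[OF that] by simp
  note prims = primitive_props[OF qm qi q0i W(2) \<phi>i]
  note [measurable] = prims(1)
  have \<phi>b: "norm (\<phi> y) \<le> real CARD('n) * ((G + A / \<delta>) * H)" for y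
  proof -
    have "norm (\<phi> y) \<le> (\<Sum>i\<in>UNIV. \<bar>\<phi> y $ i\<bar>)" by (rule norm_le_l1_cart)
    also have "\<dots> \<le> (\<Sum>i\<in>(UNIV::'n set). (G + A / \<delta>) * H)" by (intro sum_mono prims(2))
    finally show ?thesis by simp
  qed
  have \<phi>L: "in_L2 ?\<Omega> (\<lambda>x. \<phi> (x $ v))"
    by (rule in_L2_bounded[OF channel_fmeasurable _ \<phi>b])
       (auto intro!: borel_measurable_lebesgue_on borel_measurable_vecI)
  have b_int: "integrable (lebesgue_on ?\<Omega>) (\<lambda>x. b (x $ v))"
    by (rule integrable_bounded_channel[of _ _ _ _ 1]) (simp_all add: b_abs)
  have b_vol: "(\<integral>x. b (x $ v) \<partial>lebesgue_on ?\<Omega>) = 2 * \<delta> * w"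
  proof -
    have "(\<integral>x. b (x $ v) \<partial>lebesgue_on ?\<Omega>) = w * (\<integral>y. b y * indicator {0..H} y \<partial>lborel)"
      unfolding w_def by (rule integral_channel_profile[OF W bm b_abs])
    also have "(\<lambda>y. b y * indicator {0..H} y) = (\<lambda>y. indicator {0..\<delta>} y + indicator {H - \<delta>..H} y)"
      using \<delta> by (auto simp: b_def indicator_def fun_eq_iff)
    also have "(\<integral>y. indicator {0..\<delta>} y + indicator {H - \<delta>..H} y \<partial>lborel) = 2 * \<delta>"
      using \<delta> by (subst Bochner_Integration.integral_add) (auto simp: integrable_Icc)
    finally show ?thesis by simp
  qed
  \<comment> \<open>The source terms after Young's inequality: \<nu> G^2 / 2 over the whole volume
    from the shear, and \<nu> (A / \<delta>)^2 over the layers, whose volume is 2 \<delta>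
    w.\<close>
  define \<kappa> where "\<kappa> = (1/2) * \<nu> * G\<^sup>2 * (H * w) + 2 * \<nu> * A\<^sup>2 / \<delta> * w"
  have \<kappa>0: "0 \<le> \<kappa>" unfolding \<kappa>_def using W \<nu> \<delta> w0 by (intro add_nonneg_nonneg) auto
  have rate: "- \<nu> * L2sq ?\<Omega> gw
      - (\<integral>x. (\<Sum>i\<in>UNIV. (f x $ i * f x $ v - \<nu> * gw x $ i $ v) * q (x $ v) $ i) \<partial>lebesgue_on ?\<Omega>)
      \<le> (G / 2) * L2sq ?\<Omega> (\<lambda>x. f x - \<phi> (x $ v)) - (\<nu> / 8) * L2sq ?\<Omega> gw + \<kappa>"
    if f: "H10_gradient v W H f gw" and div: "AE x in lebesgue_on ?\<Omega>. trace (gw x) = 0" for f gw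
  proof -
    have fL: "in_L2 ?\<Omega> f" and gL: "in_L2 ?\<Omega> gw" using f by (auto simp: H10_gradient_def)
    have zL: "in_L2 ?\<Omega> (\<lambda>x. f x - \<phi> (x $ v))" by (intro in_L2_diff fL \<phi>L)
    define k where "k y = \<phi> y \<bullet> p y" for y
    have km [measurable]: "k \<in> borel_measurable borel" unfolding k_def inner_vec_def by simp
    let ?M = "real CARD('n) * ((G + A / \<delta>) * H)"
    have kb: "\<bar>k y\<bar> \<le> ?M * G" for y
      unfolding k_def using order.trans[OF norm_ge_zero \<phi>b]
      by (intro order.trans[OF Cauchy_Schwarz_ineq2] mult_mono \<phi>b pG) auto
    let ?B = "\<lambda>x. \<Sum>i\<in>UNIV. (f x $ i * f x $ v - \<nu> * gw x $ i $ v) * q (x $ v) $ i"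
    let ?bound = "\<lambda>x. (G / 2) * (norm (f x - \<phi> (x $ v)))\<^sup>2 - f x $ v * k (x $ v) + (A / \<delta> / 2) * (b (x $ v) * (norm (f x))\<^sup>2)
        + \<nu> * ((3/4) * (norm (gw x))\<^sup>2 + (1/2) * G\<^sup>2 + (A / \<delta>)\<^sup>2 * b (x $ v))"
    have pointwise: "- ?B x \<le> ?bound x" if x: "x \<in> ?\<Omega>" for x
    proof -
      let ?y = "x $ v" and ?z = "f x - \<phi> (x $ v)" and ?col = "(\<chi> i. gw x $ i $ v) :: real^'n"
      have y: "?y \<in> {0..H}" using x by (simp add: channel_def)
      have q_eq: "q ?y = p ?y + s ?y" using y by (simp add: q_def)
      have \<phi>v: "\<phi> ?y $ v = 0" by (simp add: \<phi>i qv)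
      have B_eq: "?B x = f x $ v * (f x \<bullet> q ?y) - \<nu> * (?col \<bullet> q ?y)"
        by (simp add: inner_vec_def sum_distrib_left sum_subtractf[symmetric] algebra_simps)
      \<comment> \<open>The shear slope p is paired with f - \<phi>, the quantity in Gronwall's
        inequality, at the price of f_v times a function of height, which has no flux. The layer
        slope s is paired with f itself, ready for Hardy's inequality.\<close>
      have fq: "f x $ v * (f x \<bullet> q ?y) = ?z $ v * (?z \<bullet> p ?y) + f x $ v * k ?y + f x $ v * (f x \<bullet> s ?y)"
        by (simp add: q_eq k_def inner_add_right inner_diff_left \<phi>v algebra_simps)
      have 1: "\<bar>?z $ v * (?z \<bullet> p ?y)\<bar> \<le> (G / 2) * (norm ?z)\<^sup>2"
        by (rule transverse_product_le[OF pv pG])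
      have 2: "\<bar>f x $ v * (f x \<bullet> s ?y)\<bar> \<le> ((A / \<delta>) * b ?y / 2) * (norm (f x))\<^sup>2"
        by (rule transverse_product_le[OF sv sb])
      have col: "norm ?col \<le> norm (gw x)" by (rule norm_column_le)
      have 3: "?col \<bullet> p ?y \<le> (1/2) * (norm (gw x))\<^sup>2 + (1/2) * G\<^sup>2"
      proof -
        have "?col \<bullet> p ?y \<le> norm ?col * norm (p ?y)" by (rule norm_cauchy_schwarz)
        also have "\<dots> \<le> norm (gw x) * G" by (intro mult_mono col pG) auto
        also have "\<dots> \<le> (1/2) * (norm (gw x))\<^sup>2 + (1/2) * G\<^sup>2"
          using sum_squares_bound[of "norm (gw x)" G] by simp
        finally show ?thesis .
      qed
      have 4: "?col \<bullet> s ?y \<le> (1/4) * (norm (gw x))\<^sup>2 + (A / \<delta>)\<^sup>2 * b ?y"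
      proof -
        have "?col \<bullet> s ?y \<le> norm ?col * norm (s ?y)" by (rule norm_cauchy_schwarz)
        also have "\<dots> \<le> norm (gw x) * ((A / \<delta>) * b ?y)"
          by (intro mult_mono col sb) auto
        \<comment> \<open>The weight 1/4 here and 1/2 for the shear leave a quarter of the
          dissipation to absorb the convective layer term.\<close>
        also have "\<dots> \<le> (1/4) * (norm (gw x))\<^sup>2 + ((A / \<delta>) * b ?y)\<^sup>2"
          using sum_squares_bound[of "(1/2) * norm (gw x)" "(A / \<delta>) * b ?y"] by (simp add: power2_eq_square)
        also have "((A / \<delta>) * b ?y)\<^sup>2 = (A / \<delta>)\<^sup>2 * b ?y"
          using b01[of ?y] by auto
        finally show ?thesis .
      qed
      have 5: "\<bar>f x $ v * (f x \<bullet> s ?y)\<bar> \<le> (A / \<delta> / 2) * (b ?y * (norm (f x))\<^sup>2)"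
        using 2 by (simp add: mult_ac)
      have "\<nu> * (?col \<bullet> q ?y) \<le> \<nu> * ((3/4) * (norm (gw x))\<^sup>2 + (1/2) * G\<^sup>2 + (A / \<delta>)\<^sup>2 * b ?y)"
        using \<nu> 3 4 by (intro mult_left_mono) (auto simp: q_eq inner_add_right)
      then show ?thesis
        unfolding B_eq fq using 1 5 by linarith
    qed
    have int_z: "integrable (lebesgue_on ?\<Omega>) (\<lambda>x. (norm (f x - \<phi> (x $ v)))\<^sup>2)"
      and int_g: "integrable (lebesgue_on ?\<Omega>) (\<lambda>x. (norm (gw x))\<^sup>2)"
      and int_f: "integrable (lebesgue_on ?\<Omega>) (\<lambda>x. (norm (f x))\<^sup>2)"
      using zL gL fL by (auto simp: in_L2_def)
    have int_ind: "integrable (lebesgue_on ?\<Omega>) (\<lambda>x. indicator {c..d} (x $ v) * (norm (f x))\<^sup>2)" for c d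
      using integrable_lebesgue_on_mult_bounded[OF int_f, of "\<lambda>x. indicator {c..d} (x $ v)" 1] by (simp add: mult.commute)
    have int_k: "integrable (lebesgue_on ?\<Omega>) (\<lambda>x. f x $ v * k (x $ v))"
      using in_L2_inner_integrable[OF in_L2_nth[OF fL, of v] in_L2_continuous[OF continuous_on_const[of _ "1::real"]]] kb
      by (intro integrable_lebesgue_on_mult_bounded[of _ _ _ "?M * G"]) auto
    have b_split: "(\<lambda>x. b (x $ v) * (norm (f x))\<^sup>2) = (\<lambda>x. indicator {0..\<delta>} (x $ v) * (norm (f x))\<^sup>2
        + indicator {H - \<delta>..H} (x $ v) * (norm (f x))\<^sup>2)"
      by (simp add: b_def distrib_right)
    have int_b: "integrable (lebesgue_on ?\<Omega>) (\<lambda>x. b (x $ v) * (norm (f x))\<^sup>2)"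
      unfolding b_split by (intro Bochner_Integration.integrable_add int_ind)
    have hardy: "(\<integral>x. b (x $ v) * (norm (f x))\<^sup>2 \<partial>lebesgue_on ?\<Omega>) \<le> 8 * \<delta>\<^sup>2 * L2sq ?\<Omega> gw"
    proof -
      have "(\<integral>x. indicator {0..\<delta>} (x $ v) * (norm (f x))\<^sup>2 \<partial>lebesgue_on ?\<Omega>) \<le> 4 * (\<delta> - 0)\<^sup>2 * L2sq ?\<Omega> gw"
        by (rule hardy_H10[OF W f, of 0 \<delta> 0]) (use \<delta> in auto)
      moreover have "(\<integral>x. indicator {H - \<delta>..H} (x $ v) * (norm (f x))\<^sup>2 \<partial>lebesgue_on ?\<Omega>) \<le> 4 * (H - (H - \<delta>))\<^sup>2 * L2sq ?\<Omega> gw"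
        by (rule hardy_H10[OF W f, of "H - \<delta>" H H]) (use \<delta> in auto)
      ultimately show ?thesis
        unfolding b_split Bochner_Integration.integral_add[OF int_ind int_ind] by simp
    qed
    have int_B: "integrable (lebesgue_on ?\<Omega>) ?B"
    proof (intro Bochner_Integration.integrable_sum integrable_lebesgue_on_mult_bounded)
      fix i
      show "integrable (lebesgue_on ?\<Omega>) (\<lambda>x. f x $ i * f x $ v - \<nu> * gw x $ i $ v)"
        using in_L2_inner_integrable[OF in_L2_nth[OF fL, of i] in_L2_nth[OF fL, of v]]
          in_L2_inner_integrable[OF in_L2_nth[OF in_L2_nth[OF gL], of i v] in_L2_continuous[OF continuous_on_const[of _ "1::real"]]]
        by (intro Bochner_Integration.integrable_diff integrable_mult_right) simp_all
      show "\<bar>q (x $ v) $ i\<bar> \<le> G + A / \<delta>" for x by (rule qi)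
    qed measurable
    have int_c: "integrable (lebesgue_on ?\<Omega>) (\<lambda>x. c :: real)" for c by (rule integrable_const_channel)
    have vol: "(\<integral>x. (1/2) * G\<^sup>2 \<partial>lebesgue_on ?\<Omega>) = (1/2) * G\<^sup>2 * (H * w)"
      using measure_channel[OF W, of v] by (simp add: measure_restrict_space w_def)
    have "- (\<integral>x. ?B x \<partial>lebesgue_on ?\<Omega>) = (\<integral>x. - ?B x \<partial>lebesgue_on ?\<Omega>)" by simp
    also have "\<dots> \<le> (\<integral>x. ?bound x \<partial>lebesgue_on ?\<Omega>)"
      by (rule integral_mono)
         (use pointwise in \<open>auto intro!: Bochner_Integration.integrable_add Bochner_Integration.integrable_diff
           Bochner_Integration.integrable_minus integrable_mult_right int_B int_z int_k int_b int_g int_c b_int\<close>)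
    also have "\<dots> = (G / 2) * L2sq ?\<Omega> (\<lambda>x. f x - \<phi> (x $ v)) - (\<integral>x. f x $ v * k (x $ v) \<partial>lebesgue_on ?\<Omega>)
        + (A / \<delta> / 2) * (\<integral>x. b (x $ v) * (norm (f x))\<^sup>2 \<partial>lebesgue_on ?\<Omega>)
        + \<nu> * ((3/4) * L2sq ?\<Omega> gw + (\<integral>x. (1/2) * G\<^sup>2 \<partial>lebesgue_on ?\<Omega>) + (A / \<delta>)\<^sup>2 * (\<integral>x. b (x $ v) \<partial>lebesgue_on ?\<Omega>))"
      unfolding L2sq_def
      by (simp only: Bochner_Integration.integral_add Bochner_Integration.integral_diff integral_mult_right_zero
          Bochner_Integration.integrable_add Bochner_Integration.integrable_diff integrable_mult_right
          int_z int_k int_b int_g int_c b_int)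
    also have "(\<integral>x. f x $ v * k (x $ v) \<partial>lebesgue_on ?\<Omega>) = 0"
      by (rule flux_eq_0[OF W f div km kb])
    also have "(A / \<delta> / 2) * (\<integral>x. b (x $ v) * (norm (f x))\<^sup>2 \<partial>lebesgue_on ?\<Omega>) \<le> (\<nu> / 12) * L2sq ?\<Omega> gw"
    proof -
      have "(A / \<delta> / 2) * (\<integral>x. b (x $ v) * (norm (f x))\<^sup>2 \<partial>lebesgue_on ?\<Omega>) \<le> (A / \<delta> / 2) * (8 * \<delta>\<^sup>2 * L2sq ?\<Omega> gw)"
        using A0 \<delta> by (intro mult_left_mono hardy) auto
      \<comment> \<open>Hardy's constant is 4 \<delta>^2 for each wall, hence 8 \<delta>^2, and 4 A
        \<delta> \<le> \<nu> / 12 is the smallness condition on \<delta>.\<close>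
      also have "\<dots> = (4 * A * \<delta>) * L2sq ?\<Omega> gw"
        using \<delta>(1) by (simp add: power2_eq_square)
      also have "\<dots> \<le> (\<nu> / 12) * L2sq ?\<Omega> gw"
        using \<delta>(3) by (intro mult_right_mono L2sq_nonneg) simp
      finally show ?thesis .
    qed
    finally have "- (\<integral>x. ?B x \<partial>lebesgue_on ?\<Omega>) \<le> (G / 2) * L2sq ?\<Omega> (\<lambda>x. f x - \<phi> (x $ v)) + (\<nu> / 12) * L2sq ?\<Omega> gw
        + \<nu> * ((3/4) * L2sq ?\<Omega> gw + (1/2) * G\<^sup>2 * (H * w) + (A / \<delta>)\<^sup>2 * (2 * \<delta> * w))"
      unfolding vol b_vol by simp
    \<comment> \<open>The sum 3/4 + 1/12 = 5/6 leaves \<nu> / 6 of the dissipation, more than the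
      \<nu> / 8 demanded by \<open>energy_comparison\<close>. That \<nu> / 8 becomes \<nu> / 4 for
      the squared norm and \<nu> / 2 after the final doubling.\<close>
    also have "\<dots> = (G / 2) * L2sq ?\<Omega> (\<lambda>x. f x - \<phi> (x $ v)) + (5/6) * (\<nu> * L2sq ?\<Omega> gw) + \<kappa>"
      using \<delta>(1) by (simp add: \<kappa>_def power2_eq_square field_simps)
    finally have "- (\<integral>x. ?B x \<partial>lebesgue_on ?\<Omega>) \<le> (G / 2) * L2sq ?\<Omega> (\<lambda>x. f x - \<phi> (x $ v)) + (5/6) * (\<nu> * L2sq ?\<Omega> gw) + \<kappa>" .
    moreover have "0 \<le> \<nu> * L2sq ?\<Omega> gw" using \<nu> L2sq_nonneg[of ?\<Omega> gw] by simp
    ultimately show ?thesis by linarith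
  qed
  let ?D = "L2sq ({0..t} \<times> ?\<Omega>) (\<lambda>(s, x). g s x)"
  let ?y = "\<lambda>t. L2sq ?\<Omega> (\<lambda>x. u t x - \<phi> (x $ v))" and ?L = "\<lambda>t. L2sq ?\<Omega> (\<lambda>x. u t x - U (x $ v))"
  have main: "?y t + (\<nu> / 4) * ?D \<le> (?y 0 + 2 * \<kappa> * T) * exp (G * t)"
    by (rule energy_comparison[OF W \<nu> T lh qm qb q0 qv mean \<phi>i G \<kappa>0 rate t])
  have utL: "in_L2 ?\<Omega> (u r)" if "r \<in> {0..T}" for r
    using lh that by (simp add: leray_hopf_def weak_solution_def)
  have cm [measurable]: "(\<lambda>x::real^'n. ch (x $ v)) \<in> borel_measurable borel"
    unfolding ch_def by (intro borel_measurable_continuous_onI continuous_intros) (use \<delta> in auto)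
  have chb1: "norm (ch (x $ v)) \<le> A * b (x $ v)" if "x \<in> ?\<Omega>" for x
    using that by (intro chb) (simp add: channel_def)
  have chA: "norm (ch (x $ v)) \<le> A" if "x \<in> ?\<Omega>" for x
    using chb1[OF that] b01[of "x $ v"] A0 by auto
  have chL: "in_L2 ?\<Omega> (\<lambda>x. ch (x $ v))"
    by (rule in_L2_bounded[OF channel_fmeasurable borel_measurable_lebesgue_on[OF cm] chA])
  have chX: "L2sq ?\<Omega> (\<lambda>x. ch (x $ v)) \<le> 2 * A\<^sup>2 * \<delta> * w"
  proof -
    have "L2sq ?\<Omega> (\<lambda>x. ch (x $ v)) \<le> (\<integral>x. A\<^sup>2 * b (x $ v) \<partial>lebesgue_on ?\<Omega>)"
      unfolding L2sq_def
    proof (rule integral_mono)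
      show "integrable (lebesgue_on ?\<Omega>) (\<lambda>x. (norm (ch (x $ v)))\<^sup>2)" using chL by (simp add: in_L2_def)
      show "integrable (lebesgue_on ?\<Omega>) (\<lambda>x. A\<^sup>2 * b (x $ v))" using b_int by simp
      fix x assume "x \<in> space (lebesgue_on ?\<Omega>)"
      then have "(norm (ch (x $ v)))\<^sup>2 \<le> (A * b (x $ v))\<^sup>2" using chb1[of x] by (intro power_mono) auto
      also have "\<dots> = A\<^sup>2 * b (x $ v)" using b01[of "x $ v"] by auto
      finally show "(norm (ch (x $ v)))\<^sup>2 \<le> A\<^sup>2 * b (x $ v)" .
    qed
    also have "\<dots> = 2 * A\<^sup>2 * \<delta> * w" using b_vol by simp
    finally show ?thesis .
  qed
  have U_eq: "U (x $ v) = \<phi> (x $ v) + ch (x $ v)" if "x \<in> ?\<Omega>" for x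
    using that by (intro U\<phi>) (simp add: channel_def)
  have T0: "0 \<in> {0..T}" using T by simp
  have "?L t = L2sq ?\<Omega> (\<lambda>x. (u t x - \<phi> (x $ v)) + (-1) *\<^sub>R ch (x $ v))"
    unfolding L2sq_def by (rule Bochner_Integration.integral_cong) (use U_eq in \<open>auto simp: algebra_simps\<close>)
  also have "\<dots> \<le> 2 * ?y t + 2 * L2sq ?\<Omega> (\<lambda>x. (-1) *\<^sub>R ch (x $ v))"
    by (intro L2sq_add_le in_L2_diff utL[OF t] \<phi>L in_L2_cmult chL)
  also have "L2sq ?\<Omega> (\<lambda>x. (-1) *\<^sub>R ch (x $ v)) = L2sq ?\<Omega> (\<lambda>x. ch (x $ v))" by (simp add: L2sq_def)
  finally have Lt: "?L t \<le> 2 * ?y t + 4 * A\<^sup>2 * \<delta> * w" using chX by simp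
  have "?y 0 = L2sq ?\<Omega> (\<lambda>x. (u 0 x - U (x $ v)) + ch (x $ v))"
    unfolding L2sq_def by (rule Bochner_Integration.integral_cong) (use U_eq in \<open>auto simp: algebra_simps\<close>)
  also have "\<dots> \<le> 2 * ?L 0 + 2 * L2sq ?\<Omega> (\<lambda>x. ch (x $ v))"
  proof (rule L2sq_add_le[OF _ chL])
    have "in_L2 ?\<Omega> (\<lambda>x. (u 0 x - \<phi> (x $ v)) - ch (x $ v))"
      by (intro in_L2_diff utL[OF T0] \<phi>L chL)
    moreover have "u 0 x - U (x $ v) = (u 0 x - \<phi> (x $ v)) - ch (x $ v)" if "x \<in> ?\<Omega>" for x
      using U_eq[OF that] by simp
    ultimately show "in_L2 ?\<Omega> (\<lambda>x. u 0 x - U (x $ v))"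
      using in_L2_cong[of ?\<Omega> "\<lambda>x. u 0 x - U (x $ v)" "\<lambda>x. (u 0 x - \<phi> (x $ v)) - ch (x $ v)"] by blast
  qed
  finally have L0: "?y 0 \<le> 2 * ?L 0 + 4 * A\<^sup>2 * \<delta> * w" using chX by simp
  let ?e = "exp (2 * G * T)" and ?X = "A\<^sup>2 * \<delta> * w"
  have X0: "0 \<le> ?X" using \<delta> w0 by simp
  have e: "exp (G * t) \<le> ?e" "1 \<le> ?e"
  proof -
    have "G * t \<le> G * T" "0 \<le> G * T" using G t T by (auto intro: mult_left_mono)
    then show "exp (G * t) \<le> ?e" "1 \<le> ?e" by auto
  qed
  \<comment> \<open>Replacing \<phi> by U doubles the estimate and adds 4 X at time t. Doubling the
    initial comparison adds another 8 X, which accounts for the coefficient 12 of the layer volume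
    term.\<close>
  have "?L t + (\<nu> / 2) * ?D \<le> 2 * (?y t + (\<nu> / 4) * ?D) + 4 * ?X" using Lt by simp
  also have "\<dots> \<le> 2 * ((?y 0 + 2 * \<kappa> * T) * ?e) + 4 * ?X * ?e"
  proof (intro add_mono mult_left_mono)
    have "(?y 0 + 2 * \<kappa> * T) * exp (G * t) \<le> (?y 0 + 2 * \<kappa> * T) * ?e"
      using \<kappa>0 T L2sq_nonneg[of ?\<Omega> "\<lambda>x. u 0 x - \<phi> (x $ v)"] e by (intro mult_left_mono) auto
    then show "?y t + (\<nu> / 4) * ?D \<le> (?y 0 + 2 * \<kappa> * T) * ?e" using main by linarith
    show "4 * ?X \<le> 4 * ?X * ?e" using mult_left_mono[OF e(2), of "4 * ?X"] X0 by simp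
  qed simp
  also have "\<dots> = ?e * (2 * ?y 0 + 4 * \<kappa> * T + 4 * ?X)" by (simp add: algebra_simps)
  also have "\<dots> \<le> ?e * (4 * ?L 0 + 2 * \<nu> * G\<^sup>2 * T * (H * w) + 12 * A\<^sup>2 * \<delta> * w + 8 * \<nu> * A\<^sup>2 / \<delta> * T * w)"
  proof (intro mult_left_mono)
    have "4 * \<kappa> * T = 2 * \<nu> * G\<^sup>2 * T * (H * w) + 8 * \<nu> * A\<^sup>2 / \<delta> * T * w"
      by (simp add: \<kappa>_def algebra_simps)
    then show "2 * ?y 0 + 4 * \<kappa> * T + 4 * ?X
        \<le> 4 * ?L 0 + 2 * \<nu> * G\<^sup>2 * T * (H * w) + 12 * A\<^sup>2 * \<delta> * w + 8 * \<nu> * A\<^sup>2 / \<delta> * T * w"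
      using L0 by linarith
  qed simp
  finally show ?thesis .
qed

text \<open>For small Reynolds number the energy inequality alone suffices, the term \<open>2 E / Re\<close> absorbing \<open>6 E\<close>.\<close>

lemma energy_bound:
  fixes v :: "'n::finite"
  assumes W: "0 < W" "0 < H" and \<nu>: "0 < \<nu>" and T: "0 < T" and lh: "leray_hopf v W H \<nu> T u g"
    and f: "in_L2 (channel v W H) f" and t: "t \<in> {0..T}"
  shows "L2sq (channel v W H) (\<lambda>x. u t x - f x) + (\<nu> / 2) * L2sq ({0..t} \<times> channel v W H) (\<lambda>(s, x). g s x)
    \<le> 4 * L2sq (channel v W H) (\<lambda>x. u 0 x - f x) + 6 * L2sq (channel v W H) f"
proof -
  let ?\<Omega> = "channel v W H"
  let ?D = "L2sq ({0..t} \<times> ?\<Omega>) (\<lambda>(s, x). g s x)"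
  have utL: "in_L2 ?\<Omega> (u r)" if "r \<in> {0..T}" for r
    using lh that by (simp add: leray_hopf_def weak_solution_def)
  have u0: "in_L2 ?\<Omega> (u 0)" using T by (intro utL) simp
  have "L2sq ?\<Omega> (\<lambda>x. u t x - 0) + (\<nu> / 4) * ?D \<le> (L2sq ?\<Omega> (\<lambda>x. u 0 x - 0) + 2 * 0 * T) * exp (0 * t)"
  proof (rule energy_comparison[OF W \<nu> T lh, where q = "\<lambda>_. 0" and \<phi> = "\<lambda>_. 0" and K = 0 and c = 0 and \<kappa> = 0])
    fix w :: "real^'n \<Rightarrow> real^'n" and gw :: "real^'n \<Rightarrow> real^'n^'n"
    show "- \<nu> * L2sq ?\<Omega> gw - (\<integral>x. (\<Sum>i\<in>UNIV. (w x $ i * w x $ v - \<nu> * gw x $ i $ v) * (0 :: real^'n) $ i) \<partial>lebesgue_on ?\<Omega>)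
        \<le> 0 / 2 * L2sq ?\<Omega> (\<lambda>x. w x - 0) - \<nu> / 8 * L2sq ?\<Omega> gw + 0"
      using mult_nonneg_nonneg[OF less_imp_le[OF \<nu>] L2sq_nonneg[of ?\<Omega> gw]] by simp
  qed (use t in auto)
  then have main: "L2sq ?\<Omega> (u t) + (\<nu> / 4) * ?D \<le> L2sq ?\<Omega> (u 0)" by simp
  have neg: "in_L2 ?\<Omega> (\<lambda>x. - f x)" using in_L2_cmult[OF f, of "-1"] by simp
  have "L2sq ?\<Omega> (\<lambda>x. u t x - f x) \<le> 2 * L2sq ?\<Omega> (u t) + 2 * L2sq ?\<Omega> f"
    using L2sq_add_le[OF utL[OF t] neg] by (simp add: L2sq_def)
  moreover have "L2sq ?\<Omega> (u 0) \<le> 2 * L2sq ?\<Omega> (\<lambda>x. u 0 x - f x) + 2 * L2sq ?\<Omega> f"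
    using L2sq_add_le[OF in_L2_diff[OF u0 f] f] by simp
  ultimately show ?thesis using main by simp
qed

section \<open>Choice of the layer width\<close>

text \<open>The width balances nothing: it is taken as large as the absorption condition allows,
  because the source \<nu> A^2 / \<delta> decreases with \<delta> while the cost A^2 \<delta> of the
  layer is then of order A \<nu>, that is, A^2 H / Re per unit wall area. This choice fits into the
  channel only if Re is not too small, whence the cases.\<close>

lemma shear_flow_stability:
  fixes v :: "'n::finite"
  assumes W: "0 < W" "0 < H" and \<nu>: "0 < \<nu>" and T: "0 < T"
    and shear: "shear_flow_bounded_vorticity v W H ub D" and lh: "leray_hopf v W H \<nu> T u g"
  defines "\<Omega> \<equiv> channel v W H" and "G \<equiv> Linf_norm (lebesgue_on (channel v W H)) D"
    and "A \<equiv> Linf_norm (wall_measure v W H) ub"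
  shows "(SUP t\<in>{0..T}. ereal (L2sq \<Omega> (\<lambda>x. u t x - ub x) + \<nu> / 2 * L2sq ({0..t} \<times> \<Omega>) (\<lambda>(s, x). g s x)))
    \<le> ereal (exp (2 * G * T) * (4 * L2sq \<Omega> (\<lambda>x. u 0 x - ub x) + 2 * \<nu> * G\<^sup>2 * T * measure lebesgue \<Omega>
      + 200 * A\<^sup>2 * measure lebesgue \<Omega> * inverse (A * H / \<nu>) * ln (2 + A * H / \<nu>)
      + 2 * inverse (A * H / \<nu>) * L2sq \<Omega> ub
      + 200 * A ^ 3 * T * measure (wall_measure v W H) UNIV * (max (H / W) 1)\<^sup>2))"
proof (rule SUP_least, unfold ereal_less_eq)
  fix t assume t: "t \<in> {0..T}"
  define w where "w = W ^ (CARD('n) - 1)"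
  have w0: "0 < w" using W by (simp add: w_def)
  let ?Re = "A * H / \<nu>" and ?lhs = "L2sq \<Omega> (\<lambda>x. u t x - ub x) + \<nu> / 2 * L2sq ({0..t} \<times> \<Omega>) (\<lambda>(s, x). g s x)"
  let ?L = "L2sq \<Omega> (\<lambda>x. u 0 x - ub x)" and ?E = "L2sq \<Omega> ub"
  obtain U p :: "real \<Rightarrow> real^'n" where
    G: "0 \<le> G" and ubU: "\<And>x. x \<in> channel v W H \<Longrightarrow> ub x = U (x $ v)"
    and Uv: "\<And>y. U y $ v = 0" and pm: "\<And>i. (\<lambda>y. p y $ i) \<in> borel_measurable borel"
    and pG: "\<And>y. norm (p y) \<le> G" and pv: "\<And>y. p y $ v = 0"
    and U: "\<And>y i. y \<in> {0..H} \<Longrightarrow> U y $ i = U 0 $ i + (\<integral>r. p r $ i * indicator {0..y} r \<partial>lborel)"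
    using shear_flow_profile[OF W shear] unfolding G_def by blast
  note A = wall_Linf[where U = U and ub = ub, OF W ubU, folded A_def]
  have vol: "measure lebesgue \<Omega> = H * w" unfolding \<Omega>_def w_def by (rule measure_channel[OF W])
  have area: "measure (wall_measure v W H) UNIV = 2 * w" unfolding w_def by (rule emeasure_wall(3)[OF W, of "{}"]) simp
  have L2_ub: "L2sq \<Omega> (\<lambda>x. h x - U (x $ v)) = L2sq \<Omega> (\<lambda>x. h x - ub x)" for h
    unfolding L2sq_def \<Omega>_def by (rule Bochner_Integration.integral_cong) (use ubU in auto)
  have layer: "?lhs \<le> exp (2 * G * T) * (4 * ?L + 2 * \<nu> * G\<^sup>2 * T * (H * w) + 12 * A\<^sup>2 * \<delta> * w + 8 * \<nu> * A\<^sup>2 / \<delta> * T * w)"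
    if "0 < \<delta>" "2 * \<delta> < H" "48 * A * \<delta> \<le> \<nu>" for \<delta>
    using boundary_layer_comparison[OF W \<nu> T lh G Uv pm pG pv U A(1,2) that t]
    unfolding w_def[symmetric] \<Omega>_def[symmetric] L2_ub by simp
  have e1: "1 \<le> exp (2 * G * T)" using G T by simp
  have E0: "0 \<le> ?E" and L0: "0 \<le> ?L" by (rule L2sq_nonneg)+
  let ?m = "(max (H / W) 1)\<^sup>2"
  have m1: "1 \<le> ?m" by (simp add: one_le_power)
  show "?lhs \<le> exp (2 * G * T) * (4 * ?L + 2 * \<nu> * G\<^sup>2 * T * measure lebesgue \<Omega>
      + 200 * A\<^sup>2 * measure lebesgue \<Omega> * inverse ?Re * ln (2 + ?Re)
      + 2 * inverse ?Re * ?E + 200 * A ^ 3 * T * measure (wall_measure v W H) UNIV * ?m)"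
  proof (cases "A = 0")
    \<comment> \<open>Here Re = 0, so \<open>inverse Re\<close> is 0 and the terms containing it
      give no help. All layer terms carry the factor A as well, and any admissible width will do,
      for instance H / 4.\<close>
    case True
    have "?lhs \<le> exp (2 * G * T) * (4 * ?L + 2 * \<nu> * G\<^sup>2 * T * (H * w) + 12 * A\<^sup>2 * (H / 4) * w + 8 * \<nu> * A\<^sup>2 / (H / 4) * T * w)"
      by (rule layer) (use True W \<nu> in auto)
    then show ?thesis using True by (simp add: vol)
  next
    case False
    then have A0: "0 < A" using A(3) by simp
    then have Re: "0 < ?Re" using W \<nu> by simp
    \<comment> \<open>This is how the logarithm is introduced into a bound that has none.\<close>
    have ln: "1 / 2 \<le> ln (2 + ?Re)"
    proof -
      have "(1 / 2 :: real) \<le> ln 2" using ln2_ge_two_thirds by simp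
      also have "\<dots> \<le> ln (2 + ?Re)" using Re by simp
      finally show ?thesis .
    qed
    have inv: "0 \<le> inverse ?Re" by (rule less_imp_le[OF positive_imp_inverse_positive[OF Re]])
    have log_nn: "0 \<le> 200 * A\<^sup>2 * (H * w) * inverse ?Re * ln (2 + ?Re)"
      using inv W w0 ln by (intro mult_nonneg_nonneg) auto
    have flux_nn: "0 \<le> 200 * A ^ 3 * T * (2 * w) * ?m"
      using A0 T w0 by (intro mult_nonneg_nonneg) auto
    have G_nn: "0 \<le> 2 * \<nu> * G\<^sup>2 * T * (H * w)"
      using \<nu> T W w0 by (intro mult_nonneg_nonneg) auto
    show ?thesis
    \<comment> \<open>The threshold makes 2 / Re at least 6, the coefficient of E in
      \<open>energy_bound\<close>. Above it, \<nu> < 3 A H leaves ample room for two layers of width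
      \<nu> / (48 A).\<close>
    proof (cases "?Re \<le> 1 / 3")
      case True
      have "3 \<le> inverse ?Re" using le_imp_inverse_le[OF True Re] by simp
      then have "6 * ?E \<le> 2 * inverse ?Re * ?E" using E0 by (intro mult_right_mono) auto
      \<comment> \<open>The weak gradient only gives integrability of the flow. Square integrability
        comes from its wall values and its slope: each component is at most A + G H.\<close>
      moreover have "in_L2 \<Omega> ub"
      proof -
        have "integrable (lebesgue_on \<Omega>) ub"
          using shear by (simp add: shear_flow_bounded_vorticity_def weak_gradient_def \<Omega>_def)
        moreover have "norm (ub x) \<le> real CARD('n) * (A + G * H)" if x: "x \<in> \<Omega>" for x
        proof -
          have y: "x $ v \<in> {0..H}" using x by (simp add: \<Omega>_def channel_def)
          have "\<bar>U (x $ v) $ i\<bar> \<le> A + G * H" for i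
          proof -
            have pi: "\<bar>p r $ i * indicator {0..H} r\<bar> \<le> G" for r
              using component_le_norm_cart[of "p r" i] pG[of r] G by (auto simp: indicator_def)
            have "(\<integral>r. p r $ i * indicator {0..x $ v} r \<partial>lborel)
                = (\<integral>r. p r $ i * indicator {0..H} r * indicator {0..x $ v} r \<partial>lborel)"
              by (rule Bochner_Integration.integral_cong) (use y in \<open>auto simp: indicator_def\<close>)
            moreover have "\<bar>\<integral>r. p r $ i * indicator {0..H} r * indicator {0..x $ v} r \<partial>lborel\<bar> \<le> G * H"
              by (rule primitive_props(2)[OF _ pi _ W(2) refl]) (use pm[of i] in auto)
            moreover have "\<bar>U 0 $ i\<bar> \<le> A" using component_le_norm_cart[of "U 0" i] A(1) by linarith
            ultimately show ?thesis using U[OF y, of i] by linarith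
          qed
          then have "norm (U (x $ v)) \<le> (\<Sum>i\<in>(UNIV::'n set). A + G * H)"
            by (intro order.trans[OF norm_le_l1_cart] sum_mono)
          then show ?thesis using ubU x by (simp add: \<Omega>_def)
        qed
        ultimately show ?thesis
          unfolding \<Omega>_def by (intro in_L2_bounded[OF channel_fmeasurable]) auto
      qed
      ultimately have "?lhs \<le> 4 * ?L + 2 * inverse ?Re * ?E"
        using energy_bound[OF W \<nu> T lh, folded \<Omega>_def, OF _ t, of ub] by simp
      also have "\<dots> \<le> 4 * ?L + 2 * \<nu> * G\<^sup>2 * T * (H * w)
          + 200 * A\<^sup>2 * (H * w) * inverse ?Re * ln (2 + ?Re) + 2 * inverse ?Re * ?E + 200 * A ^ 3 * T * (2 * w) * ?m"
        using log_nn flux_nn G_nn by linarith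
      also have "\<dots> \<le> exp (2 * G * T) * \<dots>"
      proof -
        have "0 \<le> 4 * ?L + 2 * \<nu> * G\<^sup>2 * T * (H * w)
          + 200 * A\<^sup>2 * (H * w) * inverse ?Re * ln (2 + ?Re) + 2 * inverse ?Re * ?E + 200 * A ^ 3 * T * (2 * w) * ?m"
          using log_nn flux_nn G_nn L0 mult_nonneg_nonneg[OF inv E0] by linarith
        from mult_right_mono[OF e1 this] show ?thesis by simp
      qed
      finally show ?thesis by (simp only: vol area)
    next
      case False
      let ?\<delta> = "\<nu> / (48 * A)"
      have d: "0 < ?\<delta>" using \<nu> A0 by simp
      have "2 * ?\<delta> < H"
      proof -
        have "\<nu> < 3 * (A * H)" using False \<nu> by (simp add: not_le divide_simps)
        moreover have "0 < A * H" using A0 W by simp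
        ultimately have "2 * \<nu> < 48 * (A * H)" by linarith
        also have "\<dots> = H * (48 * A)" by simp
        finally have "2 * \<nu> < H * (48 * A)" .
        then have "(2 * \<nu>) / (48 * A) < H" using A0 by (subst pos_divide_less_eq) simp_all
        then show ?thesis by simp
      qed
      then have main: "?lhs \<le> exp (2 * G * T) * (4 * ?L + 2 * \<nu> * G\<^sup>2 * T * (H * w) + 12 * A\<^sup>2 * ?\<delta> * w + 8 * \<nu> * A\<^sup>2 / ?\<delta> * T * w)"
        using d A0 by (intro layer) auto
      \<comment> \<open>Since 12 / 48 = 1/4 and A^2 H / Re = A \<nu>, the layer volume term is a
        quarter of the expression without the logarithm, well within the constant.\<close>
      have "12 * A\<^sup>2 * ?\<delta> * w = (1/4) * (A\<^sup>2 * (H * w) * inverse ?Re)"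
        using A0 W \<nu> by (simp add: field_simps power2_eq_square)
      also have "\<dots> \<le> (200 * ln (2 + ?Re)) * (A\<^sup>2 * (H * w) * inverse ?Re)"
        using ln inv W w0 by (intro mult_right_mono mult_nonneg_nonneg) auto
      also have "\<dots> = 200 * A\<^sup>2 * (H * w) * inverse ?Re * ln (2 + ?Re)"
        by (simp only: mult_ac)
      finally have 1: "12 * A\<^sup>2 * ?\<delta> * w \<le> 200 * A\<^sup>2 * (H * w) * inverse ?Re * ln (2 + ?Re)" .
      \<comment> \<open>Inserting \<delta> gives 8 * 48 = 384 times w, and 192 times the area 2 w of
        the two walls. This is the term that dictates the constant, rounded up to 200.\<close>
      have "8 * \<nu> * A\<^sup>2 / ?\<delta> * T * w = (192 * A ^ 3 * T * (2 * w)) * 1"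
        using A0 \<nu> by (simp add: field_simps power2_eq_square power3_eq_cube)
      also have "\<dots> \<le> (200 * A ^ 3 * T * (2 * w)) * ?m"
        using A0 T w0 m1 by (intro mult_mono) auto
      finally have 2: "8 * \<nu> * A\<^sup>2 / ?\<delta> * T * w \<le> 200 * A ^ 3 * T * (2 * w) * ?m" .
      have 3: "0 \<le> 2 * inverse ?Re * ?E" using inv E0 by (intro mult_nonneg_nonneg) auto
      have "4 * ?L + 2 * \<nu> * G\<^sup>2 * T * (H * w) + 12 * A\<^sup>2 * ?\<delta> * w + 8 * \<nu> * A\<^sup>2 / ?\<delta> * T * w
          \<le> 4 * ?L + 2 * \<nu> * G\<^sup>2 * T * (H * w)
          + 200 * A\<^sup>2 * (H * w) * inverse ?Re * ln (2 + ?Re) + 2 * inverse ?Re * ?E + 200 * A ^ 3 * T * (2 * w) * ?m"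
        using 1 2 3 by linarith
      then have "exp (2 * G * T) * (4 * ?L + 2 * \<nu> * G\<^sup>2 * T * (H * w) + 12 * A\<^sup>2 * ?\<delta> * w + 8 * \<nu> * A\<^sup>2 / ?\<delta> * T * w)
          \<le> exp (2 * G * T) * (4 * ?L + 2 * \<nu> * G\<^sup>2 * T * (H * w)
          + 200 * A\<^sup>2 * (H * w) * inverse ?Re * ln (2 + ?Re) + 2 * inverse ?Re * ?E + 200 * A ^ 3 * T * (2 * w) * ?m)"
        by (rule mult_left_mono) simp
      with main show ?thesis unfolding vol area by linarith
    qed
  qed
qed

theorem theorem1p5:
  shows "\<exists>C::real. C > 0 \<and>
     (\<forall>(W::real) (H::real) (\<nu>::real) (T::real)
            (ubar :: real^2 \<Rightarrow> real^2) (Dubar :: real^2 \<Rightarrow> real^2^2)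
            (u :: real \<Rightarrow> real^2 \<Rightarrow> real^2) (Du :: real \<Rightarrow> real^2 \<Rightarrow> real^2^2).
          0 < W \<and> 0 < H \<and> 0 < \<nu> \<and> 0 < T \<and>
          shear_flow_bounded_vorticity 2 W H ubar Dubar \<and>
          leray_hopf 2 W H \<nu> T u Du \<longrightarrow>
          (let \<Omega> = channel (2::2) W H;
               vol = measure lebesgue \<Omega>;
               area = measure (wall_measure (2::2) W H) UNIV;
               G = Linf_norm (lebesgue_on \<Omega>) Dubar;
               A = Linf_norm (wall_measure 2 W H) ubar;
               E = L2sq \<Omega> ubar;
               Re = A * H / \<nu>
           in (SUP t\<in>{0..T}. ereal (L2sq \<Omega> (\<lambda>x. u t x - ubar x)
                  + \<nu> / 2 * L2sq ({0..t} \<times> \<Omega>) (\<lambda>(s, x). Du s x)))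
              \<le> ereal (exp (2 * G * T) *
                  (4 * L2sq \<Omega> (\<lambda>x. u 0 x - ubar x)
                   + 2 * \<nu> * G\<^sup>2 * T * vol
                   + C * A\<^sup>2 * vol * inverse Re * ln (2 + Re)
                   + 2 * inverse Re * E
                   + C * A ^ 3 * T * area * (max (H / W) 1)\<^sup>2)))) \<and>
     (\<forall>(W::real) (H::real) (\<nu>::real) (T::real)
            (ubar :: real^3 \<Rightarrow> real^3) (Dubar :: real^3 \<Rightarrow> real^3^3)
            (u :: real \<Rightarrow> real^3 \<Rightarrow> real^3) (Du :: real \<Rightarrow> real^3 \<Rightarrow> real^3^3).
          0 < W \<and> 0 < H \<and> 0 < \<nu> \<and> 0 < T \<and>
          shear_flow_bounded_vorticity 3 W H ubar Dubar \<and>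
          leray_hopf 3 W H \<nu> T u Du \<longrightarrow>
          (let \<Omega> = channel (3::3) W H;
               vol = measure lebesgue \<Omega>;
               area = measure (wall_measure (3::3) W H) UNIV;
               G = Linf_norm (lebesgue_on \<Omega>) Dubar;
               A = Linf_norm (wall_measure 3 W H) ubar;
               E = L2sq \<Omega> ubar;
               Re = A * H / \<nu>
           in (SUP t\<in>{0..T}. ereal (L2sq \<Omega> (\<lambda>x. u t x - ubar x)
                  + \<nu> / 2 * L2sq ({0..t} \<times> \<Omega>) (\<lambda>(s, x). Du s x)))
              \<le> ereal (exp (2 * G * T) *
                  (4 * L2sq \<Omega> (\<lambda>x. u 0 x - ubar x)
                   + 2 * \<nu> * G\<^sup>2 * T * vol
                   + C * A\<^sup>2 * vol * inverse Re * ln (2 + Re)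
                   + 2 * inverse Re * E
                   + C * A ^ 3 * T * area * (max (H / W) 1)\<^sup>2))))"
  unfolding Let_def
  \<comment> \<open>The stability estimate holds for every finite index type and every choice of the
    wall-normal index, so the same constant serves both dimensions.\<close>
  by (intro exI[of _ 200] conjI allI impI; (elim conjE)?) (simp, (rule shear_flow_stability; assumption)+)

end
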